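(* Let $G=(V,E)$ be a finite symmetric directed graph with every vertex of positive degree, and $m\ge1$. Consider $m$ independent continuous-time random walkers on $G$ (a "multiple random walk" in which the cost of sampling a vertex $v$ is exponentially distributed with parameter $\deg(v)$): a walker at vertex $v$ waits an exponentially distributed time with rate $\deg(v)$, then moves to an out-neighbour of $v$ chosen uniformly at random, independently of everything else. Then the joint process $(v_1(\tau),\dots,v_m(\tau))$ is equivalent to a Frontier Sampling process: it is a continuous-time Markov chain on $V^m$ with transition rate matrix $\mathbf Q=\mathbf A-\mathbf D$, where $\mathbf A$ is the adjacency matrix of the Cartesian power $G^m$ and $\mathbf D$ is the diagonal matrix of row sums of $\mathbf A$, and its sequence of visited states (embedded jump chain) has transition matrix $\mathbf D^{-1}\mathbf A$, which is the transition matrix of Frontier Sampling.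
   Context: Frontier Sampling (FS) with $m$ walkers is the discrete-time Markov chain on $V^m$ which, from state $(v_1,\dots,v_m)$, selects index $i$ with probability $\deg(v_i)/\sum_j\deg(v_j)$ and replaces $v_i$ by a uniformly random out-neighbour of $v_i$. The Cartesian power $G^m=(V^m,E_m)$ has $(\mathbf v,\mathbf u)\in E_m$ iff there is an index $i$ with $(v_i,u_i)\in E$ and $u_j=v_j$ for all $j\neq i$. $\deg(v)$ is the (common) in- and out-degree of $v$ in $G$.
   Formalization: The graph is assumed to have no loops: with loops the claim fails (for V={a,b} with all four arcs and m=2, the matrix D^{-1}A keeps (a,a) fixed with probability 1/3, Frontier Sampling with probability 1/2). *)

theory Defs
  imports "HOL-Probability.Probability" "Graph_Theory.Graph_Theory"
begin

section \<open>Graphs and their Cartesian powers\<close>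

abbreviation deg :: "'v pair_pre_digraph \<Rightarrow> 'v \<Rightarrow> nat" where
  "deg G v \<equiv> out_degree (with_proj G) v"

lemma (in pair_graph) in_degree_eq_deg: "in_degree (with_proj G) v = deg G v"
proof -
  have "bij_betw prod.swap (in_arcs (with_proj G) v) (out_arcs (with_proj G) v)"
    using pair_sym_arcs
    by (intro bij_betwI[where g = prod.swap])
       (auto simp: symmetric_def in_arcs_def out_arcs_def dest: symD)
  then show ?thesis
    unfolding in_degree_def out_degree_def by (rule bij_betw_same_card)
qed

definition out_nbrs :: "'v pair_pre_digraph \<Rightarrow> 'v \<Rightarrow> 'v set" where
  "out_nbrs G v = {u. (v, u) \<in> parcs G}"

text \<open>The elements of $V^m$ are the functions on \<^term>\<open>{..<m}\<close> with values in $V$,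
  extended by \<^term>\<open>undefined\<close>.\<close>

definition cart_power :: "'v pair_pre_digraph \<Rightarrow> nat \<Rightarrow> (nat \<Rightarrow> 'v) pair_pre_digraph" where
  "cart_power G m =
    (let S = {..<m} \<rightarrow>\<^sub>E pverts G in
     \<lparr> pverts = S,
       parcs = {(v, u) \<in> S \<times> S.
         \<exists>i<m. (v i, u i) \<in> parcs G \<and> (\<forall>j<m. j \<noteq> i \<longrightarrow> u j = v j)} \<rparr>)"

section \<open>Matrices indexed by the vertices of a graph\<close>

definition adj_matrix :: "'s pair_pre_digraph \<Rightarrow> 's \<Rightarrow> 's \<Rightarrow> real" where
  "adj_matrix H x y = of_bool ((x, y) \<in> parcs H)"

definition diag :: "('s \<Rightarrow> real) \<Rightarrow> 's \<Rightarrow> 's \<Rightarrow> real" where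
  "diag d x y = (if x = y then d x else 0)"

definition row_sum :: "'s pair_pre_digraph \<Rightarrow> 's \<Rightarrow> real" where
  "row_sum H x = (\<Sum>y\<in>pverts H. adj_matrix H x y)"

definition deg_matrix :: "'s pair_pre_digraph \<Rightarrow> 's \<Rightarrow> 's \<Rightarrow> real" where
  "deg_matrix H = diag (row_sum H)"

definition deg_matrix_inv :: "'s pair_pre_digraph \<Rightarrow> 's \<Rightarrow> 's \<Rightarrow> real" where
  "deg_matrix_inv H = diag (\<lambda>x. inverse (row_sum H x))"

definition mat_mult :: "'s set \<Rightarrow> ('s \<Rightarrow> 's \<Rightarrow> real) \<Rightarrow> ('s \<Rightarrow> 's \<Rightarrow> real) \<Rightarrow> 's \<Rightarrow> 's \<Rightarrow> real" where
  "mat_mult S A B x y = (\<Sum>z\<in>S. A x z * B z y)"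

lemma deg_matrix_inv_mult:
  assumes "finite (pverts H)" "\<And>x. x \<in> pverts H \<Longrightarrow> row_sum H x \<noteq> 0"
    and "x \<in> pverts H" "y \<in> pverts H"
  shows "mat_mult (pverts H) (deg_matrix_inv H) (deg_matrix H) x y = of_bool (x = y)"
proof -
  have "mat_mult (pverts H) (deg_matrix_inv H) (deg_matrix H) x y =
      (\<Sum>z\<in>pverts H. if z = x then of_bool (x = y) else 0)"
    unfolding mat_mult_def using assms
    by (intro sum.cong) (auto simp: deg_matrix_inv_def deg_matrix_def diag_def)
  with assms show ?thesis by simp
qed

definition rate_matrix :: "'s pair_pre_digraph \<Rightarrow> 's \<Rightarrow> 's \<Rightarrow> real" where
  "rate_matrix H x y = adj_matrix H x y - deg_matrix H x y"

definition jump_matrix :: "'s pair_pre_digraph \<Rightarrow> 's \<Rightarrow> 's \<Rightarrow> real" where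
  "jump_matrix H = mat_mult (pverts H) (deg_matrix_inv H) (adj_matrix H)"

section \<open>Frontier Sampling\<close>

definition select_walker :: "'v pair_pre_digraph \<Rightarrow> nat \<Rightarrow> (nat \<Rightarrow> 'v) \<Rightarrow> nat pmf" where
  "select_walker G m v =
    embed_pmf (\<lambda>i. if i < m then real (deg G (v i)) / (\<Sum>j<m. real (deg G (v j))) else 0)"

definition frontier_step :: "'v pair_pre_digraph \<Rightarrow> nat \<Rightarrow> (nat \<Rightarrow> 'v) \<Rightarrow> (nat \<Rightarrow> 'v) pmf" where
  "frontier_step G m v =
    bind_pmf (select_walker G m v) (\<lambda>i.
      map_pmf (\<lambda>u. v(i := u)) (pmf_of_set (out_nbrs G (v i))))"

definition frontier_matrix ::
    "'v pair_pre_digraph \<Rightarrow> nat \<Rightarrow> (nat \<Rightarrow> 'v) \<Rightarrow> (nat \<Rightarrow> 'v) \<Rightarrow> real" where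
  "frontier_matrix G m v u = pmf (frontier_step G m v) u"

section \<open>Markov chains on a finite state space\<close>

definition discrete_markov_chain ::
    "'a measure \<Rightarrow> 's set \<Rightarrow> ('s \<Rightarrow> 's \<Rightarrow> real) \<Rightarrow> (nat \<Rightarrow> 'a \<Rightarrow> 's) \<Rightarrow> bool" where
  "discrete_markov_chain M S P Z \<longleftrightarrow>
    (\<forall>n. Z n \<in> M \<rightarrow>\<^sub>M count_space S) \<and>
    (\<forall>n z. (\<forall>k\<le>Suc n. z k \<in> S) \<longrightarrow>
       \<P>(\<omega> in M. \<forall>k\<le>n. Z k \<omega> = z k) \<noteq> 0 \<longrightarrow>
       \<P>(\<omega> in M. Z (Suc n) \<omega> = z (Suc n) \<bar> \<forall>k\<le>n. Z k \<omega> = z k) = P (z n) (z (Suc n)))"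

definition transition_function :: "'s set \<Rightarrow> (real \<Rightarrow> 's \<Rightarrow> 's \<Rightarrow> real) \<Rightarrow> bool" where
  "transition_function S P \<longleftrightarrow>
    (\<forall>t\<ge>0. \<forall>x\<in>S. (\<forall>y\<in>S. 0 \<le> P t x y) \<and> (\<Sum>y\<in>S. P t x y) = 1) \<and>
    (\<forall>x\<in>S. \<forall>y\<in>S. P 0 x y = of_bool (x = y)) \<and>
    (\<forall>s\<ge>0. \<forall>t\<ge>0. \<forall>x\<in>S. \<forall>y\<in>S. P (s + t) x y = mat_mult S (P s) (P t) x y)"

text \<open>A right-continuous (for the discrete topology on $S$), time-homogeneous Markov process
  whose transition function has derivative $Q$ at time $0$; as $S$ is finite, this determines the
  transition function as $e^{tQ}$.\<close>

definition continuous_time_markov_chain ::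
    "'a measure \<Rightarrow> 's set \<Rightarrow> ('s \<Rightarrow> 's \<Rightarrow> real) \<Rightarrow> (real \<Rightarrow> 'a \<Rightarrow> 's) \<Rightarrow> bool" where
  "continuous_time_markov_chain M S Q X \<longleftrightarrow>
    (\<forall>t\<ge>0. X t \<in> M \<rightarrow>\<^sub>M count_space S) \<and>
    (AE \<omega> in M. \<forall>t\<ge>0. \<exists>\<epsilon>>0. \<forall>s\<in>{t..<t + \<epsilon>}. X s \<omega> = X t \<omega>) \<and>
    (\<exists>P. transition_function S P \<and>
      (\<forall>x\<in>S. \<forall>y\<in>S. ((\<lambda>t. P t x y) has_real_derivative Q x y) (at_right 0)) \<and>
      (\<forall>n t x. 0 \<le> t 0 \<longrightarrow> (\<forall>k\<le>n. t k < t (Suc k)) \<longrightarrow> (\<forall>k\<le>Suc n. x k \<in> S) \<longrightarrow>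
         \<P>(\<omega> in M. \<forall>k\<le>n. X (t k) \<omega> = x k) \<noteq> 0 \<longrightarrow>
         \<P>(\<omega> in M. X (t (Suc n)) \<omega> = x (Suc n) \<bar> \<forall>k\<le>n. X (t k) \<omega> = x k)
           = P (t (Suc n) - t n) (x n) (x (Suc n))))"

primrec jump_time :: "(real \<Rightarrow> 's) \<Rightarrow> nat \<Rightarrow> real" where
  "jump_time f 0 = 0"
| "jump_time f (Suc n) = Inf {t. jump_time f n \<le> t \<and> f t \<noteq> f (jump_time f n)}"

definition jump_chain :: "(real \<Rightarrow> 'a \<Rightarrow> 's) \<Rightarrow> nat \<Rightarrow> 'a \<Rightarrow> 's" where
  "jump_chain X n \<omega> = X (jump_time (\<lambda>t. X t \<omega>) n) \<omega>"

section \<open>Continuous-time random walkers\<close>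

text \<open>A walker is given by the sequence $Y_0, Y_1, \dots$ of vertices it visits and the times
  $W_0, W_1, \dots$ it waits there.  The history at step $n$ is generated by
  $Y_0, \dots, Y_n$ and $W_0, \dots, W_{n-1}$.\<close>

definition history ::
    "'a measure \<Rightarrow> 'v pair_pre_digraph \<Rightarrow> (nat \<Rightarrow> 'a \<Rightarrow> 'v) \<Rightarrow> (nat \<Rightarrow> 'a \<Rightarrow> real) \<Rightarrow> nat \<Rightarrow> 'a measure" where
  "history M G Y W n =
    vimage_algebra (space M)
      (\<lambda>\<omega>. (\<lambda>k\<in>{..n}. Y k \<omega>, \<lambda>k\<in>{..<n}. W k \<omega>))
      ((\<Pi>\<^sub>M k\<in>{..n}. count_space (pverts G)) \<Otimes>\<^sub>M (\<Pi>\<^sub>M k\<in>{..<n}. borel))"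

text \<open>Given the history at step $n$ and $Y_n = v$, the waiting time $W_n$ is exponential with rate
  $\deg(v)$ and $Y_{n+1}$ is uniform on the out-neighbours of $v$, independently of each other and
  of the history.\<close>

definition random_walker ::
    "'a measure \<Rightarrow> 'v pair_pre_digraph \<Rightarrow> (nat \<Rightarrow> 'a \<Rightarrow> 'v) \<Rightarrow> (nat \<Rightarrow> 'a \<Rightarrow> real) \<Rightarrow> bool" where
  "random_walker M G Y W \<longleftrightarrow>
    (\<forall>n. Y n \<in> M \<rightarrow>\<^sub>M count_space (pverts G)) \<and>
    (\<forall>n. W n \<in> borel_measurable M) \<and>
    (\<forall>n. \<forall>H\<in>sets (history M G Y W n). \<forall>v\<in>pverts G. \<forall>B\<in>sets borel. \<forall>u\<in>pverts G.
       \<P>(\<omega> in M. \<omega> \<in> H \<and> Y n \<omega> = v \<and> W n \<omega> \<in> B \<and> Y (Suc n) \<omega> = u) =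
       \<P>(\<omega> in M. \<omega> \<in> H \<and> Y n \<omega> = v)
         * measure (density lborel (exponential_density (real (deg G v)))) B
         * pmf (pmf_of_set (out_nbrs G v)) u)"

definition position :: "(nat \<Rightarrow> 'a \<Rightarrow> 'v) \<Rightarrow> (nat \<Rightarrow> 'a \<Rightarrow> real) \<Rightarrow> real \<Rightarrow> 'a \<Rightarrow> 'v" where
  "position Y W t \<omega> = Y (LEAST n. t < (\<Sum>k\<le>n. W k \<omega>)) \<omega>"

definition independent_walkers ::
    "'a measure \<Rightarrow> 'v pair_pre_digraph \<Rightarrow> nat \<Rightarrow>
     (nat \<Rightarrow> nat \<Rightarrow> 'a \<Rightarrow> 'v) \<Rightarrow> (nat \<Rightarrow> nat \<Rightarrow> 'a \<Rightarrow> real) \<Rightarrow> bool" where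
  "independent_walkers M G m Y W \<longleftrightarrow>
    (\<forall>i<m. random_walker M G (Y i) (W i)) \<and>
    prob_space.indep_vars M
      (\<lambda>i. \<Pi>\<^sub>M n\<in>(UNIV :: nat set). count_space (pverts G) \<Otimes>\<^sub>M (borel :: real measure))
      (\<lambda>i \<omega> n. (Y i n \<omega>, W i n \<omega>)) {..<m}"

definition joint_process ::
    "nat \<Rightarrow> (nat \<Rightarrow> nat \<Rightarrow> 'a \<Rightarrow> 'v) \<Rightarrow> (nat \<Rightarrow> nat \<Rightarrow> 'a \<Rightarrow> real) \<Rightarrow> real \<Rightarrow> 'a \<Rightarrow> (nat \<Rightarrow> 'v)" where
  "joint_process m Y W t \<omega> = (\<lambda>i\<in>{..<m}. position (Y i) (W i) t \<omega>)"

end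

theory Submission
  imports Defs
begin

text \<open>Conditionally on its position at time $s$ and on the past, a walker at $x$ has by time $s + h$
  not jumped with probability $e^{-\deg(x) h}$, and has jumped at least twice with probability
  $O(h^2)$, because the residual waiting time is again exponential.  So one walker is a Markov process
  whose transition function satisfies the forward equation of $A - D$ for $G$, that is $e^{t(A - D)}$.
  By independence the joint process has the product transition function, whose derivative at $0$ is
  the rate matrix of the Cartesian power.

  The jump chain of a right-continuous finite Markov process is the pointwise limit of the jump chains
  of its restrictions to the grids $h \mathbb{N}$ as $h \to 0$.  The latter are Markov chains with
  transition probabilities $P_h(x,y) / (1 - P_h(x,x))$, by summing a geometric series, and these tend to
  $Q(x,y) / (-Q(x,x))$.\<close>

section \<open>The semigroup of a finite rate matrix\<close>

text \<open>Two obstacles shape the proof. Positions observed at fixed times do not show how many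
  jumps were made, nor how long the current wait has lasted, whereas the hypothesis on
  \<open>W n\<close> speaks of the history at step \<open>n\<close>. Events are therefore split by
  the number \<open>n\<close> of jumps made by time \<open>s\<close>; on each piece the observed
  past becomes an event of that history. The error of a short time step is proportional to the
  probability of the piece, so the sum over \<open>n\<close> stays quadratic in \<open>h\<close>;
  this requires that the pieces exhaust the space up to a null set, that is, absence of explosions.
  The second obstacle is that jump times are random, while the Markov property is known at fixed
  times only. Grid times take the place of a strong Markov property. That part speaks of the joint
  process as a Markov process and never of single walkers, so the interleaving of their jumps is not
  analysed.\<close>

primrec mat_pow :: "'s set \<Rightarrow> ('s \<Rightarrow> 's \<Rightarrow> real) \<Rightarrow> nat \<Rightarrow> 's \<Rightarrow> 's \<Rightarrow> real" where
  "mat_pow S B 0 = (\<lambda>x y. of_bool (x = y))"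
| "mat_pow S B (Suc n) = mat_mult S B (mat_pow S B n)"

lemma mat_pow_nonneg:
  assumes "\<And>x y. x \<in> S \<Longrightarrow> y \<in> S \<Longrightarrow> 0 \<le> B x y" "x \<in> S" "y \<in> S"
  shows "0 \<le> mat_pow S B n x y"
  using assms(2,3)
  by (induction n arbitrary: x) (auto simp: mat_mult_def assms(1) intro!: sum_nonneg)

lemma mat_pow_row_sum:
  assumes "finite S" "\<And>x. x \<in> S \<Longrightarrow> (\<Sum>y\<in>S. B x y) = l" "x \<in> S"
  shows "(\<Sum>y\<in>S. mat_pow S B n x y) = l ^ n"
  using assms(3)
proof (induction n arbitrary: x)
  case 0
  then show ?case using assms(1) by (simp add: of_bool_def)
next
  case (Suc n)
  have "(\<Sum>y\<in>S. mat_pow S B (Suc n) x y) = (\<Sum>z\<in>S. \<Sum>y\<in>S. B x z * mat_pow S B n z y)"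
    by (simp add: mat_mult_def) (rule sum.swap)
  also have "\<dots> = (\<Sum>z\<in>S. B x z * l ^ n)"
    by (intro sum.cong) (auto simp: Suc.IH sum_distrib_left[symmetric])
  also have "\<dots> = l ^ Suc n"
    using assms(2)[OF Suc.prems] by (simp add: sum_distrib_right[symmetric])
  finally show ?case .
qed

lemma mat_pow_add:
  assumes "finite S" "x \<in> S"
  shows "mat_pow S B (a + b) x y = mat_mult S (mat_pow S B a) (mat_pow S B b) x y"
  using assms(2)
proof (induction a arbitrary: x)
  case 0
  have "(\<Sum>z\<in>S. of_bool (x = z) * mat_pow S B b z y) =
      (\<Sum>z\<in>S. if z = x then mat_pow S B b x y else 0)"
    by (intro sum.cong) auto
  with 0 assms(1) show ?case by (simp add: mat_mult_def)
next
  case (Suc a)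
  have "mat_pow S B (Suc a + b) x y =
      (\<Sum>z\<in>S. \<Sum>w\<in>S. B x z * mat_pow S B a z w * mat_pow S B b w y)"
    using Suc.IH by (auto simp: mat_mult_def sum_distrib_left mult.assoc intro!: sum.cong)
  also have "\<dots> = (\<Sum>w\<in>S. \<Sum>z\<in>S. B x z * mat_pow S B a z w * mat_pow S B b w y)"
    by (rule sum.swap)
  also have "\<dots> = mat_mult S (mat_pow S B (Suc a)) (mat_pow S B b) x y"
    by (simp add: mat_mult_def sum_distrib_right)
  finally show ?case .
qed

text \<open>Uniformisation: $e^{tQ} = e^{-lt} e^{tB}$ for $B = Q + l I$, where $B$ is entrywise nonnegative.\<close>

definition mat_exp :: "'s set \<Rightarrow> ('s \<Rightarrow> 's \<Rightarrow> real) \<Rightarrow> real \<Rightarrow> 's \<Rightarrow> 's \<Rightarrow> real" where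
  "mat_exp S B t x y = (\<Sum>n. mat_pow S B n x y / fact n * t ^ n)"

lemma mat_exp_0: "mat_exp S B 0 x y = of_bool (x = y)"
  using powser_zero[of "\<lambda>n. mat_pow S B n x y / fact n"] by (simp add: mat_exp_def)

definition unif_semigroup ::
    "'s set \<Rightarrow> ('s \<Rightarrow> 's \<Rightarrow> real) \<Rightarrow> real \<Rightarrow> real \<Rightarrow> 's \<Rightarrow> 's \<Rightarrow> real" where
  "unif_semigroup S B l t x y = exp (- (l * t)) * mat_exp S B t x y"

text \<open>For \<open>l\<close> > 0 the matrix \<open>B\<close> divided by \<open>l\<close> is
  stochastic, and the semigroup is that of a discrete chain moved at the times of a Poisson process
  of rate \<open>l\<close>. The shift removes the negative diagonal of the rate matrix, so
  positivity can be read off the series term by term.\<close>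

locale uniformized =
  fixes S :: "'s set" and B :: "'s \<Rightarrow> 's \<Rightarrow> real" and l :: real
  assumes fin: "finite S"
    and B_nonneg: "\<And>x y. x \<in> S \<Longrightarrow> y \<in> S \<Longrightarrow> 0 \<le> B x y"
    and B_row: "\<And>x. x \<in> S \<Longrightarrow> (\<Sum>y\<in>S. B x y) = l"
begin

text \<open>A nonnegative entry is at most its row sum \<open>l ^ n\<close>, so an exponential
  series dominates. Absolute summability is what the Cauchy product asks for.\<close>

lemma summable_mat_exp:
  assumes "x \<in> S" "y \<in> S"
  shows "summable (\<lambda>n. norm (mat_pow S B n x y / fact n * t ^ n))"
proof (rule summable_comparison_test)
  have "mat_pow S B n x y \<le> l ^ n" for n
    using member_le_sum[of y S "\<lambda>y. mat_pow S B n x y"] assms fin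
    by (simp add: mat_pow_nonneg B_nonneg mat_pow_row_sum[where B = B, OF fin B_row])
  moreover have "0 \<le> l" using B_row[OF assms(1)] sum_nonneg[of S "B x"] B_nonneg assms(1) by auto
  ultimately show "\<exists>N. \<forall>n\<ge>N. norm (norm (mat_pow S B n x y / fact n * t ^ n)) \<le>
      inverse (fact n) * \<bar>l * t\<bar> ^ n"
    by (intro exI[of _ 0])
       (auto simp: abs_mult power_abs mat_pow_nonneg B_nonneg assms power_mult_distrib divide_inverse
         mult.commute[of _ "inverse _"] mult.assoc intro!: mult_left_mono mult_right_mono)
  show "summable (\<lambda>n. inverse (fact n) * \<bar>l * t\<bar> ^ n)"
    by (rule summable_exp)
qed

lemma mat_exp_sums:
  assumes "x \<in> S" "y \<in> S"
  shows "(\<lambda>n. mat_pow S B n x y / fact n * t ^ n) sums mat_exp S B t x y"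
  unfolding mat_exp_def using summable_norm_cancel[OF summable_mat_exp[OF assms]]
  by (rule summable_sums)

lemma mat_exp_row_sum:
  assumes "x \<in> S"
  shows "(\<Sum>y\<in>S. mat_exp S B t x y) = exp (l * t)"
proof -
  have "(\<lambda>n. \<Sum>y\<in>S. mat_pow S B n x y / fact n * t ^ n) sums (\<Sum>y\<in>S. mat_exp S B t x y)"
    by (intro sums_sum mat_exp_sums assms)
  moreover have "(\<Sum>y\<in>S. mat_pow S B n x y / fact n * t ^ n) = (l * t) ^ n /\<^sub>R fact n" for n
    using mat_pow_row_sum[where B = B and n = n, OF fin B_row assms]
    by (simp add: sum_distrib_right[symmetric] sum_divide_distrib[symmetric] power_mult_distrib
        divide_inverse)
  ultimately show ?thesis
    using exp_converges[of "l * t"] sums_unique2 by fastforce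
qed

text \<open>Powers of one matrix commute, so the scalar proof of exp(s + t) = exp(s) exp(t) carries
  over: Cauchy product of the two series, then the binomial theorem in each degree.\<close>

lemma mat_exp_add:
  assumes "x \<in> S" "y \<in> S"
  shows "mat_exp S B (s + t) x y = mat_mult S (mat_exp S B s) (mat_exp S B t) x y"
proof -
  let ?a = "\<lambda>t x y n. mat_pow S B n x y / fact n * t ^ n"
  have "(\<lambda>n. \<Sum>z\<in>S. \<Sum>i\<le>n. ?a s x z i * ?a t z y (n - i)) sums
      (\<Sum>z\<in>S. mat_exp S B s x z * mat_exp S B t z y)"
    unfolding mat_exp_def
    by (intro sums_sum Cauchy_product_sums summable_mat_exp assms)
  moreover have "(\<Sum>z\<in>S. \<Sum>i\<le>n. ?a s x z i * ?a t z y (n - i)) = ?a (s + t) x y n" for n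
  proof -
    have "(\<Sum>z\<in>S. \<Sum>i\<le>n. ?a s x z i * ?a t z y (n - i)) =
        (\<Sum>i\<le>n. \<Sum>z\<in>S. ?a s x z i * ?a t z y (n - i))"
      by (rule sum.swap)
    also have "\<dots> = (\<Sum>i\<le>n. of_nat (n choose i) * s ^ i * t ^ (n - i) * (mat_pow S B n x y / fact n))"
    proof (intro sum.cong refl)
      fix i assume i: "i \<in> {..n}"
      have "(\<Sum>z\<in>S. ?a s x z i * ?a t z y (n - i)) =
          (\<Sum>z\<in>S. mat_pow S B i x z * mat_pow S B (n - i) z y) *
            (s ^ i * t ^ (n - i) / (fact i * fact (n - i)))"
        by (simp add: sum_distrib_left sum_distrib_right field_simps)
      also have "(\<Sum>z\<in>S. mat_pow S B i x z * mat_pow S B (n - i) z y) = mat_pow S B n x y"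
        using mat_pow_add[OF fin assms(1), of B i "n - i" y] i by (simp add: mat_mult_def)
      finally show "(\<Sum>z\<in>S. ?a s x z i * ?a t z y (n - i)) =
          of_nat (n choose i) * s ^ i * t ^ (n - i) * (mat_pow S B n x y / fact n)"
        using i by (simp add: binomial_fact field_simps)
    qed
    also have "\<dots> = ?a (s + t) x y n"
      by (simp add: binomial_ring sum_distrib_left sum_divide_distrib mult.commute)
    finally show ?thesis .
  qed
  ultimately show ?thesis
    using mat_exp_sums[OF assms, of "s + t"] sums_unique2 unfolding mat_mult_def by force
qed

lemma transition_function_unif_semigroup: "transition_function S (unif_semigroup S B l)"
  unfolding transition_function_def
proof (intro conjI allI impI ballI)
  fix t :: real and x y assume "0 \<le> t" "x \<in> S" "y \<in> S"
  then show "0 \<le> unif_semigroup S B l t x y"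
    unfolding unif_semigroup_def mat_exp_def
    by (intro mult_nonneg_nonneg suminf_nonneg summable_norm_cancel[OF summable_mat_exp])
       (auto simp: mat_pow_nonneg B_nonneg)
next
  fix t :: real and x assume "x \<in> S"
  then show "(\<Sum>y\<in>S. unif_semigroup S B l t x y) = 1"
    unfolding unif_semigroup_def
    by (simp add: sum_distrib_left[symmetric] mat_exp_row_sum exp_minus)
next
  fix x y show "unif_semigroup S B l 0 x y = of_bool (x = y)"
    by (simp add: unif_semigroup_def mat_exp_0)
next
  fix s t :: real and x y assume "x \<in> S" "y \<in> S"
  then show "unif_semigroup S B l (s + t) x y =
      mat_mult S (unif_semigroup S B l s) (unif_semigroup S B l t) x y"
    unfolding unif_semigroup_def
    by (simp add: mat_exp_add mat_mult_def sum_distrib_left ring_distribs exp_add exp_diff exp_minus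
        field_simps)
qed

text \<open>Only the linear coefficient of the power series, \<open>B x y\<close>, survives at 0;
  the factor exp(-lt) contributes -l times the identity, which undoes the shift.\<close>

lemma unif_semigroup_deriv:
  assumes "x \<in> S" "y \<in> S"
  shows "((\<lambda>t. unif_semigroup S B l t x y) has_real_derivative B x y - l * of_bool (x = y))
    (at_right 0)"
proof -
  let ?c = "\<lambda>n. mat_pow S B n x y / fact n"
  have "((\<lambda>t. mat_exp S B t x y) has_real_derivative (\<Sum>n. diffs ?c n * 0 ^ n)) (at 0)"
    unfolding mat_exp_def
    by (rule termdiffs_strong[of _ 1])
       (use summable_norm_cancel[OF summable_mat_exp[OF assms, of 1]] in auto)
  moreover have "(\<Sum>z\<in>S. B x z * of_bool (z = y)) = (\<Sum>z\<in>S. if z = y then B x z else 0)"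
    by (intro sum.cong) auto
  then have "(\<Sum>n. diffs ?c n * 0 ^ n) = B x y"
    using assms fin powser_zero[of "diffs ?c"] by (simp add: diffs_def mat_mult_def)
  ultimately have "((\<lambda>t. mat_exp S B t x y) has_real_derivative B x y) (at_right 0)"
    by (auto intro: DERIV_subset)
  then show ?thesis
    using mat_exp_0[of S B x y] unfolding unif_semigroup_def
    by (auto intro!: derivative_eq_intros)
qed

end

text \<open>Euler's method: on $[0,t]$ the local errors of $n$ steps of length $t/n$ add up to
  $n \cdot o(t/n)$, because stochastic matrices do not increase the $\ell^1$-norm.\<close>

lemma transition_function_flow_unique:
  assumes fin: "finite S" and P: "transition_function S P"
    and \<rho>: "((\<lambda>h. \<rho> h / h) \<longlongrightarrow> 0) (at_right 0)"
    and step: "\<And>s h y. 0 \<le> s \<Longrightarrow> 0 < h \<Longrightarrow> y \<in> S \<Longrightarrow>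
      \<bar>f (s + h) y - (\<Sum>x\<in>S. f s x * P h x y)\<bar> \<le> \<rho> h"
    and "0 \<le> t" "y \<in> S"
  shows "f t y = (\<Sum>x\<in>S. f 0 x * P t x y)"
proof (cases "t = 0")
  case True
  have "(\<Sum>x\<in>S. f 0 x * P 0 x y) = (\<Sum>x\<in>S. if x = y then f 0 x else 0)"
    using P \<open>y \<in> S\<close> by (intro sum.cong) (auto simp: transition_function_def)
  then show ?thesis using True fin \<open>y \<in> S\<close> by simp
next
  case False
  with \<open>0 \<le> t\<close> have "0 < t" by simp
  define e where "e s = (\<Sum>y\<in>S. \<bar>f s y - (\<Sum>x\<in>S. f 0 x * P s x y)\<bar>)" for s
  \<comment> \<open>The old error is moved by a stochastic matrix, which cannot enlarge its sum
    norm, and each of the \<open>card S\<close> coordinates adds one local error.\<close>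
  have e_step: "e (s + h) \<le> e s + card S * \<rho> h" if "0 \<le> s" "0 < h" for s h
  proof -
    have eq: "(\<Sum>x\<in>S. f 0 x * P (s + h) x y) = (\<Sum>z\<in>S. (\<Sum>x\<in>S. f 0 x * P s x z) * P h z y)"
      if "y \<in> S" for y
    proof -
      have "(\<Sum>x\<in>S. f 0 x * P (s + h) x y) = (\<Sum>x\<in>S. \<Sum>z\<in>S. f 0 x * P s x z * P h z y)"
        using P that \<open>0 \<le> s\<close> \<open>0 < h\<close>
        by (intro sum.cong) (auto simp: transition_function_def mat_mult_def sum_distrib_left mult.assoc)
      also have "\<dots> = (\<Sum>z\<in>S. \<Sum>x\<in>S. f 0 x * P s x z * P h z y)"
        by (rule sum.swap)
      finally show ?thesis by (simp add: sum_distrib_right)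
    qed
    have "e (s + h) \<le> (\<Sum>y\<in>S. \<rho> h + (\<Sum>z\<in>S. \<bar>f s z - (\<Sum>x\<in>S. f 0 x * P s x z)\<bar> * P h z y))"
      unfolding e_def
    proof (rule sum_mono)
      fix y assume y: "y \<in> S"
      have "\<bar>f (s + h) y - (\<Sum>x\<in>S. f 0 x * P (s + h) x y)\<bar> \<le>
          \<bar>f (s + h) y - (\<Sum>z\<in>S. f s z * P h z y)\<bar> +
          \<bar>\<Sum>z\<in>S. (f s z - (\<Sum>x\<in>S. f 0 x * P s x z)) * P h z y\<bar>"
        unfolding eq[OF y] by (simp add: left_diff_distrib sum_subtractf)
      also have "\<dots> \<le> \<rho> h + (\<Sum>z\<in>S. \<bar>(f s z - (\<Sum>x\<in>S. f 0 x * P s x z)) * P h z y\<bar>)"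
        by (intro add_mono step sum_abs that y)
      also have "\<dots> = \<rho> h + (\<Sum>z\<in>S. \<bar>f s z - (\<Sum>x\<in>S. f 0 x * P s x z)\<bar> * P h z y)"
        using P y \<open>0 < h\<close> by (simp add: abs_mult transition_function_def)
      finally show "\<bar>f (s + h) y - (\<Sum>x\<in>S. f 0 x * P (s + h) x y)\<bar> \<le> \<dots>" .
    qed
    also have "\<dots> = card S * \<rho> h +
        (\<Sum>z\<in>S. \<Sum>y\<in>S. \<bar>f s z - (\<Sum>x\<in>S. f 0 x * P s x z)\<bar> * P h z y)"
      by (subst sum.swap) (simp add: sum.distrib)
    also have "\<dots> = card S * \<rho> h + e s"
      using P \<open>0 < h\<close>
      by (simp add: sum_distrib_left[symmetric] transition_function_def e_def)
    finally show ?thesis by simp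
  qed
  have e0: "e 0 = 0"
  proof -
    have "(\<Sum>x\<in>S. f 0 x * P 0 x y) = f 0 y" if "y \<in> S" for y
    proof -
      have "(\<Sum>x\<in>S. f 0 x * P 0 x y) = (\<Sum>x\<in>S. if x = y then f 0 x else 0)"
        using P that by (intro sum.cong) (auto simp: transition_function_def)
      with fin that show ?thesis by simp
    qed
    then show ?thesis by (simp add: e_def)
  qed
  have e_le: "e (real n * h) \<le> n * (card S * \<rho> h)" if "0 < h" for n h
  proof (induction n)
    case (Suc n)
    then show ?case
      using e_step[of "real n * h" h] that by (simp add: algebra_simps)
  qed (simp add: e0)
  \<comment> \<open>With h = t / Suc n the accumulated bound
    \<open>Suc n * (card S * \<rho> h)\<close> equals \<open>card S * t * (\<rho> h / h)\<close>,
    which is why the hypothesis concerns the quotient. \<open>Suc n\<close> keeps the step length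
    positive.\<close>
  have lim: "(\<lambda>n. card S * t * (\<rho> (t / real (Suc n)) / (t / real (Suc n)))) \<longlonglongrightarrow> card S * t * 0"
  proof (intro tendsto_mult tendsto_const filterlim_compose[OF \<rho>])
    show "filterlim (\<lambda>n. t / real (Suc n)) (at_right 0) sequentially"
      using \<open>0 < t\<close> tendsto_mult[OF tendsto_const[of t] LIMSEQ_inverse_real_of_nat]
      by (auto simp: filterlim_at field_simps)
  qed
  have "e t \<le> card S * t * 0"
  proof (rule tendsto_lowerbound[OF lim])
    have "e t \<le> card S * t * (\<rho> (t / real (Suc n)) / (t / real (Suc n)))" for n
    proof -
      have "real (Suc n) * (t / real (Suc n)) = t" by simp
      then have "e t \<le> Suc n * (card S * \<rho> (t / Suc n))"
        using e_le[of "t / Suc n" "Suc n"] \<open>0 < t\<close> by (simp only:) simp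
      also have "\<dots> = card S * t * (\<rho> (t / real (Suc n)) / (t / real (Suc n)))"
        using \<open>0 < t\<close> by simp
      finally show ?thesis .
    qed
    then show "\<forall>\<^sub>F n in sequentially. e t \<le> card S * t * (\<rho> (t / real (Suc n)) / (t / real (Suc n)))"
      by simp
  qed simp
  then have "e t = 0" by (simp add: e_def sum_nonneg antisym)
  then show ?thesis using fin \<open>y \<in> S\<close> by (simp add: e_def sum_nonneg_eq_0_iff)
qed

section \<open>Cartesian powers\<close>

context pair_graph
begin

lemma out_nbrs_subset: "out_nbrs G v \<subseteq> pverts G"
  using arc_snd_in_verts by (force simp: out_nbrs_def)

lemma finite_out_nbrs: "finite (out_nbrs G v)"
  using out_nbrs_subset pair_finite_verts by (rule finite_subset)

lemma deg_eq_card_out_nbrs: "deg G v = card (out_nbrs G v)"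
proof -
  have "bij_betw (Pair v) (out_nbrs G v) (out_arcs (with_proj G) v)"
    by (auto simp: bij_betw_def inj_on_def out_nbrs_def out_arcs_def)
  then show ?thesis by (simp add: out_degree_def bij_betw_same_card)
qed

lemma row_sum_eq_deg: "row_sum G v = deg G v"
proof -
  have "row_sum G v = (\<Sum>u\<in>pverts G. if u \<in> out_nbrs G v then 1 else 0)"
    by (simp add: row_sum_def adj_matrix_def out_nbrs_def of_bool_def)
  also have "\<dots> = (\<Sum>u\<in>pverts G \<inter> out_nbrs G v. 1)"
    by (rule sum.inter_restrict[symmetric, OF pair_finite_verts])
  finally show ?thesis using out_nbrs_subset[of v] by (simp add: deg_eq_card_out_nbrs Int_absorb1)
qed

lemma pmf_out_nbrs:
  assumes "0 < deg G v"
  shows "pmf (pmf_of_set (out_nbrs G v)) u = adj_matrix G v u / deg G v"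
proof -
  have "out_nbrs G v \<noteq> {}" using assms by (auto simp: deg_eq_card_out_nbrs)
  then show ?thesis
    by (simp add: finite_out_nbrs adj_matrix_def deg_eq_card_out_nbrs indicator_def)
       (simp add: out_nbrs_def)
qed

lemma pverts_cart_power: "pverts (cart_power G m) = {..<m} \<rightarrow>\<^sub>E pverts G"
  by (simp add: cart_power_def Let_def)

lemma finite_cart_power: "finite (pverts (cart_power G m))"
  by (simp add: pverts_cart_power finite_PiE pair_finite_verts)

text \<open>The Kronecker-sum form of the adjacency matrix: coordinate \<open>i\<close> moves by
  \<open>adj_matrix G\<close>, the others by the identity. The existential over \<open>i\<close>
  becomes a sum without overcounting because \<open>G\<close> has no loops: an arc really changes
  coordinate \<open>i\<close>, so it cannot be attributed to another index.\<close>

lemma adj_matrix_cart_power: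
  assumes "v \<in> pverts (cart_power G m)" "u \<in> pverts (cart_power G m)"
  shows "adj_matrix (cart_power G m) v u =
    (\<Sum>i<m. adj_matrix G (v i) (u i) * (\<Prod>j\<in>{..<m} - {i}. of_bool (v j = u j)))"
    (is "_ = (\<Sum>i<m. ?t i)")
proof -
  have t: "?t i = of_bool ((v i, u i) \<in> parcs G \<and> (\<forall>j<m. j \<noteq> i \<longrightarrow> u j = v j))" for i
    by (auto simp: adj_matrix_def) (metis DiffI lessThan_iff singletonD)
  have arc: "(v, u) \<in> parcs (cart_power G m) \<longleftrightarrow> (\<exists>i<m. ?t i = 1)"
    using assms by (auto simp: t cart_power_def Let_def)
  show ?thesis
  proof (cases "\<exists>i<m. ?t i = 1")
    case True
    then obtain i where i: "i < m" "?t i = 1" by blast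
    then have "(v i, u i) \<in> parcs G" unfolding t by simp
    then have "v i \<noteq> u i" using pair_no_loops by fastforce
    then have "?t k = 0" if "k < m" "k \<noteq> i" for k
      using that i(1) by (force simp: t)
    then have "(\<Sum>k<m. ?t k) = (\<Sum>k<m. if k = i then 1 else 0)"
      using i by (intro sum.cong) auto
    then show ?thesis using arc True i(1) by (simp add: adj_matrix_def)
  next
    case False
    then have "(\<Sum>i<m. ?t i) = 0" unfolding t by (intro sum.neutral) auto
    then show ?thesis using arc False unfolding adj_matrix_def[of "cart_power G m"] by simp
  qed
qed

text \<open>For each moving coordinate \<open>i\<close>, distributivity turns the sum over all
  tuples into a product of row sums: the identity factors give 1 and the remaining one gives
  \<open>deg G (v i)\<close>.\<close>

lemma row_sum_cart_power:
  assumes v: "v \<in> pverts (cart_power G m)"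
  shows "row_sum (cart_power G m) v = (\<Sum>i<m. real (deg G (v i)))"
proof -
  let ?g = "\<lambda>i j y. if j = i then adj_matrix G (v i) y else of_bool (v j = y)"
  have row: "(\<Sum>y\<in>pverts G. ?g i j y) = (if j = i then real (deg G (v i)) else 1)" if "j < m" for i j
  proof -
    have "v j \<in> pverts G" using v that by (auto simp: pverts_cart_power)
    then have "(\<Sum>y\<in>pverts G. of_bool (v j = y)) = (1 :: real)"
      using pair_finite_verts by (simp add: of_bool_def)
    then show ?thesis using row_sum_eq_deg[of "v i"] by (simp add: row_sum_def)
  qed
  have "row_sum (cart_power G m) v =
      (\<Sum>u\<in>{..<m} \<rightarrow>\<^sub>E pverts G. \<Sum>i<m. \<Prod>j<m. ?g i j (u j))"
    unfolding row_sum_def pverts_cart_power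
  proof (intro sum.cong refl)
    fix u assume "u \<in> {..<m} \<rightarrow>\<^sub>E pverts G"
    then have "adj_matrix (cart_power G m) v u =
        (\<Sum>i<m. adj_matrix G (v i) (u i) * (\<Prod>j\<in>{..<m} - {i}. of_bool (v j = u j)))"
      using v by (intro adj_matrix_cart_power) (auto simp: pverts_cart_power)
    also have "\<dots> = (\<Sum>i<m. \<Prod>j<m. ?g i j (u j))"
      by (intro sum.cong refl, subst (2) prod.remove) (auto intro!: prod.cong)
    finally show "adj_matrix (cart_power G m) v u = \<dots>" .
  qed
  also have "\<dots> = (\<Sum>i<m. \<Sum>u\<in>{..<m} \<rightarrow>\<^sub>E pverts G. \<Prod>j<m. ?g i j (u j))"
    by (rule sum.swap)
  also have "\<dots> = (\<Sum>i<m. \<Prod>j<m. \<Sum>y\<in>pverts G. ?g i j y)"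
    using pair_finite_verts by (simp add: prod_sum_PiE)
  also have "\<dots> = (\<Sum>i<m. \<Prod>j<m. if j = i then real (deg G (v i)) else 1)"
    by (intro sum.cong prod.cong refl) (simp add: row del: if_split)
  finally show ?thesis by simp
qed

lemma jump_matrix_cart_power:
  assumes "v \<in> pverts (cart_power G m)"
  shows "jump_matrix (cart_power G m) v u =
    adj_matrix (cart_power G m) v u / (\<Sum>i<m. real (deg G (v i)))"
proof -
  have "jump_matrix (cart_power G m) v u = (\<Sum>z\<in>pverts (cart_power G m).
      if z = v then inverse (row_sum (cart_power G m) v) * adj_matrix (cart_power G m) v u else 0)"
    unfolding jump_matrix_def mat_mult_def deg_matrix_inv_def diag_def by (intro sum.cong) auto
  then show ?thesis
    using assms by (simp add: finite_cart_power row_sum_cart_power divide_inverse)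
qed

text \<open>\<open>embed_pmf\<close> has the intended values only for weights of total mass 1.
  Division by the total degree achieves this once that total is nonzero, which is where the
  existence of a walker and positive degrees come in.\<close>

lemma pmf_select_walker:
  assumes "1 \<le> m" "\<And>i. i < m \<Longrightarrow> 0 < deg G (v i)"
  shows "pmf (select_walker G m v) i =
    (if i < m then real (deg G (v i)) / (\<Sum>j<m. real (deg G (v j))) else 0)"
  unfolding select_walker_def
proof (rule pmf_embed_pmf)
  let ?D = "\<Sum>j<m. real (deg G (v j))"
  let ?f = "\<lambda>i. if i < m then real (deg G (v i)) / ?D else 0"
  show "0 \<le> ?f i" for i by (simp add: sum_nonneg)
  have "0 < ?D"
    using assms by (intro sum_pos) (auto simp: lessThan_empty_iff)
  have "(\<integral>\<^sup>+ i. ennreal (?f i) \<partial>count_space UNIV) = (\<integral>\<^sup>+ i. ennreal (?f i) \<partial>count_space {..<m})"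
    by (rule nn_integral_count_space_eq) auto
  also have "\<dots> = (\<Sum>i<m. ennreal (?f i))"
    by (simp add: nn_integral_count_space_finite)
  also have "\<dots> = ennreal (\<Sum>i<m. ?f i)"
    by (rule sum_ennreal) (simp add: sum_nonneg)
  also have "(\<Sum>i<m. ?f i) = 1"
    using \<open>0 < ?D\<close> by (simp add: sum_divide_distrib[symmetric])
  finally show "(\<integral>\<^sup>+ i. ennreal (?f i) \<partial>count_space UNIV) = 1" by simp
qed

text \<open>Degrees cancel: walker \<open>i\<close> is chosen with probability
  \<open>deg G (v i) / ?D\<close> and then follows each of its \<open>deg G (v i)\<close> arcs
  equally likely, so every arc of the power graph leaving \<open>v\<close> gets 1 /
  \<open>?D\<close>. Dividing the row of the adjacency matrix by its sum gives the same.\<close>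

lemma jump_matrix_eq_frontier_matrix:
  assumes "1 \<le> m" and pos: "\<forall>v\<in>pverts G. 0 < deg G v"
    and v: "v \<in> pverts (cart_power G m)" and u: "u \<in> pverts (cart_power G m)"
  shows "jump_matrix (cart_power G m) v u = frontier_matrix G m v u"
proof -
  let ?D = "\<Sum>j<m. real (deg G (v j))"
  have degv: "0 < deg G (v i)" if "i < m" for i
    using v that pos by (auto simp: pverts_cart_power)
  note sel = pmf_select_walker[OF \<open>1 \<le> m\<close> degv]
  \<comment> \<open>The map \<open>\<lambda>w. v(i := w)\<close> is injective and can produce
    \<open>u\<close> only if \<open>u\<close> agrees with \<open>v\<close> off \<open>i\<close>, and
    then only from \<open>w = u i\<close>; the product of indicators records this agreement.\<close>
  have step: "pmf (map_pmf (\<lambda>w. v(i := w)) (pmf_of_set (out_nbrs G (v i)))) u =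
      adj_matrix G (v i) (u i) / deg G (v i) * (\<Prod>j\<in>{..<m} - {i}. of_bool (v j = u j))"
    if "i < m" for i
  proof (cases "\<forall>j\<in>{..<m} - {i}. v j = u j")
    case True
    then have "u = v(i := u i)"
      using u v by (simp add: pverts_cart_power fun_eq_iff PiE_iff extensional_def)
        (metis DiffI lessThan_iff singletonD)
    moreover have "inj (\<lambda>w. v(i := w))" by (metis fun_upd_same injI)
    ultimately have "pmf (map_pmf (\<lambda>w. v(i := w)) (pmf_of_set (out_nbrs G (v i)))) u =
        pmf (pmf_of_set (out_nbrs G (v i))) (u i)"
      by (metis pmf_map_inj')
    then show ?thesis using True by (simp add: pmf_out_nbrs degv that)
  next
    case False
    then have "u \<notin> (\<lambda>w. v(i := w)) ` set_pmf (pmf_of_set (out_nbrs G (v i)))" by auto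
    then have "pmf (map_pmf (\<lambda>w. v(i := w)) (pmf_of_set (out_nbrs G (v i)))) u = 0"
      by (rule pmf_map_outside)
    then show ?thesis using False by (auto simp: prod_zero_iff)
  qed
  have "frontier_matrix G m v u =
      (\<Sum>i<m. pmf (map_pmf (\<lambda>w. v(i := w)) (pmf_of_set (out_nbrs G (v i)))) u *
        pmf (select_walker G m v) i)"
    unfolding frontier_matrix_def frontier_step_def pmf_bind
    by (intro integral_measure_pmf_real) (auto simp: set_pmf_iff sel split: if_splits)
  also have "\<dots> = (\<Sum>i<m. adj_matrix G (v i) (u i) * (\<Prod>j\<in>{..<m} - {i}. of_bool (v j = u j)) / ?D)"
  proof (intro sum.cong refl)
    fix i assume "i \<in> {..<m}"
    then show "pmf (map_pmf (\<lambda>w. v(i := w)) (pmf_of_set (out_nbrs G (v i)))) u *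
        pmf (select_walker G m v) i =
        adj_matrix G (v i) (u i) * (\<Prod>j\<in>{..<m} - {i}. of_bool (v j = u j)) / ?D"
      using degv[of i] by (simp only: step sel lessThan_iff if_True) simp
  qed
  also have "\<dots> = jump_matrix (cart_power G m) v u"
    by (simp add: jump_matrix_cart_power[OF v] adj_matrix_cart_power[OF v u] sum_divide_distrib)
  finally show ?thesis by simp
qed

end

section \<open>Product semigroups and the rate matrix of the Cartesian power\<close>

lemma transition_function_power:
  fixes m :: nat
  assumes fin: "finite S" and P: "transition_function S P"
  shows "transition_function ({..<m} \<rightarrow>\<^sub>E S) (\<lambda>t x y. \<Prod>i<m. P t (x i) (y i))"
  unfolding transition_function_def
proof (intro conjI allI impI ballI)
  fix t :: real and x y assume "0 \<le> t" and "x \<in> {..<m} \<rightarrow>\<^sub>E S" "y \<in> {..<m} \<rightarrow>\<^sub>E S"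
  then show "0 \<le> (\<Prod>i<m. P t (x i) (y i))"
    using P by (intro prod_nonneg) (auto simp: transition_function_def dest!: PiE_mem)
next
  fix t :: real and x assume t: "0 \<le> t" and x: "x \<in> {..<m} \<rightarrow>\<^sub>E S"
  \<comment> \<open>A sum over tuples of a product over coordinates is a product of sums; the
    Chapman-Kolmogorov equation below rests on the same identity.\<close>
  have "(\<Sum>y\<in>{..<m} \<rightarrow>\<^sub>E S. \<Prod>i<m. P t (x i) (y i)) = (\<Prod>i<m. \<Sum>y\<in>S. P t (x i) y)"
    using fin by (intro prod_sum_PiE[symmetric]) auto
  also have "\<dots> = 1"
    using P t x by (intro prod.neutral) (auto simp: transition_function_def dest!: PiE_mem)
  finally show "(\<Sum>y\<in>{..<m} \<rightarrow>\<^sub>E S. \<Prod>i<m. P t (x i) (y i)) = 1" .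
next
  fix x y assume x: "x \<in> {..<m} \<rightarrow>\<^sub>E S" and y: "y \<in> {..<m} \<rightarrow>\<^sub>E S"
  have "(\<Prod>i<m. P 0 (x i) (y i)) = (\<Prod>i<m. of_bool (x i = y i))"
    using P x y by (intro prod.cong) (auto simp: transition_function_def dest!: PiE_mem)
  also have "\<dots> = of_bool (\<forall>i<m. x i = y i)"
    by auto
  also have "(\<forall>i<m. x i = y i) \<longleftrightarrow> x = y"
    using x y PiE_ext[of x "{..<m}" "\<lambda>_. S" y] by auto
  finally show "(\<Prod>i<m. P 0 (x i) (y i)) = of_bool (x = y)" .
next
  fix s t :: real and x y
  assume st: "0 \<le> s" "0 \<le> t" and x: "x \<in> {..<m} \<rightarrow>\<^sub>E S" and y: "y \<in> {..<m} \<rightarrow>\<^sub>E S"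
  have "(\<Prod>i<m. P (s + t) (x i) (y i)) = (\<Prod>i<m. \<Sum>z\<in>S. P s (x i) z * P t z (y i))"
    using P x y st
    by (intro prod.cong) (auto simp: transition_function_def mat_mult_def dest!: PiE_mem)
  also have "\<dots> = (\<Sum>z\<in>{..<m} \<rightarrow>\<^sub>E S. \<Prod>i<m. P s (x i) (z i) * P t (z i) (y i))"
    using fin by (simp add: prod_sum_PiE)
  finally show "(\<Prod>i<m. P (s + t) (x i) (y i)) =
      mat_mult ({..<m} \<rightarrow>\<^sub>E S) (\<lambda>x y. \<Prod>i<m. P s (x i) (y i)) (\<lambda>x y. \<Prod>i<m. P t (x i) (y i)) x y"
    by (simp add: mat_mult_def prod.distrib)
qed

text \<open>Leibniz rule: in each summand one coordinate is differentiated and the others are frozen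
  at \<open>P 0\<close>, the identity. The result is the Kronecker sum of the rate matrices of the
  coordinates.\<close>

lemma (in pair_graph) cart_power_rate_matrix_deriv:
  assumes P: "transition_function (pverts G) P"
    and deriv: "\<And>x y. x \<in> pverts G \<Longrightarrow> y \<in> pverts G \<Longrightarrow>
      ((\<lambda>t. P t x y) has_real_derivative rate_matrix G x y) (at_right 0)"
    and x: "x \<in> pverts (cart_power G m)" and y: "y \<in> pverts (cart_power G m)"
  shows "((\<lambda>t. \<Prod>i<m. P t (x i) (y i)) has_real_derivative rate_matrix (cart_power G m) x y)
    (at_right 0)"
proof -
  have xy: "x i \<in> pverts G" "y i \<in> pverts G" if "i < m" for i
    using x y that by (auto simp: pverts_cart_power)
  let ?\<delta> = "\<lambda>i. \<Prod>j\<in>{..<m} - {i}. of_bool (x j = y j) :: real"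
  have "((\<lambda>t. \<Prod>i<m. P t (x i) (y i)) has_real_derivative
      (\<Sum>i<m. rate_matrix G (x i) (y i) * (\<Prod>j\<in>{..<m} - {i}. P 0 (x j) (y j)))) (at_right 0)"
    unfolding has_field_derivative_def
  proof (rule has_derivative_eq_rhs[OF has_derivative_prod])
    show "((\<lambda>t. P t (x i) (y i)) has_derivative (*) (rate_matrix G (x i) (y i))) (at_right 0)"
      if "i \<in> {..<m}" for i
      using deriv[of "x i" "y i"] that xy by (simp add: has_field_derivative_def)
  qed (simp add: fun_eq_iff sum_distrib_left mult_ac)
  also have "(\<Sum>i<m. rate_matrix G (x i) (y i) * (\<Prod>j\<in>{..<m} - {i}. P 0 (x j) (y j))) =
      (\<Sum>i<m. rate_matrix G (x i) (y i) * ?\<delta> i)"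
    using P by (intro sum.cong refl arg_cong2[where f = "(*)"] prod.cong)
      (auto simp: transition_function_def xy)
  \<comment> \<open>The indicator of \<open>x i = y i\<close> times the indicator of agreement off
    \<open>i\<close> is that of full agreement, whatever \<open>i\<close> is; so the degrees add up
    to the diagonal of the power graph.\<close>
  also have "\<dots> = (\<Sum>i<m. adj_matrix G (x i) (y i) * ?\<delta> i) -
      (\<Sum>i<m. real (deg G (x i)) * (\<Prod>j<m. of_bool (x j = y j)))"
    unfolding sum_subtractf[symmetric]
  proof (intro sum.cong refl)
    fix i assume i: "i \<in> {..<m}"
    then have "(\<Prod>j<m. of_bool (x j = y j)) = of_bool (x i = y i) * ?\<delta> i"
      by (intro prod.remove) auto
    then show "rate_matrix G (x i) (y i) * ?\<delta> i =
        adj_matrix G (x i) (y i) * ?\<delta> i - real (deg G (x i)) * (\<Prod>j<m. of_bool (x j = y j))"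
      by (simp only: rate_matrix_def deg_matrix_def diag_def row_sum_eq_deg)
         (simp add: left_diff_distrib)
  qed
  also have "\<dots> = rate_matrix (cart_power G m) x y"
  proof -
    have "(\<Prod>j<m. of_bool (x j = y j)) = (of_bool (x = y) :: real)"
    proof (cases "x = y")
      case False
      then obtain j where "j < m" "x j \<noteq> y j"
        using x y PiE_ext[of x "{..<m}" "\<lambda>_. pverts G" y] by (auto simp: pverts_cart_power)
      then show ?thesis using False by (auto simp: prod_zero_iff)
    qed simp
    then show ?thesis
      by (simp only: sum_distrib_right[symmetric] rate_matrix_def deg_matrix_def diag_def
          adj_matrix_cart_power[OF x y] row_sum_cart_power[OF x]) simp
  qed
  finally show ?thesis .
qed

section \<open>The jump chain of a right-continuous Markov process\<close>

subsection \<open>Jumps of a path and of its restriction to a grid\<close>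

text \<open>\<open>reach f z n k\<close>: the sequence \<open>f\<close> makes its \<open>n\<close>-th change of value at index \<open>k\<close>, and its
  successive values until then are \<open>z 0, \<dots>, z n\<close>.\<close>

primrec reach :: "(nat \<Rightarrow> 's) \<Rightarrow> (nat \<Rightarrow> 's) \<Rightarrow> nat \<Rightarrow> nat \<Rightarrow> bool" where
  "reach f z 0 k \<longleftrightarrow> k = 0 \<and> f 0 = z 0"
| "reach f z (Suc n) k \<longleftrightarrow>
    (\<exists>j<k. reach f z n j \<and> (\<forall>i\<in>{j..<k}. f i = z n) \<and> f k = z (Suc n))"

lemma reach_value: "reach f z n k \<Longrightarrow> f k = z n"
  by (cases n) auto

text \<open>Makes \<open>reach f z n k\<close> an event of the past up to index \<open>k\<close>, to
  which the Markov property at \<open>k\<close> can be applied.\<close>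

lemma reach_cong:
  assumes "\<And>i. i \<le> k \<Longrightarrow> f i = g i"
  shows "reach f z n k \<longleftrightarrow> reach g z n k"
  using assms
proof (induction n arbitrary: k)
  case (Suc n)
  have "reach f z n j \<longleftrightarrow> reach g z n j" if "j < k" for j
    using Suc that by (meson less_imp_le order_trans)
  moreover have "(\<forall>i\<in>{j..<k}. f i = z n) \<longleftrightarrow> (\<forall>i\<in>{j..<k}. g i = z n)" for j
    using Suc.prems by auto
  ultimately show ?case using Suc.prems[of k] by auto
qed auto

text \<open>As consecutive values differ, the value \<open>z n\<close> can be held only up to the
  first change after index \<open>j\<close>; hence \<open>f\<close> determines the index of the n-th
  change and the values visited. This makes the events for different indices disjoint and identifies
  a prescribed \<open>z\<close> with the true jump chain.\<close>

lemma reach_unique: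
  assumes "reach f z n k" "reach f z' n k'"
    and "\<And>i. i < n \<Longrightarrow> z i \<noteq> z (Suc i)" "\<And>i. i < n \<Longrightarrow> z' i \<noteq> z' (Suc i)"
  shows "k = k' \<and> (\<forall>i\<le>n. z i = z' i)"
  using assms
proof (induction n arbitrary: k k')
  case (Suc n)
  obtain j where j: "j < k" "reach f z n j" "\<forall>i\<in>{j..<k}. f i = z n" "f k = z (Suc n)"
    using Suc.prems(1) by auto
  obtain j' where j': "j' < k'" "reach f z' n j'" "\<forall>i\<in>{j'..<k'}. f i = z' n" "f k' = z' (Suc n)"
    using Suc.prems(2) by auto
  have IH: "j = j'" "\<forall>i\<le>n. z i = z' i"
    using Suc.IH[OF j(2) j'(2)] Suc.prems(3,4) by auto
  have "z n \<noteq> z (Suc n)" "z' n \<noteq> z' (Suc n)" using Suc.prems(3,4) by auto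
  with j j' IH have "\<not> k < k'" "\<not> k' < k"
    by (metis atLeastLessThan_iff less_imp_le order_refl)+
  then have "k = k'" by simp
  with IH j(4) j'(4) show ?case by (auto simp: le_Suc_eq)
qed auto

declare jump_time.simps(2) [simp del]

context
  fixes f :: "real \<Rightarrow> 's"
  assumes right_cont: "\<And>t. 0 \<le> t \<Longrightarrow> \<exists>\<epsilon>>0. \<forall>s\<in>{t..<t + \<epsilon>}. f s = f t"
    and not_const: "\<And>t. 0 \<le> t \<Longrightarrow> \<exists>s\<ge>t. f s \<noteq> f t"
begin

text \<open>Right-continuity enters at both ends: at the earlier jump time it makes the holding time
  positive, at the later one it makes the infimum attained, since otherwise the old value would
  persist a little beyond it. Non-constancy keeps the infimum from being taken over the empty
  set.\<close>

lemma jump_time_step: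
  assumes "0 \<le> jump_time f n"
  shows "jump_time f n < jump_time f (Suc n)"
    and "f (jump_time f (Suc n)) \<noteq> f (jump_time f n)"
    and "\<And>s. jump_time f n \<le> s \<Longrightarrow> s < jump_time f (Suc n) \<Longrightarrow> f s = f (jump_time f n)"
proof -
  let ?a = "jump_time f n"
  let ?A = "{t. ?a \<le> t \<and> f t \<noteq> f ?a}"
  let ?b = "jump_time f (Suc n)"
  have b: "?b = Inf ?A" by (simp add: jump_time.simps(2))
  have ne: "?A \<noteq> {}" using not_const[OF assms] by auto
  have bdd: "bdd_below ?A" by (auto intro: bdd_belowI)
  obtain \<epsilon> where \<epsilon>: "\<epsilon> > 0" "\<forall>s\<in>{?a..<?a + \<epsilon>}. f s = f ?a" using right_cont[OF assms] by blast
  have "?a + \<epsilon> \<le> ?b" unfolding b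
  proof (rule cInf_greatest[OF ne])
    fix t assume "t \<in> ?A"
    then show "?a + \<epsilon> \<le> t" using bspec[OF \<epsilon>(2), of t] by (cases "?a + \<epsilon> \<le> t") auto
  qed
  then show ab: "?a < ?b" using \<epsilon>(1) by linarith
  show const: "f s = f ?a" if "?a \<le> s" "s < ?b" for s
  proof (rule ccontr)
    assume "f s \<noteq> f ?a"
    then have "Inf ?A \<le> s" using that by (intro cInf_lower bdd) auto
    with that b show False by linarith
  qed
  have "0 \<le> ?b" using ab assms by linarith
  then obtain \<epsilon>' where \<epsilon>': "\<epsilon>' > 0" "\<forall>s\<in>{?b..<?b + \<epsilon>'}. f s = f ?b" using right_cont by blast
  show "f ?b \<noteq> f ?a"
  proof
    assume "f ?b = f ?a"
    have "?b + \<epsilon>' \<le> Inf ?A"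
    proof (rule cInf_greatest[OF ne])
      fix t assume t: "t \<in> ?A"
      show "?b + \<epsilon>' \<le> t"
      proof (rule ccontr)
        assume "\<not> ?b + \<epsilon>' \<le> t"
        moreover have "?b \<le> t" unfolding b using t by (intro cInf_lower bdd)
        ultimately have "f t = f ?b" by (intro bspec[OF \<epsilon>'(2)]) simp
        with t \<open>f ?b = f ?a\<close> show False by simp
      qed
    qed
    with b \<epsilon>'(1) show False by linarith
  qed
qed

lemma jump_time_nonneg: "0 \<le> jump_time f n"
proof (induction n)
  case (Suc n)
  then show ?case using jump_time_step(1)[OF Suc] by linarith
qed simp

text \<open>On a fine enough grid each of the first \<open>n\<close> jumps is seen at an index of
  its own, shortly after it happens. The margin \<open>\<delta>\<close> is arbitrary so that the
  induction can demand that a jump be seen before the next one occurs: the hypothesis is used with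
  the holding time as margin.\<close>

lemma grid_reach_jumps:
  assumes "0 < \<delta>"
  shows "\<forall>\<^sub>F N in sequentially. \<exists>k.
    reach (\<lambda>i. f (real i * inverse (real (Suc N)))) (\<lambda>i. f (jump_time f i)) n k \<and>
    jump_time f n \<le> real k * inverse (real (Suc N)) \<and>
    real k * inverse (real (Suc N)) < jump_time f n + \<delta>"
  using assms
proof (induction n arbitrary: \<delta>)
  case 0
  then show ?case by (intro always_eventually allI exI[of _ 0]) auto
next
  case (Suc n)
  let ?a = "jump_time f n" and ?b = "jump_time f (Suc n)"
  let ?h = "\<lambda>N. inverse (real (Suc N))"
  note step = jump_time_step[OF jump_time_nonneg, of n]
  have b0: "0 \<le> ?b" by (rule jump_time_nonneg)
  obtain \<epsilon> where \<epsilon>: "\<epsilon> > 0" "\<forall>s\<in>{?b..<?b + \<epsilon>}. f s = f ?b"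
    using right_cont[OF b0] by blast
  have "\<forall>\<^sub>F N in sequentially. ?h N < min \<delta> \<epsilon>"
    by (rule order_tendstoD(2)[OF LIMSEQ_inverse_real_of_nat]) (use \<epsilon>(1) \<open>0 < \<delta>\<close> in auto)
  moreover have "\<forall>\<^sub>F N in sequentially. \<exists>k. reach (\<lambda>i. f (real i * ?h N)) (\<lambda>i. f (jump_time f i)) n k \<and>
      ?a \<le> real k * ?h N \<and> real k * ?h N < ?a + (?b - ?a)"
    using step(1) by (intro Suc.IH) linarith
  ultimately show ?case
  proof eventually_elim
    case (elim N)
    define h where "h = ?h N"
    have h: "0 < h" "h < \<delta>" "h < \<epsilon>" using elim by (auto simp: h_def)
    obtain k where k: "reach (\<lambda>i. f (real i * h)) (\<lambda>i. f (jump_time f i)) n k"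
        "?a \<le> real k * h" "real k * h < ?b"
      using elim by (auto simp: h_def)
    \<comment> \<open>The first grid index at or after \<open>?b\<close>. As
      \<open>h < \<epsilon>\<close>, its grid point still lies where \<open>f\<close> has its new
      value, while the indices from \<open>k\<close> up to it see the old one.\<close>
    define k' where "k' = nat \<lceil>?b / h\<rceil>"
    have "real k' = of_int \<lceil>?b / h\<rceil>" using b0 h by (simp add: k'_def)
    then have "?b / h \<le> real k'" "real k' < ?b / h + 1" by linarith+
    then have k': "?b \<le> real k' * h" "real k' * h < ?b + h"
      using h(1) by (simp_all add: field_simps)
    have "real k * h < real k' * h" using k(3) k'(1) by linarith
    then have "k < k'" using h(1) by simp
    moreover have "f (real i * h) = f ?a" if "i \<in> {k..<k'}" for i
    proof (rule step(3))
      have "real k * h \<le> real i * h" using that h(1) by simp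
      with k(2) show "?a \<le> real i * h" by linarith
      have "real i + 1 \<le> real k'" using that by auto
      then have "real i < ?b / h" using \<open>real k' < ?b / h + 1\<close> by linarith
      then show "real i * h < ?b" using h(1) by (simp add: field_simps)
    qed
    moreover have "f (real k' * h) = f ?b" using k' h(3) by (intro bspec[OF \<epsilon>(2)]) simp
    ultimately have "reach (\<lambda>i. f (real i * h)) (\<lambda>i. f (jump_time f i)) (Suc n) k'"
      using k(1) by auto
    with k' h(2) show ?case unfolding h_def[symmetric] by (intro exI[of _ k']) auto
  qed
qed

end

subsection \<open>Measurability of the jump chain\<close>

lemma pred_eq_count_space_finite:
  assumes "finite S" "f \<in> M \<rightarrow>\<^sub>M count_space S" "g \<in> M \<rightarrow>\<^sub>M count_space S"
  shows "Measurable.pred M (\<lambda>\<omega>. f \<omega> = g \<omega>)"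
proof -
  have "Measurable.pred M (\<lambda>\<omega>. \<exists>x\<in>S. f \<omega> = x \<and> g \<omega> = x)"
    using assms by (intro pred_intros_finite pred_intros_logic pred_eq_const2) auto
  moreover have "(\<exists>x\<in>S. f \<omega> = x \<and> g \<omega> = x) \<longleftrightarrow> f \<omega> = g \<omega>" if "\<omega> \<in> space M" for \<omega>
    using measurable_space[OF assms(2) that] by auto
  ultimately show ?thesis by (subst measurable_cong) auto
qed

text \<open>An infimum is below \<open>r\<close> iff some element of the set is, and by
  right-continuity there is then a rational one, because a new value lasts for a while. This leaves
  countable unions.\<close>

lemma measurable_jump_time:
  fixes X :: "real \<Rightarrow> 'a \<Rightarrow> 's"
  assumes fin: "finite S"
    and X: "case_prod X \<in> borel \<Otimes>\<^sub>M M \<rightarrow>\<^sub>M count_space S"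
    and rc: "\<And>t \<omega>. \<omega> \<in> space M \<Longrightarrow> \<exists>\<epsilon>>0. \<forall>s\<in>{t..<t + \<epsilon>}. X s \<omega> = X t \<omega>"
  shows "(\<lambda>\<omega>. jump_time (\<lambda>t. X t \<omega>) n) \<in> borel_measurable M"
proof (induction n)
  case (Suc n)
  let ?J = "\<lambda>\<omega>. jump_time (\<lambda>t. X t \<omega>) n"
  let ?A = "\<lambda>\<omega>. {t. ?J \<omega> \<le> t \<and> X t \<omega> \<noteq> X (?J \<omega>) \<omega>}"
  have XJ: "(\<lambda>\<omega>. X (?J \<omega>) \<omega>) \<in> M \<rightarrow>\<^sub>M count_space S"
    using measurable_compose[OF measurable_Pair[OF Suc measurable_ident] X] by simp
  have Xq: "X q \<in> M \<rightarrow>\<^sub>M count_space S" for q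
    using measurable_compose[OF measurable_Pair[OF measurable_const measurable_ident] X, of q] by simp
  have rat: "(\<exists>t\<in>?A \<omega>. t < r) \<longleftrightarrow> (\<exists>q::rat. of_rat q \<in> ?A \<omega> \<and> of_rat q < r)"
    if \<omega>: "\<omega> \<in> space M" for \<omega> r
  proof
    assume "\<exists>t\<in>?A \<omega>. t < r"
    then obtain t where t: "?J \<omega> \<le> t" "X t \<omega> \<noteq> X (?J \<omega>) \<omega>" "t < r" by auto
    obtain \<epsilon> where \<epsilon>: "\<epsilon> > 0" "\<forall>s\<in>{t..<t + \<epsilon>}. X s \<omega> = X t \<omega>" using rc[OF \<omega>] by blast
    obtain q where q: "t < of_rat q" "of_rat q < min r (t + \<epsilon>)"
      using of_rat_dense[of t "min r (t + \<epsilon>)"] t(3) \<epsilon>(1) by auto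
    then have "X (of_rat q) \<omega> = X t \<omega>" by (intro bspec[OF \<epsilon>(2)]) simp
    with t q show "\<exists>q::rat. of_rat q \<in> ?A \<omega> \<and> of_rat q < r" by (intro exI[of _ q]) auto
  qed auto
  show ?case
    unfolding borel_measurable_iff_less
  proof
    fix r :: real
    \<comment> \<open>On paths with no further change the next jump time is the unspecified constant
      \<open>Inf {}\<close>; the second disjunct accounts for it.\<close>
    have "Measurable.pred M (\<lambda>\<omega>. (\<exists>q::rat. of_rat q \<in> ?A \<omega> \<and> of_rat q < r) \<or>
        (\<not> (\<exists>q::rat. of_rat q \<in> ?A \<omega>)) \<and> Inf {} < r)"
      using Suc pred_eq_count_space_finite[OF fin Xq XJ]
      by (intro pred_intros_logic pred_intros_countable) simp_all
    moreover have "Inf (?A \<omega>) < r \<longleftrightarrow> (\<exists>q::rat. of_rat q \<in> ?A \<omega> \<and> of_rat q < r) \<or>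
        (\<not> (\<exists>q::rat. of_rat q \<in> ?A \<omega>)) \<and> Inf {} < r" if "\<omega> \<in> space M" for \<omega>
    proof (cases "?A \<omega> = {}")
      case True
      show ?thesis unfolding True by simp
    next
      case False
      then obtain t where t: "t \<in> ?A \<omega>" by blast
      have "\<exists>t'\<in>?A \<omega>. t' < t + 1" using t less_add_one by (rule bexI[rotated])
      then have ex: "\<exists>q::rat. of_rat q \<in> ?A \<omega>" unfolding rat[OF that] by (elim exE conjE) (rule exI)
      have inf: "Inf (?A \<omega>) < r \<longleftrightarrow> (\<exists>t\<in>?A \<omega>. t < r)"
        by (rule cInf_less_iff[OF False]) (auto intro: bdd_belowI)
      have "F \<Longrightarrow> E \<longleftrightarrow> E \<or> \<not> F \<and> c" for E F c by blast
      from this[OF ex] show ?thesis unfolding inf rat[OF that] .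
    qed
    ultimately have "Measurable.pred M (\<lambda>\<omega>. Inf (?A \<omega>) < r)"
      by (subst measurable_cong) auto
    then show "{\<omega> \<in> space M. jump_time (\<lambda>t. X t \<omega>) (Suc n) < r} \<in> sets M"
      by (simp add: pred_def jump_time.simps(2))
  qed
qed simp

text \<open>Evaluating \<open>X\<close> at a random time is a composition that requires joint
  measurability in time and outcome.\<close>

lemma measurable_jump_chain:
  fixes X :: "real \<Rightarrow> 'a \<Rightarrow> 's"
  assumes "finite S" and X: "case_prod X \<in> borel \<Otimes>\<^sub>M M \<rightarrow>\<^sub>M count_space S"
    and "\<And>t \<omega>. \<omega> \<in> space M \<Longrightarrow> \<exists>\<epsilon>>0. \<forall>s\<in>{t..<t + \<epsilon>}. X s \<omega> = X t \<omega>"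
  shows "jump_chain X n \<in> M \<rightarrow>\<^sub>M count_space S"
  using measurable_compose[OF measurable_Pair[OF measurable_jump_time[OF assms] measurable_ident] X]
  by (simp add: jump_chain_def[abs_def])

subsection \<open>The law of the jump chain\<close>

lemma all_le_Suc: "(\<forall>i\<le>Suc k. Q i) \<longleftrightarrow> (\<forall>i\<le>k. Q i) \<and> Q (Suc k)"
  by (auto simp: le_Suc_eq)

text \<open>The Markov property is stated with products of unconditional probabilities, so null
  pasts are no exception and the identity can be summed over pasts.\<close>

locale right_cont_markov_process = prob_space M for M :: "'a measure" +
  fixes S :: "'s set" and P :: "real \<Rightarrow> 's \<Rightarrow> 's \<Rightarrow> real" and X :: "real \<Rightarrow> 'a \<Rightarrow> 's"
  assumes fin: "finite S"
    and tf: "transition_function S P"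
    and X_meas: "\<And>t. 0 \<le> t \<Longrightarrow> X t \<in> M \<rightarrow>\<^sub>M count_space S"
    and rc: "\<And>t \<omega>. \<omega> \<in> space M \<Longrightarrow> 0 \<le> t \<Longrightarrow> \<exists>\<epsilon>>0. \<forall>s\<in>{t..<t + \<epsilon>}. X s \<omega> = X t \<omega>"
    and markov: "\<And>n t x. 0 \<le> t 0 \<Longrightarrow> (\<And>k. k \<le> n \<Longrightarrow> t k < t (Suc k)) \<Longrightarrow>
      (\<And>k. k \<le> Suc n \<Longrightarrow> x k \<in> S) \<Longrightarrow>
      \<P>(\<omega> in M. \<forall>k\<le>Suc n. X (t k) \<omega> = x k) =
      \<P>(\<omega> in M. \<forall>k\<le>n. X (t k) \<omega> = x k) * P (t (Suc n) - t n) (x n) (x (Suc n))"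
begin

lemma X_in: "\<omega> \<in> space M \<Longrightarrow> 0 \<le> t \<Longrightarrow> X t \<omega> \<in> S"
  using measurable_space[OF X_meas] by fastforce

lemma sets_X_eq:
  assumes "0 \<le> t"
  shows "{\<omega> \<in> space M. X t \<omega> = x} \<in> sets M"
proof -
  have "{\<omega> \<in> space M. X t \<omega> = x} = X t -` ({x} \<inter> S) \<inter> space M"
    using X_in[OF _ assms] by auto
  then show ?thesis using measurable_sets[OF X_meas[OF assms], of "{x} \<inter> S"] by simp
qed

lemma sets_X_all:
  assumes "finite I" "\<And>i. i \<in> I \<Longrightarrow> 0 \<le> t i"
  shows "{\<omega> \<in> space M. \<forall>i\<in>I. X (t i) \<omega> = a i} \<in> sets M"
  using assms by (intro sets.sets_Collect_finite_All sets_X_eq) auto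

section \<open>The Markov chain on a grid of mesh \<open>h\<close>\<close>

context
  fixes h :: real
  assumes h: "0 < h"
begin

definition skel :: "'a \<Rightarrow> nat \<Rightarrow> 's" where
  "skel \<omega> i = X (real i * h) \<omega>"

lemma skel_in: "\<omega> \<in> space M \<Longrightarrow> skel \<omega> i \<in> S"
  using X_in[of \<omega> "real i * h"] h by (simp add: skel_def)

lemma sets_cylinder:
  fixes k :: nat
  shows "{\<omega> \<in> space M. \<forall>i\<le>k. skel \<omega> i = a i} \<in> sets M"
proof -
  have "{\<omega> \<in> space M. \<forall>i\<in>{..k}. X (real i * h) \<omega> = a i} \<in> sets M"
    by (rule sets_X_all) (use h in auto)
  then show ?thesis by (simp only: skel_def Ball_def atMost_iff)
qed

text \<open>Finitely many states give finitely many pasts, so an event decided by the grid values up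
  to index \<open>k\<close> is a finite union of cylinders. The extra condition
  \<open>\<Psi>\<close> allows the same decomposition with one further step attached.\<close>

lemma past_event_Union:
  assumes dep: "\<And>f g. (\<And>i. i \<le> k \<Longrightarrow> f i = g i) \<Longrightarrow> \<Phi> f \<longleftrightarrow> \<Phi> g"
  shows "{\<omega> \<in> space M. \<Phi> (skel \<omega>) \<and> \<Psi> \<omega>} =
    (\<Union>a\<in>{a \<in> {..k} \<rightarrow>\<^sub>E S. \<Phi> a}. {\<omega> \<in> space M. (\<forall>i\<le>k. skel \<omega> i = a i) \<and> \<Psi> \<omega>})"
proof (intro set_eqI iffI)
  fix \<omega> assume \<omega>: "\<omega> \<in> {\<omega> \<in> space M. \<Phi> (skel \<omega>) \<and> \<Psi> \<omega>}"
  let ?a = "\<lambda>i\<in>{..k}. skel \<omega> i"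
  have "\<Phi> ?a \<longleftrightarrow> \<Phi> (skel \<omega>)" by (rule dep) simp
  moreover have "?a \<in> {..k} \<rightarrow>\<^sub>E S" using \<omega> skel_in by (intro restrict_PiE_iff[THEN iffD2]) blast
  ultimately have "?a \<in> {a \<in> {..k} \<rightarrow>\<^sub>E S. \<Phi> a}" using \<omega> by blast
  moreover have "\<omega> \<in> {\<omega> \<in> space M. (\<forall>i\<le>k. skel \<omega> i = ?a i) \<and> \<Psi> \<omega>}" using \<omega> by auto
  ultimately show "\<omega> \<in> (\<Union>a\<in>{a \<in> {..k} \<rightarrow>\<^sub>E S. \<Phi> a}.
      {\<omega> \<in> space M. (\<forall>i\<le>k. skel \<omega> i = a i) \<and> \<Psi> \<omega>})" by blast
next
  fix \<omega> assume "\<omega> \<in> (\<Union>a\<in>{a \<in> {..k} \<rightarrow>\<^sub>E S. \<Phi> a}.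
      {\<omega> \<in> space M. (\<forall>i\<le>k. skel \<omega> i = a i) \<and> \<Psi> \<omega>})"
  then obtain a where a: "\<Phi> a" "\<omega> \<in> space M" "\<forall>i\<le>k. skel \<omega> i = a i" "\<Psi> \<omega>" by blast
  have "\<Phi> (skel \<omega>) \<longleftrightarrow> \<Phi> a" by (rule dep) (use a(3) in blast)
  with a show "\<omega> \<in> {\<omega> \<in> space M. \<Phi> (skel \<omega>) \<and> \<Psi> \<omega>}" by blast
qed

lemma finite_past: fixes k :: nat shows "finite {a \<in> {..k} \<rightarrow>\<^sub>E S. \<Phi> a}"
  using fin by (intro finite_Collect_conjI disjI1) (auto intro: finite_PiE)

lemma sets_past_event:
  assumes "\<And>f g. (\<And>i. i \<le> k \<Longrightarrow> f i = g i) \<Longrightarrow> \<Phi> f \<longleftrightarrow> \<Phi> g"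
  shows "{\<omega> \<in> space M. \<Phi> (skel \<omega>)} \<in> sets M"
proof -
  have "{\<omega> \<in> space M. \<Phi> (skel \<omega>) \<and> True} \<in> sets M"
    by (subst past_event_Union[where k = k, OF assms], assumption)
       (intro sets.finite_UN finite_past, simp add: sets_cylinder)
  then show ?thesis by simp
qed

lemma cylinder_step:
  assumes "\<And>i. i \<le> k \<Longrightarrow> a i \<in> S" "y \<in> S"
  shows "\<P>(\<omega> in M. (\<forall>i\<le>k. skel \<omega> i = a i) \<and> skel \<omega> (Suc k) = y) =
    \<P>(\<omega> in M. \<forall>i\<le>k. skel \<omega> i = a i) * P h (a k) y"
proof -
  let ?a = "a(Suc k := y)"
  have "\<P>(\<omega> in M. \<forall>i\<le>Suc k. skel \<omega> i = ?a i) =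
      \<P>(\<omega> in M. \<forall>i\<le>k. skel \<omega> i = ?a i) * P (real (Suc k) * h - real k * h) (?a k) (?a (Suc k))"
    unfolding skel_def
    by (rule markov[of "\<lambda>i. real i * h" k ?a]) (use h assms in \<open>auto simp: le_Suc_eq\<close>)
  moreover have past: "(\<forall>i\<le>k. skel \<omega> i = ?a i) \<longleftrightarrow> (\<forall>i\<le>k. skel \<omega> i = a i)" for \<omega>
    by (intro all_cong) simp
  moreover have "real (Suc k) * h - real k * h = h" by (simp add: algebra_simps)
  moreover have "?a k = a k" "?a (Suc k) = y" by simp_all
  ultimately show ?thesis by (simp only: all_le_Suc)
qed

text \<open>Summation of the Markov property over the cylinders that make up the past. The common
  last value \<open>x\<close> lets the same transition probability factor out of every term.\<close>

lemma past_event_step: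
  assumes dep: "\<And>f g. (\<And>i. i \<le> k \<Longrightarrow> f i = g i) \<Longrightarrow> \<Phi> f \<longleftrightarrow> \<Phi> g"
    and val: "\<And>f. \<Phi> f \<Longrightarrow> f k = x" and y: "y \<in> S"
  shows "\<P>(\<omega> in M. \<Phi> (skel \<omega>) \<and> skel \<omega> (Suc k) = y) = \<P>(\<omega> in M. \<Phi> (skel \<omega>)) * P h x y"
proof -
  let ?C = "{a \<in> {..k} \<rightarrow>\<^sub>E S. \<Phi> a}"
  have disj: "disjoint_family_on (\<lambda>a. {\<omega> \<in> space M. (\<forall>i\<le>k. skel \<omega> i = a i) \<and> \<Psi> \<omega>}) ?C" for \<Psi>
  proof -
    have "a = b" if "a \<in> ?C" "b \<in> ?C" "\<forall>i\<le>k. skel \<omega> i = a i" "\<forall>i\<le>k. skel \<omega> i = b i" for a b \<omega>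
      proof (rule PiE_ext)
      show "a \<in> {..k} \<rightarrow>\<^sub>E S" "b \<in> {..k} \<rightarrow>\<^sub>E S" using that by blast+
      show "a i = b i" if "i \<in> {..k}" for i
        using that \<open>\<forall>i\<le>k. skel \<omega> i = a i\<close> \<open>\<forall>i\<le>k. skel \<omega> i = b i\<close> by force
    qed
    then show ?thesis unfolding disjoint_family_on_def by blast
  qed
  have Sk: "{\<omega> \<in> space M. skel \<omega> (Suc k) = y} \<in> sets M" using h unfolding skel_def by (intro sets_X_eq) auto
  have ev: "{\<omega> \<in> space M. (\<forall>i\<le>k. skel \<omega> i = a i) \<and> skel \<omega> (Suc k) = y} \<in> sets M" for a
    using sets.Int[OF sets_cylinder[of k a] Sk] by (rule back_subst[of "\<lambda>A. A \<in> sets M"]) auto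
  have "\<P>(\<omega> in M. \<Phi> (skel \<omega>) \<and> skel \<omega> (Suc k) = y) =
      (\<Sum>a\<in>?C. \<P>(\<omega> in M. (\<forall>i\<le>k. skel \<omega> i = a i) \<and> skel \<omega> (Suc k) = y))"
    by (subst past_event_Union[where k = k, OF dep], assumption,
        rule finite_measure_finite_Union[OF finite_past _ disj]) (use ev in blast)
  also have "\<dots> = (\<Sum>a\<in>?C. \<P>(\<omega> in M. \<forall>i\<le>k. skel \<omega> i = a i) * P h x y)"
  proof (intro sum.cong refl)
    fix a assume a: "a \<in> ?C"
    then have "a k = x" using val by simp
    with a show "\<P>(\<omega> in M. (\<forall>i\<le>k. skel \<omega> i = a i) \<and> skel \<omega> (Suc k) = y) =
        \<P>(\<omega> in M. \<forall>i\<le>k. skel \<omega> i = a i) * P h x y"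
      using cylinder_step[of k a y] y PiE_mem[of a "{..k}" "\<lambda>_. S"] by simp
  qed
  also have "\<dots> = (\<Sum>a\<in>?C. \<P>(\<omega> in M. (\<forall>i\<le>k. skel \<omega> i = a i) \<and> True)) * P h x y"
    by (simp only: sum_distrib_right simp_thms)
  also have "(\<Sum>a\<in>?C. \<P>(\<omega> in M. (\<forall>i\<le>k. skel \<omega> i = a i) \<and> True)) =
      \<P>(\<omega> in M. \<Phi> (skel \<omega>) \<and> True)"
  proof (subst past_event_Union[where k = k, OF dep], assumption,
      rule finite_measure_finite_Union[OF finite_past _ disj, symmetric])
    show "(\<lambda>a. {\<omega> \<in> space M. (\<forall>i\<le>k. skel \<omega> i = a i) \<and> True}) ` ?C \<subseteq> sets M"
      using sets_cylinder[of k] by (simp only: simp_thms) blast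
  qed
  finally show ?thesis by (simp only: simp_thms)
qed

lemma hold_cong:
  assumes "\<And>i. i \<le> j + l \<Longrightarrow> f i = g i"
  shows "reach f z n j \<and> (\<forall>i\<in>{j..j + l}. f i = z n) \<longleftrightarrow>
    reach g z n j \<and> (\<forall>i\<in>{j..j + l}. g i = z n)"
  using assms by (intro arg_cong2[where f = "(\<and>)"] reach_cong ball_cong) auto

text \<open>Each further index spent at \<open>z n\<close> costs one factor. The exponent is
  \<open>l\<close> and not \<open>l + 1\<close>, because \<open>reach\<close> already fixes the
  value at index \<open>j\<close>.\<close>

lemma prob_hold:
  assumes "z n \<in> S"
  shows "\<P>(\<omega> in M. reach (skel \<omega>) z n j \<and> (\<forall>i\<in>{j..j + l}. skel \<omega> i = z n)) =
    \<P>(\<omega> in M. reach (skel \<omega>) z n j) * P h (z n) (z n) ^ l"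
proof (induction l)
  case 0
  have "reach (skel \<omega>) z n j \<and> (\<forall>i\<in>{j..j + 0}. skel \<omega> i = z n) \<longleftrightarrow> reach (skel \<omega>) z n j" for \<omega>
    using reach_value[of "skel \<omega>" z n j] by auto
  then show ?case by simp
next
  case (Suc l)
  let ?\<Phi> = "\<lambda>f. reach f z n j \<and> (\<forall>i\<in>{j..j + l}. f i = z n)"
  have "\<P>(\<omega> in M. ?\<Phi> (skel \<omega>) \<and> skel \<omega> (Suc (j + l)) = z n) =
      \<P>(\<omega> in M. ?\<Phi> (skel \<omega>)) * P h (z n) (z n)"
  proof (rule past_event_step)
    fix f g :: "nat \<Rightarrow> 's" assume "\<And>i. i \<le> j + l \<Longrightarrow> f i = g i"
    then show "?\<Phi> f \<longleftrightarrow> ?\<Phi> g" by (rule hold_cong)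
  qed (use assms in auto)
  moreover have "?\<Phi> (skel \<omega>) \<and> skel \<omega> (Suc (j + l)) = z n \<longleftrightarrow>
      reach (skel \<omega>) z n j \<and> (\<forall>i\<in>{j..j + Suc l}. skel \<omega> i = z n)" for \<omega>
    by (auto simp: le_Suc_eq)
  ultimately show ?case using Suc.IH by simp
qed

lemma sets_reach: "{\<omega> \<in> space M. reach (skel \<omega>) z n j} \<in> sets M"
  by (rule sets_past_event[of j]) (rule reach_cong)

lemma sets_hold_jump: "{\<omega> \<in> space M. reach (skel \<omega>) z n j \<and> (\<forall>i\<in>{j..j + l}. skel \<omega> i = z n) \<and>
    skel \<omega> (Suc (j + l)) = y} \<in> sets M"
proof (rule sets_past_event[of "Suc (j + l)"])
  fix f g :: "nat \<Rightarrow> 's" assume *: "\<And>i. i \<le> Suc (j + l) \<Longrightarrow> f i = g i"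
  have "f (Suc (j + l)) = g (Suc (j + l))" by (rule *) simp
  moreover have "reach f z n j \<and> (\<forall>i\<in>{j..j + l}. f i = z n) \<longleftrightarrow>
      reach g z n j \<and> (\<forall>i\<in>{j..j + l}. g i = z n)"
    by (rule hold_cong) (rule *, simp)
  ultimately show "reach f z n j \<and> (\<forall>i\<in>{j..j + l}. f i = z n) \<and> f (Suc (j + l)) = y \<longleftrightarrow>
      reach g z n j \<and> (\<forall>i\<in>{j..j + l}. g i = z n) \<and> g (Suc (j + l)) = y"
    by metis
qed

lemma prob_hold_jump:
  assumes "z n \<in> S" "y \<in> S"
  shows "\<P>(\<omega> in M. reach (skel \<omega>) z n j \<and> (\<forall>i\<in>{j..j + l}. skel \<omega> i = z n) \<and>
      skel \<omega> (Suc (j + l)) = y) =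
    \<P>(\<omega> in M. reach (skel \<omega>) z n j) * P h (z n) (z n) ^ l * P h (z n) y"
proof -
  let ?\<Phi> = "\<lambda>f. reach f z n j \<and> (\<forall>i\<in>{j..j + l}. f i = z n)"
  have "\<P>(\<omega> in M. ?\<Phi> (skel \<omega>) \<and> skel \<omega> (Suc (j + l)) = y) =
      \<P>(\<omega> in M. ?\<Phi> (skel \<omega>)) * P h (z n) y"
  proof (rule past_event_step)
    fix f g :: "nat \<Rightarrow> 's" assume "\<And>i. i \<le> j + l \<Longrightarrow> f i = g i"
    then show "?\<Phi> f \<longleftrightarrow> ?\<Phi> g" by (rule hold_cong)
  qed (use assms in auto)
  then show ?thesis using prob_hold[of z n j l] assms by (simp add: conj_assoc)
qed

text \<open>Locates the next change by the index \<open>j\<close> of the previous one and the number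
  \<open>l\<close> of further indices spent at the old value; \<open>l\<close> = 0 means a change in
  the very next step.\<close>

lemma reach_Suc_iff:
  "(\<exists>k. reach f z (Suc n) k) \<longleftrightarrow>
    (\<exists>j l. reach f z n j \<and> (\<forall>i\<in>{j..j + l}. f i = z n) \<and> f (Suc (j + l)) = z (Suc n))"
proof
  assume "\<exists>k. reach f z (Suc n) k"
  then obtain k j where j: "j < k" "reach f z n j" "\<forall>i\<in>{j..<k}. f i = z n" "f k = z (Suc n)"
    by auto
  then have "{j..j + (k - Suc j)} = {j..<k}" "Suc (j + (k - Suc j)) = k" by auto
  with j show "\<exists>j l. reach f z n j \<and> (\<forall>i\<in>{j..j + l}. f i = z n) \<and> f (Suc (j + l)) = z (Suc n)"
    by metis
next
  assume "\<exists>j l. reach f z n j \<and> (\<forall>i\<in>{j..j + l}. f i = z n) \<and> f (Suc (j + l)) = z (Suc n)"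
  then obtain j l where "reach f z n j" "\<forall>i\<in>{j..j + l}. f i = z n" "f (Suc (j + l)) = z (Suc n)"
    by blast
  then show "\<exists>k. reach f z (Suc n) k"
    by (intro exI[of _ "Suc (j + l)"]) (auto simp: less_Suc_eq_le intro!: exI[of _ j])
qed

text \<open>Summation over \<open>l\<close> gives the geometric series 1 / (1 - p), with p the
  probability of staying, and summation over \<open>j\<close> gives the probability of making the
  n-th change at all. Both run over disjoint events: in \<open>j\<close> by uniqueness of the index,
  in \<open>l\<close> because the value after the change differs from the one before.\<close>

lemma prob_ex_reach:
  assumes "\<And>i. i \<le> n \<Longrightarrow> z i \<in> S" "\<And>i. i < n \<Longrightarrow> z i \<noteq> z (Suc i)"
    and hold: "\<And>x. x \<in> S \<Longrightarrow> P h x x < 1"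
  shows "\<P>(\<omega> in M. \<exists>k. reach (skel \<omega>) z n k) =
    \<P>(\<omega> in M. X 0 \<omega> = z 0) * (\<Prod>i<n. P h (z i) (z (Suc i)) / (1 - P h (z i) (z i)))"
  using assms(1,2)
proof (induction n)
  case (Suc n)
  let ?p = "P h (z n) (z n)" and ?q = "P h (z n) (z (Suc n))"
  have zS: "z n \<in> S" "z (Suc n) \<in> S" using Suc.prems(1) by auto
  have neq: "z n \<noteq> z (Suc n)" using Suc.prems(2) by auto
  have p: "0 \<le> ?p" "?p < 1" using tf h zS hold by (auto simp: transition_function_def)
  define A where "A j = {\<omega> \<in> space M. reach (skel \<omega>) z n j}" for j
  define C where "C j l = {\<omega> \<in> space M. reach (skel \<omega>) z n j \<and> (\<forall>i\<in>{j..j + l}. skel \<omega> i = z n) \<and>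
    skel \<omega> (Suc (j + l)) = z (Suc n)}" for j l
  have C_sets: "C j l \<in> sets M" for j l unfolding C_def by (rule sets_hold_jump)
  have "i = j" if "\<omega> \<in> A i" "\<omega> \<in> A j" for \<omega> i j
    using reach_unique[of "skel \<omega>" z n i z j] Suc.prems(2) that by (auto simp: A_def)
  then have A_disj: "disjoint_family A"
    unfolding disjoint_family_on_def by blast
  have C_disj: "disjoint_family (C j)" for j
  proof -
    have False if "l < l'" "\<omega> \<in> C j l" "\<omega> \<in> C j l'" for l l' \<omega>
    proof -
      have "Suc (j + l) \<in> {j..j + l'}" using that by auto
      then have "skel \<omega> (Suc (j + l)) = z n" using that(3) unfolding C_def by blast
      moreover have "skel \<omega> (Suc (j + l)) = z (Suc n)" using that(2) unfolding C_def by blast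
      ultimately show False using neq by simp
    qed
    then have "i = l" if "\<omega> \<in> C j i" "\<omega> \<in> C j l" for i l \<omega>
      using that by (meson linorder_neqE_nat)
    then show ?thesis unfolding disjoint_family_on_def by blast
  qed
  have probB: "prob (\<Union>l. C j l) = prob (A j) * (?q / (1 - ?p))" for j
  proof -
    have "(\<lambda>l. prob (C j l)) sums prob (\<Union>l. C j l)"
      using C_sets C_disj by (intro finite_measure_UNION) auto
    moreover have "prob (C j l) = prob (A j) * ?q * ?p ^ l" for l
      unfolding C_def A_def using prob_hold_jump[of z n "z (Suc n)" j l] zS by simp
    moreover have "(\<lambda>l. prob (A j) * ?q * ?p ^ l) sums (prob (A j) * ?q * (1 / (1 - ?p)))"
      using p by (intro sums_mult geometric_sums) auto
    ultimately show ?thesis using sums_unique2 by fastforce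
  qed
  have "(\<lambda>j. prob (\<Union>l. C j l)) sums prob (\<Union>j. \<Union>l. C j l)"
  proof (rule finite_measure_UNION)
    have "(\<Union>l. C j l) \<subseteq> A j" for j by (auto simp: C_def A_def)
    then show "disjoint_family (\<lambda>j. \<Union>l. C j l)"
      using A_disj unfolding disjoint_family_on_def by blast
  qed (use C_sets in auto)
  moreover have "(\<lambda>j. prob (\<Union>l. C j l)) sums (prob (\<Union>j. A j) * (?q / (1 - ?p)))"
    unfolding probB using A_disj sets_reach
    by (intro sums_mult2 finite_measure_UNION) (auto simp: A_def[abs_def])
  ultimately have "prob (\<Union>j. \<Union>l. C j l) = prob (\<Union>j. A j) * (?q / (1 - ?p))"
    by (rule sums_unique2)
  moreover have "{\<omega> \<in> space M. \<exists>k. reach (skel \<omega>) z (Suc n) k} = (\<Union>j. \<Union>l. C j l)"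
    unfolding reach_Suc_iff C_def by auto
  moreover have "{\<omega> \<in> space M. \<exists>k. reach (skel \<omega>) z n k} = (\<Union>j. A j)"
    unfolding A_def by auto
  ultimately show ?case using Suc by simp
next
  case 0
  have "(\<exists>k. reach (skel \<omega>) z 0 k) \<longleftrightarrow> X 0 \<omega> = z 0" for \<omega>
    by (simp add: skel_def)
  then show ?case by simp
qed

text \<open>Staying at \<open>x\<close> for \<open>l\<close> grid steps has probability at most
  \<open>P h x x ^ l\<close>, which tends to 0. Countably many starting indices and finitely many
  states suffice, because a path constant from a real time \<open>t\<close> on is constant on the
  grid from the first index after \<open>t / h\<close> on.\<close>

lemma AE_skel_not_const:
  assumes hold: "\<And>x. x \<in> S \<Longrightarrow> P h x x < 1"
  shows "AE \<omega> in M. \<forall>t\<ge>0. \<exists>s\<ge>t. X s \<omega> \<noteq> X t \<omega>"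
proof -
  let ?c = "\<lambda>a x \<omega>. \<forall>i. X (real (a + i) * h) \<omega> = x"
  have "AE \<omega> in M. \<not> ?c a x \<omega>" if "x \<in> S" for a x
  proof -
    let ?E = "\<lambda>l. {\<omega> \<in> space M. \<forall>k\<le>l. X (real (a + k) * h) \<omega> = x}"
    have E_sets: "?E l \<in> sets M" for l
    proof -
      have "{\<omega> \<in> space M. \<forall>i\<in>{..l}. X (real (a + i) * h) \<omega> = x} \<in> sets M"
        by (rule sets_X_all) (use h in auto)
      then show ?thesis by (simp only: Ball_def atMost_iff)
    qed
    have p: "0 \<le> P h x x" "P h x x < 1" using tf h that hold by (auto simp: transition_function_def)
    have E_le: "prob (?E l) \<le> P h x x ^ l" for l
    proof (induction l)
      case (Suc l)
      have "prob (?E (Suc l)) = prob (?E l) * P (real (a + Suc l) * h - real (a + l) * h) x x"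
        using h that by (intro markov[of "\<lambda>k. real (a + k) * h" l "\<lambda>_. x"]) auto
      also have "real (a + Suc l) * h - real (a + l) * h = h" by (simp add: algebra_simps)
      finally show ?case using mult_right_mono[OF Suc p(1)] by (simp add: mult.commute)
    qed simp
    have "prob {\<omega> \<in> space M. ?c a x \<omega>} \<le> P h x x ^ l" for l
    proof -
      have "prob {\<omega> \<in> space M. ?c a x \<omega>} \<le> prob (?E l)"
        by (intro finite_measure_mono E_sets) auto
      with E_le[of l] show ?thesis by linarith
    qed
    then have "prob {\<omega> \<in> space M. ?c a x \<omega>} \<le> 0"
      using p LIMSEQ_realpow_zero[of "P h x x"] by (intro LIMSEQ_le_const[of _ 0]) auto
    moreover have "{\<omega> \<in> space M. ?c a x \<omega>} \<in> sets M"
      using h by (intro sets.sets_Collect_countable_All sets_X_eq) auto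
    ultimately show ?thesis
      by (subst AE_iff_measurable[where N = "{\<omega> \<in> space M. ?c a x \<omega>}"])
         (auto simp: emeasure_eq_measure measure_le_0_iff)
  qed
  then have "AE \<omega> in M. \<forall>a. \<forall>x\<in>S. \<not> ?c a x \<omega>"
    using fin by (intro AE_all_countable[THEN iffD2] allI AE_finite_allI) auto
  then have "AE \<omega> in M. (\<forall>a. \<forall>x\<in>S. \<not> ?c a x \<omega>) \<and> \<omega> \<in> space M" by simp
  then show ?thesis
  proof (rule AE_mp, intro AE_I2 impI allI)
    fix \<omega> and t :: real
    assume "(\<forall>a. \<forall>x\<in>S. \<not> ?c a x \<omega>) \<and> \<omega> \<in> space M" and t: "0 \<le> t"
    then have \<omega>: "\<omega> \<in> space M" and *: "\<forall>a. \<forall>x\<in>S. \<not> ?c a x \<omega>" by blast+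
    show "\<exists>s\<ge>t. X s \<omega> \<noteq> X t \<omega>"
    proof (rule ccontr)
      assume "\<not> (\<exists>s\<ge>t. X s \<omega> \<noteq> X t \<omega>)"
      then have const: "X s \<omega> = X t \<omega>" if "t \<le> s" for s using that by blast
      let ?a = "nat \<lceil>t / h\<rceil>"
      have "t / h \<le> real ?a" by linarith
      then have "t \<le> real ?a * h" using h by (simp add: field_simps)
      moreover have "real ?a * h \<le> real (?a + i) * h" for i using h by simp
      ultimately have "?c ?a (X t \<omega>) \<omega>" using const order_trans by blast
      then show False using * X_in[OF \<omega> t] by blast
    qed
  qed
qed

end

end

text \<open>Dominated convergence for the indicators, which are eventually constant at almost every
  point.\<close>

lemma (in prob_space) prob_tendsto_AE_eventually:
  assumes [measurable]: "\<And>N. A N \<in> sets M" "B \<in> sets M"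
    and ev: "AE \<omega> in M. \<forall>\<^sub>F N in sequentially. \<omega> \<in> A N \<longleftrightarrow> \<omega> \<in> B"
  shows "(\<lambda>N. prob (A N)) \<longlonglongrightarrow> prob B"
proof -
  have "(\<lambda>N. \<integral>\<omega>. indicator (A N) \<omega> \<partial>M) \<longlonglongrightarrow> (\<integral>\<omega>. indicator B \<omega> \<partial>M :: real)"
  proof (rule integral_dominated_convergence[where w = "\<lambda>_. 1"])
    show "AE \<omega> in M. (\<lambda>N. indicator (A N) \<omega> :: real) \<longlonglongrightarrow> indicator B \<omega>"
      using ev
    proof (rule AE_mp, intro AE_I2 impI)
      fix \<omega> assume "\<forall>\<^sub>F N in sequentially. \<omega> \<in> A N \<longleftrightarrow> \<omega> \<in> B"
      then have "\<forall>\<^sub>F N in sequentially. (indicator (A N) \<omega> :: real) = indicator B \<omega>"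
        by eventually_elim (simp add: indicator_def)
      then show "(\<lambda>N. indicator (A N) \<omega> :: real) \<longlonglongrightarrow> indicator B \<omega>"
        by (rule tendsto_eventually)
    qed
  qed (auto simp: indicator_def)
  then show ?thesis by simp
qed

section \<open>Letting the mesh tend to 0\<close>

context right_cont_markov_process
begin

context
  fixes Q :: "'s \<Rightarrow> 's \<Rightarrow> real"
  assumes deriv: "\<And>x y. x \<in> S \<Longrightarrow> y \<in> S \<Longrightarrow>
      ((\<lambda>t. P t x y) has_real_derivative Q x y) (at_right 0)"
    and exit: "\<And>x. x \<in> S \<Longrightarrow> Q x x < 0"
begin

lemma transition_quotient:
  assumes "x \<in> S" "y \<in> S"
  shows "((\<lambda>h. (P h x y - of_bool (x = y)) / h) \<longlongrightarrow> Q x y) (at_right 0)"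
  using deriv[OF assms] tf assms by (simp add: has_field_derivative_iff transition_function_def)

text \<open>A function with value 1 and negative right derivative at 0 is below 1 just after 0.
  Uniformity over the states comes from finiteness.\<close>

lemma eventually_hold: "\<forall>\<^sub>F h in at_right 0. \<forall>x\<in>S. P h x x < 1"
proof (intro eventually_ball_finite fin ballI)
  fix x assume x: "x \<in> S"
  have "\<forall>\<^sub>F h in at_right 0. (P h x x - 1) / h < 0"
    using order_tendstoD(2)[OF transition_quotient[OF x x] exit[OF x]] by simp
  moreover have "\<forall>\<^sub>F h in at_right (0 :: real). 0 < h"
    by (simp add: eventually_at_right_less)
  ultimately show "\<forall>\<^sub>F h in at_right 0. P h x x < 1"
    by eventually_elim (simp add: divide_less_0_iff)
qed

lemma AE_not_const: "AE \<omega> in M. \<forall>t\<ge>0. \<exists>s\<ge>t. X s \<omega> \<noteq> X t \<omega>"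
proof -
  have "\<forall>\<^sub>F h in at_right 0. (0 :: real) < h \<and> (\<forall>x\<in>S. P h x x < 1)"
    using eventually_hold by (simp add: eventually_conj_iff eventually_at_right_less)
  then obtain h where "0 < h" "\<forall>x\<in>S. P h x x < 1"
    using eventually_happens[of _ "at_right (0 :: real)"] by auto
  then show ?thesis by (intro AE_skel_not_const) auto
qed

lemma filterlim_grid: "filterlim (\<lambda>N. inverse (real (Suc N))) (at_right 0) sequentially"
  using LIMSEQ_inverse_real_of_nat by (auto simp: filterlim_at)

text \<open>Dividing numerator and denominator by \<open>h\<close> turns both into difference
  quotients at 0, with limits \<open>Q x y\<close> and \<open>- Q x x\<close>; the latter is nonzero
  since \<open>Q x x < 0\<close>.\<close>

lemma jump_ratio_tendsto:
  assumes x: "x \<in> S" and y: "y \<in> S" and "x \<noteq> y"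
  shows "(\<lambda>N. P (inverse (real (Suc N))) x y / (1 - P (inverse (real (Suc N))) x x))
    \<longlonglongrightarrow> Q x y / - Q x x"
proof -
  have "((\<lambda>h. ((P h x y - of_bool (x = y)) / h) / (- ((P h x x - of_bool (x = x)) / h)))
      \<longlongrightarrow> Q x y / - Q x x) (at_right 0)"
    using exit[OF x] by (intro tendsto_intros transition_quotient x y) auto
  then have "((\<lambda>h. P h x y / (1 - P h x x)) \<longlongrightarrow> Q x y / - Q x x) (at_right 0)"
  proof (rule Lim_transform_eventually)
    show "\<forall>\<^sub>F h in at_right 0. ((P h x y - of_bool (x = y)) / h) / (- ((P h x x - of_bool (x = x)) / h)) =
        P h x y / (1 - P h x x)"
      using eventually_at_right_less[of "0 :: real"]
    proof eventually_elim
      case (elim h)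
      have "- ((P h x x - of_bool (x = x)) / h) = (1 - P h x x) / h"
        by (simp add: minus_divide_left)
      then show ?case using \<open>x \<noteq> y\<close> elim by simp
    qed
  qed
  from filterlim_compose[OF this filterlim_grid] show ?thesis .
qed

context
  assumes Z_meas: "\<And>n. jump_chain X n \<in> M \<rightarrow>\<^sub>M count_space S"
begin

lemma sets_jump_chain: "{\<omega> \<in> space M. \<forall>k\<le>n. jump_chain X k \<omega> = z k} \<in> sets M"
proof -
  have "{\<omega> \<in> space M. jump_chain X k \<omega> = x} = jump_chain X k -` ({x} \<inter> S) \<inter> space M" for k x
    using measurable_space[OF Z_meas[of k]] by auto
  then have "{\<omega> \<in> space M. jump_chain X k \<omega> = x} \<in> sets M" for k x
    using measurable_sets[OF Z_meas[of k], of "{x} \<inter> S"] by (simp only:) simp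
  then have "{\<omega> \<in> space M. \<forall>k\<in>{..n}. jump_chain X k \<omega> = z k} \<in> sets M"
    by (intro sets.sets_Collect_finite_All) auto
  then show ?thesis by (simp only: Ball_def atMost_iff)
qed

text \<open>For almost every path and all fine grids, the grid chain passes through the jump values
  up to index \<open>n\<close>; by uniqueness it then realises \<open>z\<close> iff the jump chain
  does. So the grid probabilities, known in closed form, converge to the one sought.\<close>

lemma prob_jump_chain_distinct:
  assumes zS: "\<And>i. i \<le> n \<Longrightarrow> z i \<in> S" and neq: "\<And>i. i < n \<Longrightarrow> z i \<noteq> z (Suc i)"
  shows "\<P>(\<omega> in M. \<forall>k\<le>n. jump_chain X k \<omega> = z k) =
    \<P>(\<omega> in M. X 0 \<omega> = z 0) * (\<Prod>i<n. Q (z i) (z (Suc i)) / - Q (z i) (z i))"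
proof -
  define h where "h N = inverse (real (Suc N))" for N
  have h0: "0 < h N" for N by (simp add: h_def)
  define A where "A N = {\<omega> \<in> space M. \<exists>k. reach (skel (h N) \<omega>) z n k}" for N
  define B where "B = {\<omega> \<in> space M. \<forall>k\<le>n. jump_chain X k \<omega> = z k}"
  have "A N \<in> sets M" for N
  proof -
    have "A N = (\<Union>k. {\<omega> \<in> space M. reach (skel (h N) \<omega>) z n k})" by (auto simp: A_def)
    then show ?thesis using sets_reach[OF h0] by (simp only:) (rule sets.countable_UN, blast)
  qed
  moreover have "B \<in> sets M" unfolding B_def by (rule sets_jump_chain)
  moreover have "AE \<omega> in M. \<forall>\<^sub>F N in sequentially. \<omega> \<in> A N \<longleftrightarrow> \<omega> \<in> B"
    using AE_not_const
  proof (rule AE_mp, intro AE_I2 impI)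
    fix \<omega> assume \<omega>: "\<omega> \<in> space M" and nc: "\<forall>t\<ge>0. \<exists>s\<ge>t. X s \<omega> \<noteq> X t \<omega>"
    let ?f = "\<lambda>t. X t \<omega>"
    have rc': "\<exists>\<epsilon>>0. \<forall>s\<in>{t..<t + \<epsilon>}. ?f s = ?f t" if "0 \<le> t" for t using rc[OF \<omega> that] .
    have nc': "\<exists>s\<ge>t. ?f s \<noteq> ?f t" if "0 \<le> t" for t using nc that by blast
    have neq': "jump_chain X i \<omega> \<noteq> jump_chain X (Suc i) \<omega>" for i
      unfolding jump_chain_def using jump_time_step(2)[OF rc' nc' jump_time_nonneg[OF rc' nc'], of i]
      by metis
    have skel_eq: "skel (h N) \<omega> = (\<lambda>i. X (real i * inverse (real (Suc N))) \<omega>)" for N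
      by (rule ext) (simp only: skel_def[OF h0], simp only: h_def)
    have "\<forall>\<^sub>F N in sequentially. \<exists>k. reach (skel (h N) \<omega>) (\<lambda>i. jump_chain X i \<omega>) n k"
      using grid_reach_jumps[OF rc' nc', of 1 n]
      unfolding skel_eq jump_chain_def by (rule eventually_mono) auto
    then show "\<forall>\<^sub>F N in sequentially. \<omega> \<in> A N \<longleftrightarrow> \<omega> \<in> B"
    proof eventually_elim
      case (elim N)
      then obtain k where k: "reach (skel (h N) \<omega>) (\<lambda>i. jump_chain X i \<omega>) n k" by blast
      show ?case
      proof
        assume "\<omega> \<in> A N"
        then obtain k' where "reach (skel (h N) \<omega>) z n k'" by (auto simp: A_def)
        from reach_unique[OF k this neq' neq] \<omega> show "\<omega> \<in> B" by (auto simp: B_def)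
      next
        assume "\<omega> \<in> B"
        then have eq: "\<And>i. i \<le> n \<Longrightarrow> jump_chain X i \<omega> = z i" by (auto simp: B_def)
        \<comment> \<open>The two sequences agree only up to index \<open>n\<close>, which is all
          that \<open>reach\<close> inspects.\<close>
        have "reach (skel (h N) \<omega>) z i k" if "reach (skel (h N) \<omega>) (\<lambda>i. jump_chain X i \<omega>) i k" "i \<le> n" for i k
          using that
        proof (induction i arbitrary: k)
          case 0
          then show ?case using eq[of 0] by auto
        next
          case (Suc i)
          then show ?case using eq[of i] eq[of "Suc i"] by fastforce
        qed
        from this[OF k] \<omega> show "\<omega> \<in> A N" by (auto simp: A_def)
      qed
    qed
  qed
  ultimately have 1: "(\<lambda>N. prob (A N)) \<longlonglongrightarrow> prob B"
    by (rule prob_tendsto_AE_eventually)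
  have "(\<lambda>N. prob {\<omega> \<in> space M. X 0 \<omega> = z 0} *
      (\<Prod>i<n. P (h N) (z i) (z (Suc i)) / (1 - P (h N) (z i) (z i)))) \<longlonglongrightarrow>
      prob {\<omega> \<in> space M. X 0 \<omega> = z 0} * (\<Prod>i<n. Q (z i) (z (Suc i)) / - Q (z i) (z i))"
    unfolding h_def by (intro tendsto_mult tendsto_const tendsto_prod jump_ratio_tendsto) (auto simp: zS neq)
  moreover have "\<forall>\<^sub>F N in sequentially. prob {\<omega> \<in> space M. X 0 \<omega> = z 0} *
      (\<Prod>i<n. P (h N) (z i) (z (Suc i)) / (1 - P (h N) (z i) (z i))) = prob (A N)"
    \<comment> \<open>The closed form presupposes staying probabilities below 1, known only for fine
      grids; hence an eventual identity.\<close>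
    using filterlim_grid[THEN filterlim_iff[THEN iffD1], rule_format, OF eventually_hold]
  proof eventually_elim
    case (elim N)
    then show ?case unfolding A_def using prob_ex_reach[OF h0, of n z N] zS neq by (simp add: h_def)
  qed
  ultimately have "(\<lambda>N. prob (A N)) \<longlonglongrightarrow>
      prob {\<omega> \<in> space M. X 0 \<omega> = z 0} * (\<Prod>i<n. Q (z i) (z (Suc i)) / - Q (z i) (z i))"
    by (rule Lim_transform_eventually)
  from LIMSEQ_unique[OF 1 this] show ?thesis unfolding B_def .
qed

text \<open>A path that never settles changes its value at every jump time, so repetitions occur
  only on the null set of settling paths.\<close>

lemma prob_jump_chain_repeat:
  assumes "i < n" "z i = z (Suc i)"
  shows "\<P>(\<omega> in M. \<forall>k\<le>n. jump_chain X k \<omega> = z k) = 0"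
proof -
  have "AE \<omega> in M. \<omega> \<notin> {\<omega> \<in> space M. \<forall>k\<le>n. jump_chain X k \<omega> = z k}"
    using AE_not_const
  proof (rule AE_mp, intro AE_I2 impI)
    fix \<omega> assume \<omega>: "\<omega> \<in> space M" and nc: "\<forall>t\<ge>0. \<exists>s\<ge>t. X s \<omega> \<noteq> X t \<omega>"
    let ?f = "\<lambda>t. X t \<omega>"
    have rc': "\<exists>\<epsilon>>0. \<forall>s\<in>{t..<t + \<epsilon>}. ?f s = ?f t" if "0 \<le> t" for t using rc[OF \<omega> that] .
    have nc': "\<exists>s\<ge>t. ?f s \<noteq> ?f t" if "0 \<le> t" for t using nc that by blast
    have "jump_chain X i \<omega> \<noteq> jump_chain X (Suc i) \<omega>"
      unfolding jump_chain_def using jump_time_step(2)[OF rc' nc' jump_time_nonneg[OF rc' nc'], of i]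
      by metis
    then show "\<omega> \<notin> {\<omega> \<in> space M. \<forall>k\<le>n. jump_chain X k \<omega> = z k}"
      using assms by (metis (mono_tags, lifting) Suc_leI less_imp_le mem_Collect_eq)
  qed
  then show ?thesis using prob_eq_0[OF sets_jump_chain] by blast
qed

text \<open>A past of positive probability has no equal neighbours, so the product formula applies
  to it and one more step multiplies it by a single factor. A repetition in the last step matches
  the zero diagonal of \<open>K\<close>.\<close>

lemma discrete_markov_chain_jump_chain:
  assumes K: "\<And>x y. x \<in> S \<Longrightarrow> y \<in> S \<Longrightarrow> K x y = (if x = y then 0 else Q x y / - Q x x)"
  shows "discrete_markov_chain M S K (jump_chain X)"
  unfolding discrete_markov_chain_def
proof (intro conjI allI impI)
  fix n and z :: "nat \<Rightarrow> 's"
  assume zS: "\<forall>k\<le>Suc n. z k \<in> S"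
    and nz: "\<P>(\<omega> in M. \<forall>k\<le>n. jump_chain X k \<omega> = z k) \<noteq> 0"
  have neq: "z i \<noteq> z (Suc i)" if "i < n" for i
    using prob_jump_chain_repeat[OF that] nz by blast
  let ?p = "\<lambda>n. \<P>(\<omega> in M. \<forall>k\<le>n. jump_chain X k \<omega> = z k)"
  have "?p (Suc n) = ?p n * K (z n) (z (Suc n))"
  proof (cases "z n = z (Suc n)")
    case True
    then show ?thesis using prob_jump_chain_repeat[of n "Suc n" z] K zS by simp
  next
    case False
    then have "z i \<noteq> z (Suc i)" if "i < Suc n" for i
      using neq that by (auto simp: less_Suc_eq)
    then show ?thesis
      using prob_jump_chain_distinct[of "Suc n" z] prob_jump_chain_distinct[of n z] neq zS False K
      by simp
  qed
  moreover have "{\<omega> \<in> space M. jump_chain X (Suc n) \<omega> = z (Suc n) \<and> (\<forall>k\<le>n. jump_chain X k \<omega> = z k)} =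
      {\<omega> \<in> space M. \<forall>k\<le>Suc n. jump_chain X k \<omega> = z k}"
    by (auto simp: le_Suc_eq)
  ultimately show "\<P>(\<omega> in M. jump_chain X (Suc n) \<omega> = z (Suc n) \<bar> \<forall>k\<le>n. jump_chain X k \<omega> = z k) =
      K (z n) (z (Suc n))"
    using nz by (simp add: cond_prob_def)
qed (rule Z_meas)

end

end

end

section \<open>A single walker\<close>

lemma emeasure_exponential_gt:
  assumes "0 < l" "0 \<le> a"
  shows "emeasure (density lborel (exponential_density l)) {a<..} = ennreal (exp (- l * a))"
proof -
  interpret E: prob_space "density lborel (exponential_density l)"
    by (rule prob_space_exponential_density[OF assms(1)])
  have "distributed (density lborel (exponential_density l)) lborel (\<lambda>x. x) (exponential_density l)"
    by (auto simp: distributed_def distr_id2)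
  from E.exponential_distributedD_gt[OF this assms(2,1)]
  show ?thesis by (simp add: E.emeasure_eq_measure greaterThan_def mult.commute)
qed

lemma measure_exponential_le:
  assumes "0 < l" "0 \<le> a"
  shows "measure (density lborel (exponential_density l)) {..a} = 1 - exp (- l * a)"
  using emeasure_erlang_density[OF assms(1), of 0 a] assms
  by (simp add: measure_def erlang_CDF_def)

lemma (in prob_space) prob_sum_values:
  assumes "finite V" "f \<in> M \<rightarrow>\<^sub>M count_space V" "E \<in> sets M"
  shows "prob E = (\<Sum>v\<in>V. \<P>(\<omega> in M. \<omega> \<in> E \<and> f \<omega> = v))"
proof -
  have "E = (\<Union>v\<in>V. {\<omega> \<in> space M. \<omega> \<in> E \<and> f \<omega> = v})"
    using sets.sets_into_space[OF assms(3)] measurable_space[OF assms(2)] by auto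
  moreover have "{\<omega> \<in> space M. \<omega> \<in> E \<and> f \<omega> = v} \<in> sets M" if "v \<in> V" for v
  proof -
    have "{\<omega> \<in> space M. \<omega> \<in> E \<and> f \<omega> = v} = E \<inter> (f -` {v} \<inter> space M)"
      using sets.sets_into_space[OF assms(3)] by auto
    then show ?thesis using measurable_sets[OF assms(2), of "{v}"] assms(3) that by simp
  qed
  then have "prob (\<Union>v\<in>V. {\<omega> \<in> space M. \<omega> \<in> E \<and> f \<omega> = v}) =
      (\<Sum>v\<in>V. \<P>(\<omega> in M. \<omega> \<in> E \<and> f \<omega> = v))"
    using assms(1) by (intro finite_measure_finite_Union) (auto simp: disjoint_family_on_def)
  ultimately show ?thesis by simp
qed

text \<open>The law of \<open>(R, W)\<close> on \<open>F\<close> is the product of \<open>\<kappa>\<close> times the law of \<open>R\<close> on \<open>F\<^sub>0\<close> with an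
  exponential law, so the claim follows from Fubini's theorem.\<close>

lemma (in prob_space) exponential_residual:
  fixes R W :: "'a \<Rightarrow> real"
  assumes l: "0 < l" and \<kappa>: "0 \<le> \<kappa>" and c: "0 \<le> c"
    and [measurable]: "F \<in> sets M" "F\<^sub>0 \<in> sets M" "R \<in> borel_measurable M" "W \<in> borel_measurable M"
    and R: "\<And>\<omega>. \<omega> \<in> F\<^sub>0 \<Longrightarrow> 0 \<le> R \<omega>"
    and law: "\<And>A B. A \<in> sets borel \<Longrightarrow> B \<in> sets borel \<Longrightarrow>
      \<P>(\<omega> in M. \<omega> \<in> F \<and> R \<omega> \<in> A \<and> W \<omega> \<in> B) =
      \<kappa> * \<P>(\<omega> in M. \<omega> \<in> F\<^sub>0 \<and> R \<omega> \<in> A) * measure (density lborel (exponential_density l)) B"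
  shows "emeasure M {\<omega> \<in> space M. \<omega> \<in> F \<and> R \<omega> + c < W \<omega>} =
    ennreal (\<kappa> * exp (- l * c)) * (\<integral>\<^sup>+\<omega>. ennreal (exp (- l * R \<omega>)) * indicator F\<^sub>0 \<omega> \<partial>M)"
proof -
  define E where "E = density lborel (exponential_density l)"
  interpret E: prob_space E unfolding E_def by (rule prob_space_exponential_density[OF l])
  have [measurable_cong]: "sets E = sets borel" by (simp add: E_def)
  define N where "N = distr (density M (\<lambda>\<omega>. ennreal \<kappa> * indicator F\<^sub>0 \<omega>)) borel R"
  define \<mu> where "\<mu> = distr (density M (indicator F)) (borel \<Otimes>\<^sub>M borel) (\<lambda>\<omega>. (R \<omega>, W \<omega>))"
  have N: "emeasure N A = ennreal (\<kappa> * \<P>(\<omega> in M. \<omega> \<in> F\<^sub>0 \<and> R \<omega> \<in> A))"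
    if [measurable]: "A \<in> sets borel" for A
  proof -
    have "emeasure N A = (\<integral>\<^sup>+\<omega>. ennreal \<kappa> * indicator F\<^sub>0 \<omega> * indicator (R -` A \<inter> space M) \<omega> \<partial>M)"
      unfolding N_def by (simp add: emeasure_distr emeasure_density)
    also have "\<dots> = (\<integral>\<^sup>+\<omega>. ennreal \<kappa> * indicator {\<omega> \<in> space M. \<omega> \<in> F\<^sub>0 \<and> R \<omega> \<in> A} \<omega> \<partial>M)"
      by (intro nn_integral_cong) (auto split: split_indicator)
    finally show ?thesis
      using \<kappa> by (simp add: nn_integral_cmult emeasure_eq_measure ennreal_mult)
  qed
  have \<mu>: "emeasure \<mu> C = emeasure M {\<omega> \<in> space M. \<omega> \<in> F \<and> (R \<omega>, W \<omega>) \<in> C}"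
    if [measurable]: "C \<in> sets (borel \<Otimes>\<^sub>M borel)" for C
  proof -
    have "emeasure \<mu> C = (\<integral>\<^sup>+\<omega>. indicator F \<omega> * indicator ((\<lambda>\<omega>. (R \<omega>, W \<omega>)) -` C \<inter> space M) \<omega> \<partial>M)"
      unfolding \<mu>_def by (simp add: emeasure_distr emeasure_density)
    also have "\<dots> = (\<integral>\<^sup>+\<omega>. indicator {\<omega> \<in> space M. \<omega> \<in> F \<and> (R \<omega>, W \<omega>) \<in> C} \<omega> \<partial>M)"
      by (intro nn_integral_cong) (auto split: split_indicator)
    finally show ?thesis by simp
  qed
  have "finite_measure N"
    by (rule finite_measureI) (use N[of UNIV] in \<open>simp add: N_def\<close>)
  then have "sigma_finite_measure N" by (simp add: finite_measure_def)
  \<comment> \<open>The two measures agree on rectangles, and this determines the product because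
    both factors are sigma-finite.\<close>
  then have prod: "N \<Otimes>\<^sub>M E = \<mu>"
  proof (rule pair_measure_eqI)
    show "sets (N \<Otimes>\<^sub>M E) = sets \<mu>"
      unfolding \<mu>_def sets_distr by (rule sets_pair_measure_cong) (simp_all add: N_def E_def)
    fix A B assume "A \<in> sets N" "B \<in> sets E"
    then have AB [measurable]: "A \<in> sets borel" "B \<in> sets borel" by (auto simp: N_def E_def)
    have "emeasure \<mu> (A \<times> B) = ennreal (\<P>(\<omega> in M. \<omega> \<in> F \<and> R \<omega> \<in> A \<and> W \<omega> \<in> B))"
      by (subst \<mu>[OF pair_measureI[OF AB]]) (simp add: emeasure_eq_measure)
    also have "\<dots> = emeasure N A * emeasure E B"
      using \<kappa> by (simp add: law[OF AB, folded E_def] N[OF AB(1)] E.emeasure_eq_measure ennreal_mult)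
    finally show "emeasure N A * emeasure E B = emeasure \<mu> (A \<times> B)" by simp
  qed (rule E.sigma_finite_measure_axioms)
  let ?C = "{p \<in> space (borel \<Otimes>\<^sub>M borel). fst p + c < snd p} :: (real \<times> real) set"
  have C: "?C \<in> sets (borel \<Otimes>\<^sub>M borel)" by measurable
  have "emeasure M {\<omega> \<in> space M. \<omega> \<in> F \<and> R \<omega> + c < W \<omega>} = emeasure \<mu> ?C"
    unfolding \<mu>[OF C] by (simp add: space_pair_measure)
  also have "\<dots> = (\<integral>\<^sup>+r. emeasure E (Pair r -` ?C) \<partial>N)"
    unfolding prod[symmetric]
  proof (rule E.emeasure_pair_measure_alt)
    have "sets (N \<Otimes>\<^sub>M E) = sets (borel \<Otimes>\<^sub>M borel)" by (simp only: prod) (simp add: \<mu>_def)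
    then show "?C \<in> sets (N \<Otimes>\<^sub>M E)" using C by (simp only:)
  qed
  also have "\<dots> = (\<integral>\<^sup>+r. emeasure E {r + c<..} \<partial>N)"
    by (intro nn_integral_cong arg_cong[where f = "emeasure E"]) (auto simp: space_pair_measure)
  also have "\<dots> = (\<integral>\<^sup>+\<omega>. ennreal \<kappa> * indicator F\<^sub>0 \<omega> * emeasure E {R \<omega> + c<..} \<partial>M)"
  proof -
    have "(\<lambda>r. emeasure E {r + c<..}) \<in> borel_measurable borel"
    proof -
      have "(\<lambda>r. emeasure E (Pair r -` ?C)) \<in> borel_measurable borel"
        by (rule E.measurable_emeasure_Pair) (use C in simp)
      moreover have "Pair r -` ?C = {r + c<..}" for r by (auto simp: space_pair_measure)
      ultimately show ?thesis by simp
    qed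
    note [measurable] = this
    show ?thesis unfolding N_def by (simp add: nn_integral_distr nn_integral_density)
  qed
  also have "\<dots> = (\<integral>\<^sup>+\<omega>. ennreal (\<kappa> * exp (- l * c)) * (ennreal (exp (- l * R \<omega>)) * indicator F\<^sub>0 \<omega>) \<partial>M)"
  proof (intro nn_integral_cong)
    fix \<omega>
    show "ennreal \<kappa> * indicator F\<^sub>0 \<omega> * emeasure E {R \<omega> + c<..} =
        ennreal (\<kappa> * exp (- l * c)) * (ennreal (exp (- l * R \<omega>)) * indicator F\<^sub>0 \<omega>)"
    proof (cases "\<omega> \<in> F\<^sub>0")
      case True
      \<comment> \<open>Memorylessness: the delay \<open>c\<close> splits off as a factor that does
        not depend on the age \<open>R\<close>. The exponential tail formula is valid at nonnegative
        arguments, which \<open>R\<close> provides on \<open>F\<^sub>0\<close>.\<close>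
      have "exp (- l * (R \<omega> + c)) = exp (- l * c) * exp (- l * R \<omega>)"
        by (simp add: ring_distribs exp_add[symmetric])
      then show ?thesis
        using True R[OF True] c l \<kappa> unfolding E_def
        by (simp add: emeasure_exponential_gt ennreal_mult mult.assoc)
    qed simp
  qed
  finally show ?thesis by (simp add: nn_integral_cmult)
qed

subsection \<open>Positions\<close>

text \<open>The time at which \<open>Y n\<close> is entered, 0 for \<open>n = 0\<close>. It involves
  only the waits before step \<open>n\<close> and so belongs to the history at step
  \<open>n\<close>, whereas \<open>arrival W (Suc n)\<close>, the time of leaving
  \<open>Y n\<close>, belongs to the next one.\<close>

definition arrival :: "(nat \<Rightarrow> 'a \<Rightarrow> real) \<Rightarrow> nat \<Rightarrow> 'a \<Rightarrow> real" where
  "arrival W n \<omega> = (\<Sum>k<n. W k \<omega>)"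

lemma position_arrival: "position Y W t \<omega> = Y (LEAST n. t < arrival W (Suc n) \<omega>) \<omega>"
  by (simp add: position_def arrival_def lessThan_Suc_atMost)

lemma position_eq:
  assumes "t < arrival W (Suc n) \<omega>" "\<And>k. k < n \<Longrightarrow> arrival W (Suc k) \<omega> \<le> t"
  shows "position Y W t \<omega> = Y n \<omega>"
proof -
  have "(LEAST n. t < arrival W (Suc n) \<omega>) = n"
    using assms by (intro Least_equality) (auto simp: not_less[symmetric])
  then show ?thesis by (simp add: position_arrival)
qed

text \<open>Holds on every path. If no arrival lies beyond \<open>t\<close>, then none lies beyond
  any later time, so \<open>LEAST\<close> is applied to the same predicate; its unspecified value,
  and with it the position, stays constant.\<close>

lemma position_right_cont: "\<exists>\<epsilon>>0. \<forall>s\<in>{t..<t + \<epsilon>}. position Y W s \<omega> = position Y W t \<omega>"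
proof (cases "\<exists>n. t < arrival W (Suc n) \<omega>")
  case True
  define n where "n = (LEAST n. t < arrival W (Suc n) \<omega>)"
  have n: "t < arrival W (Suc n) \<omega>" unfolding n_def using True by (rule LeastI_ex)
  have le: "arrival W (Suc k) \<omega> \<le> t" if "k < n" for k
    using not_less_Least[of k "\<lambda>n. t < arrival W (Suc n) \<omega>"] that by (simp add: n_def not_less)
  have "position Y W s \<omega> = Y n \<omega>" if "t \<le> s" "s < arrival W (Suc n) \<omega>" for s
    using le that by (intro position_eq) (auto intro: order_trans)
  with n show ?thesis by (intro exI[of _ "arrival W (Suc n) \<omega> - t"]) auto
next
  case False
  have "(\<lambda>n. s < arrival W (Suc n) \<omega>) = (\<lambda>n. t < arrival W (Suc n) \<omega>)" if "t \<le> s" for s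
  proof (rule ext)
    fix n
    have "arrival W (Suc n) \<omega> \<le> t" using False by (simp add: not_less)
    with that show "s < arrival W (Suc n) \<omega> \<longleftrightarrow> t < arrival W (Suc n) \<omega>" by linarith
  qed
  then have "position Y W s \<omega> = position Y W t \<omega>" if "t \<le> s" for s
    unfolding position_arrival using that by metis
  then show ?thesis by (intro exI[of _ 1] conjI ballI zero_less_one) (meson atLeastLessThan_iff)
qed

lemma measurable_position_pair:
  assumes [measurable]: "\<And>n. Y n \<in> M \<rightarrow>\<^sub>M count_space V" "\<And>n. W n \<in> borel_measurable M"
  shows "(\<lambda>(t, \<omega>). position Y W t \<omega>) \<in> borel \<Otimes>\<^sub>M M \<rightarrow>\<^sub>M count_space V"
proof -
  have "(\<lambda>p. Y (LEAST n. fst p < (\<Sum>k\<le>n. W k (snd p))) (snd p)) \<in> borel \<Otimes>\<^sub>M M \<rightarrow>\<^sub>M count_space V"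
    by (rule measurable_compose_countable[where f = "\<lambda>n p. Y n (snd p)"]) measurable
  then show ?thesis by (simp add: position_def[abs_def] split_beta')
qed

lemma measurable_position:
  assumes "\<And>n. Y n \<in> M \<rightarrow>\<^sub>M count_space V" "\<And>n. W n \<in> borel_measurable M"
  shows "position Y W t \<in> M \<rightarrow>\<^sub>M count_space V"
  using measurable_compose[OF measurable_Pair[OF measurable_const measurable_ident]
      measurable_position_pair[OF assms], of t] by simp

lemma (in prob_space) AE_of_prob_0:
  assumes "prob {\<omega> \<in> space M. \<not> Q \<omega>} = 0" "{\<omega> \<in> space M. \<not> Q \<omega>} \<in> sets M"
  shows "AE \<omega> in M. Q \<omega>"
  using AE_iff_measurable[OF assms(2) refl] assms(1) by (simp add: emeasure_eq_measure)

locale walker = prob_space M + pair_graph G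
  for M :: "'a measure" and G :: "'v pair_pre_digraph" +
  fixes Y :: "nat \<Rightarrow> 'a \<Rightarrow> 'v" and W :: "nat \<Rightarrow> 'a \<Rightarrow> real"
  assumes deg_pos: "\<And>v. v \<in> pverts G \<Longrightarrow> 0 < deg G v"
    and walker: "random_walker M G Y W"
begin

abbreviation "V \<equiv> pverts G"
abbreviation "X \<equiv> position Y W"
abbreviation "rate v \<equiv> real (deg G v)"
abbreviation "step_prob v u \<equiv> pmf (pmf_of_set (out_nbrs G v)) u"
abbreviation "hist n \<equiv> history M G Y W n"

lemma Y_meas: "Y n \<in> M \<rightarrow>\<^sub>M count_space V"
  and W_meas: "W n \<in> borel_measurable M"
  using walker by (simp_all add: random_walker_def)

lemma rate_pos: "v \<in> V \<Longrightarrow> 0 < rate v"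
  using deg_pos by simp

lemma sum_step_prob:
  assumes "v \<in> V"
  shows "(\<Sum>u\<in>V. step_prob v u) = 1"
  using row_sum_eq_deg[of v] deg_pos[OF assms]
  by (simp add: pmf_out_nbrs row_sum_def sum_divide_distrib[symmetric])

subsection \<open>Histories\<close>

lemma space_hist: "space (hist n) = space M"
  by (simp add: history_def)

lemma measurable_hist_map:
  assumes "\<And>k. k \<le> n \<Longrightarrow> Y k \<in> N \<rightarrow>\<^sub>M count_space V" "\<And>k. k < n \<Longrightarrow> W k \<in> borel_measurable N"
  shows "(\<lambda>\<omega>. (\<lambda>k\<in>{..n}. Y k \<omega>, \<lambda>k\<in>{..<n}. W k \<omega>)) \<in>
    N \<rightarrow>\<^sub>M (\<Pi>\<^sub>M k\<in>{..n}. count_space V) \<Otimes>\<^sub>M (\<Pi>\<^sub>M k\<in>{..<n}. borel)"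
  using assms by (intro measurable_Pair measurable_restrict) auto

lemma hist_map_space:
  "(\<lambda>\<omega>. (\<lambda>k\<in>{..n}. Y k \<omega>, \<lambda>k\<in>{..<n}. W k \<omega>)) \<in>
    space M \<rightarrow> space ((\<Pi>\<^sub>M k\<in>{..n}. count_space V) \<Otimes>\<^sub>M (\<Pi>\<^sub>M k\<in>{..<n}. borel))"
  by (rule measurable_space[OF measurable_hist_map, THEN funcsetI]) (rule Y_meas W_meas | assumption)+

text \<open>The history is the smallest sigma-algebra making the listed variables measurable. With
  \<open>N = M\<close> this shows that its sets are events, with the next history for
  \<open>N\<close> that histories increase.\<close>

lemma hist_subset:
  assumes "space N = space M"
    and "\<And>k. k \<le> n \<Longrightarrow> Y k \<in> N \<rightarrow>\<^sub>M count_space V" "\<And>k. k < n \<Longrightarrow> W k \<in> borel_measurable N"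
  shows "sets (hist n) \<subseteq> sets N"
  unfolding history_def sets_vimage_algebra2[OF hist_map_space]
  using measurable_sets[OF measurable_hist_map[OF assms(2,3)]] unfolding assms(1) by blast

lemma Y_hist:
  assumes "k \<le> n"
  shows "Y k \<in> hist n \<rightarrow>\<^sub>M count_space V"
proof -
  have "(\<lambda>\<omega>. fst (\<lambda>k\<in>{..n}. Y k \<omega>, \<lambda>k\<in>{..<n}. W k \<omega>) k) \<in> hist n \<rightarrow>\<^sub>M count_space V"
    unfolding history_def
    by (rule measurable_compose[OF measurable_vimage_algebra1[OF hist_map_space]],
        rule measurable_compose[OF measurable_fst], rule measurable_component_singleton) (use assms in simp)
  then show ?thesis using assms by simp
qed

lemma W_hist:
  assumes "k < n"
  shows "W k \<in> borel_measurable (hist n)"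
proof -
  have "(\<lambda>\<omega>. snd (\<lambda>k\<in>{..n}. Y k \<omega>, \<lambda>k\<in>{..<n}. W k \<omega>) k) \<in> borel_measurable (hist n)"
    unfolding history_def
    by (rule measurable_compose[OF measurable_vimage_algebra1[OF hist_map_space]],
        rule measurable_compose[OF measurable_snd], rule measurable_component_singleton) (use assms in simp)
  then show ?thesis using assms by simp
qed

lemma hist_events: "H \<in> sets (hist n) \<Longrightarrow> H \<in> sets M"
  using hist_subset[of M n] Y_meas W_meas by blast

lemma hist_Suc: "H \<in> sets (hist n) \<Longrightarrow> H \<in> sets (hist (Suc n))"
  using hist_subset[of "hist (Suc n)" n] Y_hist[of _ "Suc n"] W_hist[of _ "Suc n"] space_hist by force

lemma arrival_hist: "k \<le> n \<Longrightarrow> arrival W k \<in> borel_measurable (hist n)"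
  unfolding arrival_def[abs_def] by (intro borel_measurable_sum W_hist) auto

lemma arrival_meas: "arrival W k \<in> borel_measurable M"
  unfolding arrival_def[abs_def] by (intro borel_measurable_sum W_meas)

lemma arrival_le_hist: "k \<le> n \<Longrightarrow> {\<omega> \<in> space M. arrival W k \<omega> \<le> t} \<in> sets (hist n)"
  using borel_measurable_le[OF arrival_hist[of k n] borel_measurable_const[of t]]
  by (simp add: space_hist)

lemma arrival_gt_hist: "k \<le> n \<Longrightarrow> {\<omega> \<in> space M. t < arrival W k \<omega>} \<in> sets (hist n)"
  using borel_measurable_less[OF borel_measurable_const[of t] arrival_hist[of k n]]
  by (simp add: space_hist)

lemma Y_eq_hist:
  assumes "k \<le> n"
  shows "{\<omega> \<in> space M. Y k \<omega> = v} \<in> sets (hist n)"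
proof -
  have "{\<omega> \<in> space M. Y k \<omega> = v} = Y k -` ({v} \<inter> V) \<inter> space (hist n)"
    using measurable_space[OF Y_meas[of k]] by (auto simp: space_hist)
  then show ?thesis using measurable_sets[OF Y_hist[OF assms], of "{v} \<inter> V"] by simp
qed

lemma Y_eq_event: "{\<omega> \<in> space M. Y k \<omega> = v} \<in> sets M"
  by (rule hist_events[OF Y_eq_hist[OF order_refl]])

lemma step_law:
  assumes "H \<in> sets (hist n)" "v \<in> V" "B \<in> sets borel" "u \<in> V"
  shows "\<P>(\<omega> in M. \<omega> \<in> H \<and> Y n \<omega> = v \<and> W n \<omega> \<in> B \<and> Y (Suc n) \<omega> = u) =
    \<P>(\<omega> in M. \<omega> \<in> H \<and> Y n \<omega> = v)
      * measure (density lborel (exponential_density (rate v))) B * step_prob v u"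
  using walker assms by (simp add: random_walker_def)

text \<open>Sums out the next vertex, whose step probabilities add up to 1.\<close>

lemma waiting_law:
  assumes H: "H \<in> sets (hist n)" and v: "v \<in> V" and B: "B \<in> sets borel"
  shows "\<P>(\<omega> in M. \<omega> \<in> H \<and> Y n \<omega> = v \<and> W n \<omega> \<in> B) =
    \<P>(\<omega> in M. \<omega> \<in> H \<and> Y n \<omega> = v) * measure (density lborel (exponential_density (rate v))) B"
proof -
  let ?E = "{\<omega> \<in> space M. \<omega> \<in> H \<and> Y n \<omega> = v \<and> W n \<omega> \<in> B}"
  have "?E = (H \<inter> {\<omega> \<in> space M. Y n \<omega> = v}) \<inter> (W n -` B \<inter> space M)" by auto
  then have "?E \<in> sets M"
    using hist_events[OF H] Y_eq_event measurable_sets[OF W_meas B] by (simp only: sets.Int)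
  then have "prob ?E = (\<Sum>u\<in>V. \<P>(\<omega> in M. \<omega> \<in> ?E \<and> Y (Suc n) \<omega> = u))"
    by (rule prob_sum_values[OF pair_finite_verts Y_meas])
  also have "\<dots> = (\<Sum>u\<in>V. \<P>(\<omega> in M. \<omega> \<in> H \<and> Y n \<omega> = v)
      * measure (density lborel (exponential_density (rate v))) B * step_prob v u)"
  proof (intro sum.cong refl)
    fix u assume u: "u \<in> V"
    have "{\<omega> \<in> space M. \<omega> \<in> ?E \<and> Y (Suc n) \<omega> = u} =
        {\<omega> \<in> space M. \<omega> \<in> H \<and> Y n \<omega> = v \<and> W n \<omega> \<in> B \<and> Y (Suc n) \<omega> = u}" by blast
    then show "\<P>(\<omega> in M. \<omega> \<in> ?E \<and> Y (Suc n) \<omega> = u) = \<P>(\<omega> in M. \<omega> \<in> H \<and> Y n \<omega> = v)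
        * measure (density lborel (exponential_density (rate v))) B * step_prob v u"
      using step_law[OF H v B u] by (simp only:)
  qed
  also have "\<dots> = \<P>(\<omega> in M. \<omega> \<in> H \<and> Y n \<omega> = v) * measure (density lborel (exponential_density (rate v))) B"
    by (simp only: sum_distrib_left[symmetric] sum_step_prob[OF v] mult_1_right)
  finally show ?thesis .
qed

subsection \<open>Absence of explosions\<close>

text \<open>The total of the rates and not their maximum: only a common upper bound is used, and a
  sum is defined without asking for a nonempty \<open>V\<close>.\<close>

definition max_rate :: real where
  "max_rate = (\<Sum>v\<in>V. rate v)"

lemma rate_le: "v \<in> V \<Longrightarrow> rate v \<le> max_rate"
  unfolding max_rate_def by (rule member_le_sum) (auto simp: pair_finite_verts)

text \<open>Whatever the current vertex, its rate is at most \<open>max_rate\<close>, so the bound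
  is uniform over the past. It serves with \<open>a\<close> = 0 for positive waits, \<open>a\<close>
  = 1 against explosions and \<open>a\<close> = \<open>h\<close> for a second jump.\<close>

lemma waiting_le:
  assumes H: "H \<in> sets (hist n)" and "0 \<le> a"
  shows "\<P>(\<omega> in M. \<omega> \<in> H \<and> W n \<omega> \<le> a) \<le> (1 - exp (- max_rate * a)) * prob H"
proof -
  let ?E = "{\<omega> \<in> space M. \<omega> \<in> H \<and> W n \<omega> \<le> a}"
  have "?E = H \<inter> (W n -` {..a} \<inter> space M)" by auto
  then have "?E \<in> sets M"
    using hist_events[OF H] measurable_sets[OF W_meas, of "{..a}"] by (simp only: sets.Int) simp
  then have "prob ?E = (\<Sum>v\<in>V. \<P>(\<omega> in M. \<omega> \<in> ?E \<and> Y n \<omega> = v))"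
    by (rule prob_sum_values[OF pair_finite_verts Y_meas])
  also have "\<dots> \<le> (\<Sum>v\<in>V. (1 - exp (- max_rate * a)) * \<P>(\<omega> in M. \<omega> \<in> H \<and> Y n \<omega> = v))"
  proof (intro sum_mono)
    fix v assume v: "v \<in> V"
    have "{\<omega> \<in> space M. \<omega> \<in> ?E \<and> Y n \<omega> = v} = {\<omega> \<in> space M. \<omega> \<in> H \<and> Y n \<omega> = v \<and> W n \<omega> \<in> {..a}}"
      by auto
    then have "\<P>(\<omega> in M. \<omega> \<in> ?E \<and> Y n \<omega> = v) = \<P>(\<omega> in M. \<omega> \<in> H \<and> Y n \<omega> = v) *
        measure (density lborel (exponential_density (rate v))) {..a}"
      using waiting_law[OF H v, of "{..a}"] by simp
    also have "\<dots> = \<P>(\<omega> in M. \<omega> \<in> H \<and> Y n \<omega> = v) * (1 - exp (- rate v * a))"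
      by (simp only: measure_exponential_le[OF rate_pos[OF v] \<open>0 \<le> a\<close>])
    also have "\<dots> \<le> \<P>(\<omega> in M. \<omega> \<in> H \<and> Y n \<omega> = v) * (1 - exp (- max_rate * a))"
      using rate_le[OF v] \<open>0 \<le> a\<close> by (intro mult_left_mono) (auto intro: mult_right_mono)
    finally show "\<P>(\<omega> in M. \<omega> \<in> ?E \<and> Y n \<omega> = v) \<le>
        (1 - exp (- max_rate * a)) * \<P>(\<omega> in M. \<omega> \<in> H \<and> Y n \<omega> = v)"
      by (simp only: mult.commute)
  qed
  also have "\<dots> = (1 - exp (- max_rate * a)) * prob H"
    by (simp only: sum_distrib_left[symmetric]
        prob_sum_values[OF pair_finite_verts Y_meas hist_events[OF H], of n])
  finally show ?thesis .
qed

lemma AE_waiting_pos: "AE \<omega> in M. \<forall>n. 0 < W n \<omega>"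
proof (subst AE_all_countable, intro allI)
  fix n
  have "space M \<in> sets (hist n)" using sets.top[of "hist n"] by (simp only: space_hist)
  then have "\<P>(\<omega> in M. \<omega> \<in> space M \<and> W n \<omega> \<le> 0) \<le> 0"
    using waiting_le[of "space M" n 0] by simp
  moreover have "{\<omega> \<in> space M. \<omega> \<in> space M \<and> W n \<omega> \<le> 0} = {\<omega> \<in> space M. \<not> 0 < W n \<omega>}" by auto
  ultimately have "prob {\<omega> \<in> space M. \<not> 0 < W n \<omega>} = 0"
    by (simp only: measure_le_0_iff)
  moreover have "{\<omega> \<in> space M. \<not> 0 < W n \<omega>} \<in> sets M"
    using borel_measurable_le[OF W_meas[of n] borel_measurable_const[of 0]] by (simp only: not_less)
  ultimately show "AE \<omega> in M. 0 < W n \<omega>"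
    by (rule AE_of_prob_0)
qed

text \<open>Given any past, the next wait is at most 1 with probability at most \<open>q\<close> <
  1, so \<open>l\<close> short waits in a row have probability at most \<open>q ^ l\<close>. The
  waits need not be independent, as their rates depend on the path; the bound is iterated along the
  histories instead.\<close>

lemma AE_long_waiting: "AE \<omega> in M. \<forall>a. \<exists>k\<ge>a. 1 < W k \<omega>"
proof (subst AE_all_countable, intro allI)
  fix a
  define q where "q = 1 - exp (- max_rate * 1)"
  have "0 \<le> max_rate" by (simp add: max_rate_def sum_nonneg)
  then have q: "0 \<le> q" "q < 1" by (simp_all add: q_def)
  define H where "H l = {\<omega> \<in> space M. \<forall>k\<in>{a..<a + l}. W k \<omega> \<le> 1}" for l
  have H_hist: "H l \<in> sets (hist (a + l))" for l
  proof -
    have "{\<omega> \<in> space (hist (a + l)). \<forall>k\<in>{a..<a + l}. W k \<omega> \<le> 1} \<in> sets (hist (a + l))"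
      by (intro sets.sets_Collect_finite_All borel_measurable_le W_hist borel_measurable_const) auto
    then show ?thesis by (simp only: H_def space_hist)
  qed
  have H_le: "prob (H l) \<le> q ^ l" for l
  proof (induction l)
    case (Suc l)
    have "H (Suc l) = {\<omega> \<in> space M. \<omega> \<in> H l \<and> W (a + l) \<omega> \<le> 1}"
      unfolding H_def by (auto simp: less_Suc_eq)
    then have "prob (H (Suc l)) \<le> q * prob (H l)"
      using waiting_le[OF H_hist[of l] zero_le_one] by (simp only: q_def)
    also have "\<dots> \<le> q * q ^ l" by (rule mult_left_mono[OF Suc q(1)])
    finally show ?case by simp
  qed (simp add: H_def)
  let ?N = "{\<omega> \<in> space M. \<not> (\<exists>k\<ge>a. 1 < W k \<omega>)}"
  have "prob ?N \<le> q ^ l" for l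
  proof -
    have "prob ?N \<le> prob (H l)"
      by (rule finite_measure_mono[OF _ hist_events[OF H_hist]]) (auto simp: H_def not_less)
    with H_le[of l] show ?thesis by linarith
  qed
  then have "prob ?N \<le> 0"
    using q LIMSEQ_realpow_zero[of q] by (intro LIMSEQ_le_const[of _ 0]) auto
  then have "prob ?N = 0" by (simp only: measure_le_0_iff)
  moreover have "?N = (\<Inter>l. H l)"
  proof (intro set_eqI iffI)
    fix \<omega> assume "\<omega> \<in> (\<Inter>l. H l)"
    then have *: "\<omega> \<in> H l" for l by blast
    have "W k \<omega> \<le> 1" if "a \<le> k" for k using *[of "Suc (k - a)"] that by (auto simp: H_def)
    then show "\<omega> \<in> ?N" using *[of 0] by (auto simp: H_def not_less)
  qed (auto simp: H_def not_less)
  then have "?N \<in> sets M" using hist_events[OF H_hist] by (simp only:) (rule sets.countable_INT, blast, simp)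
  ultimately show "AE \<omega> in M. \<exists>k\<ge>a. 1 < W k \<omega>"
    by (rule AE_of_prob_0)
qed

text \<open>Positive waits of which infinitely many exceed 1 have unbounded partial sums.\<close>

lemma AE_no_explosion: "AE \<omega> in M. \<forall>s. \<exists>n. s < arrival W (Suc n) \<omega>"
  using AE_waiting_pos AE_long_waiting
proof eventually_elim
  case (elim \<omega>)
  have mono: "arrival W n \<omega> \<le> arrival W n' \<omega>" if "n \<le> n'" for n n'
    unfolding arrival_def using elim(1) that by (intro sum_mono2) (auto intro: less_imp_le)
  have "\<exists>n. real N \<le> arrival W n \<omega>" for N
  proof (induction N)
    case 0
    show ?case by (rule exI[of _ 0]) (simp add: arrival_def)
  next
    case (Suc N)
    then obtain n where n: "real N \<le> arrival W n \<omega>" by blast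
    obtain k where k: "n \<le> k" "1 < W k \<omega>" using elim(2) by blast
    have "arrival W (Suc k) \<omega> = arrival W k \<omega> + W k \<omega>" by (simp add: arrival_def)
    then have "real (Suc N) \<le> arrival W (Suc k) \<omega>" using n k mono[OF k(1)] by simp
    then show ?case by blast
  qed
  then have ex: "\<exists>n. real N \<le> arrival W n \<omega>" for N .
  show "\<forall>s. \<exists>n. s < arrival W (Suc n) \<omega>"
  proof
    fix s :: real
    obtain N where "s < real N" using reals_Archimedean2 by blast
    moreover obtain n where "real N \<le> arrival W n \<omega>" using ex by blast
    ultimately have "s < arrival W (Suc n) \<omega>" using mono[of n "Suc n"] by simp
    then show "\<exists>n. s < arrival W (Suc n) \<omega>" by blast
  qed
qed

subsection \<open>The Markov property\<close>

definition before :: "real \<Rightarrow> nat \<Rightarrow> 'a set" where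
  "before s n = {\<omega> \<in> space M. \<forall>k<n. arrival W (Suc k) \<omega> \<le> s}"

text \<open>With positive waits, the event of exactly \<open>n\<close> jumps by time
  \<open>s\<close>. It splits into \<open>before s n\<close>, an event of the history at step
  \<open>n\<close>, and a condition on \<open>W n\<close>, to which the exponential law applies.
  Listing all earlier arrivals matches \<open>LEAST\<close> in \<open>position\<close> on every
  path.\<close>

definition during :: "real \<Rightarrow> nat \<Rightarrow> 'a set" where
  "during s n = {\<omega> \<in> space M. (\<forall>k<n. arrival W (Suc k) \<omega> \<le> s) \<and> s < arrival W (Suc n) \<omega>}"

lemma before_hist: "before s n \<in> sets (hist n)"
proof -
  have "{\<omega> \<in> space (hist n). \<forall>k\<in>{..<n}. arrival W (Suc k) \<omega> \<le> s} \<in> sets (hist n)"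
    unfolding space_hist[symmetric]
    by (intro sets.sets_Collect_finite_All) (use arrival_le_hist[of "Suc _" n s] in \<open>auto simp: space_hist\<close>)
  then show ?thesis by (simp only: before_def space_hist Ball_def lessThan_iff)
qed

lemma arrival_Suc: "arrival W (Suc n) \<omega> = arrival W n \<omega> + W n \<omega>"
  by (simp add: arrival_def)

lemma before_arrival: "\<omega> \<in> before s n \<Longrightarrow> 0 \<le> s \<Longrightarrow> arrival W n \<omega> \<le> s"
  by (cases n) (auto simp: before_def arrival_def[of W 0])

lemma during_event: "during s n \<in> sets M"
proof -
  have "during s n = before s n \<inter> {\<omega> \<in> space M. s < arrival W (Suc n) \<omega>}"
    by (auto simp: during_def before_def)
  then show ?thesis
    using hist_events[OF before_hist] hist_events[OF arrival_gt_hist[OF order_refl]]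
    by (simp only: sets.Int)
qed

lemma position_during: "\<omega> \<in> during s n \<Longrightarrow> X s \<omega> = Y n \<omega>"
  by (rule position_eq) (auto simp: during_def)

text \<open>Memorylessness of the wait in progress: its age \<open>R\<close> at time
  \<open>s\<close> is known from the history and nonnegative, so \<open>exponential_residual\<close>
  applies. It is used once with the next vertex prescribed and once without it at \<open>c\<close> =
  0; both results contain the same integral \<open>J\<close> over the ages, which is thereby
  eliminated.\<close>

lemma residual_law:
  assumes H: "H \<in> sets (hist n)" "H \<subseteq> before s n" and s: "0 \<le> s"
    and x: "x \<in> V" and u: "u \<in> V" and c: "0 \<le> c"
  shows "\<P>(\<omega> in M. \<omega> \<in> H \<and> Y n \<omega> = x \<and> s - arrival W n \<omega> + c < W n \<omega> \<and> Y (Suc n) \<omega> = u) =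
    step_prob x u * exp (- rate x * c) *
      \<P>(\<omega> in M. \<omega> \<in> H \<and> Y n \<omega> = x \<and> s - arrival W n \<omega> < W n \<omega>)"
proof -
  define R where "R \<omega> = s - arrival W n \<omega>" for \<omega>
  define F\<^sub>0 where "F\<^sub>0 = {\<omega> \<in> space M. \<omega> \<in> H \<and> Y n \<omega> = x}"
  define F where "F = {\<omega> \<in> space M. \<omega> \<in> H \<and> Y n \<omega> = x \<and> Y (Suc n) \<omega> = u}"
  let ?E = "density lborel (exponential_density (rate x))"
  have R_hist: "R \<in> borel_measurable (hist n)"
    unfolding R_def[abs_def] by (intro borel_measurable_diff borel_measurable_const arrival_hist order_refl)
  have R_meas: "R \<in> borel_measurable M"
    unfolding R_def[abs_def] by (intro borel_measurable_diff borel_measurable_const arrival_meas)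
  have HR: "H \<inter> (R -` A \<inter> space M) \<in> sets (hist n)" if "A \<in> sets borel" for A
    using measurable_sets[OF R_hist that] H(1) by (simp only: space_hist sets.Int)
  have F0_eq: "F\<^sub>0 = H \<inter> {\<omega> \<in> space M. Y n \<omega> = x}" by (auto simp: F\<^sub>0_def)
  have F0_sets: "F\<^sub>0 \<in> sets M"
    unfolding F0_eq by (intro sets.Int hist_events[OF H(1)] Y_eq_event)
  have F_eq: "F = F\<^sub>0 \<inter> {\<omega> \<in> space M. Y (Suc n) \<omega> = u}" by (auto simp: F_def F\<^sub>0_def)
  have F_sets: "F \<in> sets M" unfolding F_eq by (intro sets.Int F0_sets Y_eq_event)
  have R0: "0 \<le> R \<omega>" if "\<omega> \<in> F\<^sub>0" for \<omega>
    using that H(2) before_arrival[OF _ s, of \<omega> n] by (auto simp: F\<^sub>0_def R_def)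
  have law0: "\<P>(\<omega> in M. \<omega> \<in> F\<^sub>0 \<and> R \<omega> \<in> A \<and> W n \<omega> \<in> B) =
      1 * \<P>(\<omega> in M. \<omega> \<in> F\<^sub>0 \<and> R \<omega> \<in> A) * measure ?E B"
    if A: "A \<in> sets borel" and B: "B \<in> sets borel" for A B
  proof -
    have 1: "{\<omega> \<in> space M. \<omega> \<in> F\<^sub>0 \<and> R \<omega> \<in> A \<and> W n \<omega> \<in> B} =
        {\<omega> \<in> space M. \<omega> \<in> H \<inter> (R -` A \<inter> space M) \<and> Y n \<omega> = x \<and> W n \<omega> \<in> B}"
      unfolding F\<^sub>0_def by blast
    have 2: "{\<omega> \<in> space M. \<omega> \<in> F\<^sub>0 \<and> R \<omega> \<in> A} =
        {\<omega> \<in> space M. \<omega> \<in> H \<inter> (R -` A \<inter> space M) \<and> Y n \<omega> = x}"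
      unfolding F\<^sub>0_def by blast
    show ?thesis unfolding 1 2 by (simp only: waiting_law[OF HR[OF A] x B] mult_1)
  qed
  have law: "\<P>(\<omega> in M. \<omega> \<in> F \<and> R \<omega> \<in> A \<and> W n \<omega> \<in> B) =
      step_prob x u * \<P>(\<omega> in M. \<omega> \<in> F\<^sub>0 \<and> R \<omega> \<in> A) * measure ?E B"
    if A: "A \<in> sets borel" and B: "B \<in> sets borel" for A B
  proof -
    have 1: "{\<omega> \<in> space M. \<omega> \<in> F \<and> R \<omega> \<in> A \<and> W n \<omega> \<in> B} =
        {\<omega> \<in> space M. \<omega> \<in> H \<inter> (R -` A \<inter> space M) \<and> Y n \<omega> = x \<and> W n \<omega> \<in> B \<and> Y (Suc n) \<omega> = u}"
      unfolding F_def by blast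
    have 2: "{\<omega> \<in> space M. \<omega> \<in> F\<^sub>0 \<and> R \<omega> \<in> A} =
        {\<omega> \<in> space M. \<omega> \<in> H \<inter> (R -` A \<inter> space M) \<and> Y n \<omega> = x}"
      unfolding F\<^sub>0_def by blast
    show ?thesis unfolding 1 2 by (simp only: step_law[OF HR[OF A] x B u] mult.commute mult.left_commute)
  qed
  define J where "J = (\<integral>\<^sup>+\<omega>. ennreal (exp (- rate x * R \<omega>)) * indicator F\<^sub>0 \<omega> \<partial>M)"
  have J: "emeasure M {\<omega> \<in> space M. \<omega> \<in> F\<^sub>0 \<and> R \<omega> + 0 < W n \<omega>} = ennreal (1 * exp (- rate x * 0)) * J"
    unfolding J_def
    by (rule exponential_residual[OF rate_pos[OF x] zero_le_one order_refl F0_sets F0_sets R_meas W_meas])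
       (fact R0 law0)+
  have "emeasure M {\<omega> \<in> space M. \<omega> \<in> F \<and> R \<omega> + c < W n \<omega>} =
      ennreal (step_prob x u * exp (- rate x * c)) * J"
    unfolding J_def
    by (rule exponential_residual[OF rate_pos[OF x] pmf_nonneg c F_sets F0_sets R_meas W_meas])
       (fact R0 law)+
  moreover have "J = emeasure M {\<omega> \<in> space M. \<omega> \<in> F\<^sub>0 \<and> R \<omega> + 0 < W n \<omega>}"
    unfolding J by simp
  ultimately have "ennreal (prob {\<omega> \<in> space M. \<omega> \<in> F \<and> R \<omega> + c < W n \<omega>}) =
      ennreal (step_prob x u * exp (- rate x * c)) *
        ennreal (prob {\<omega> \<in> space M. \<omega> \<in> F\<^sub>0 \<and> R \<omega> + 0 < W n \<omega>})"
    by (simp only: emeasure_eq_measure)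
  also have "\<dots> = ennreal (step_prob x u * exp (- rate x * c) *
      prob {\<omega> \<in> space M. \<omega> \<in> F\<^sub>0 \<and> R \<omega> + 0 < W n \<omega>})"
    by (rule ennreal_mult[symmetric]) (simp_all add: measure_nonneg)
  finally have "prob {\<omega> \<in> space M. \<omega> \<in> F \<and> R \<omega> + c < W n \<omega>} = step_prob x u * exp (- rate x * c) *
      prob {\<omega> \<in> space M. \<omega> \<in> F\<^sub>0 \<and> R \<omega> + 0 < W n \<omega>}"
    by (subst (asm) ennreal_inj) (auto intro!: mult_nonneg_nonneg)
  moreover have "{\<omega> \<in> space M. \<omega> \<in> F \<and> R \<omega> + c < W n \<omega>} =
      {\<omega> \<in> space M. \<omega> \<in> H \<and> Y n \<omega> = x \<and> s - arrival W n \<omega> + c < W n \<omega> \<and> Y (Suc n) \<omega> = u}"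
    unfolding F_def R_def by blast
  moreover have "{\<omega> \<in> space M. \<omega> \<in> F\<^sub>0 \<and> R \<omega> + 0 < W n \<omega>} =
      {\<omega> \<in> space M. \<omega> \<in> H \<and> Y n \<omega> = x \<and> s - arrival W n \<omega> < W n \<omega>}"
    unfolding F\<^sub>0_def R_def by auto
  ultimately show ?thesis by (simp only:)
qed

text \<open>The transition probabilities over a short time \<open>h\<close>, ignoring second jumps.\<close>

definition one_jump :: "real \<Rightarrow> 'v \<Rightarrow> 'v \<Rightarrow> real" where
  "one_jump h x y = exp (- rate x * h) * of_bool (x = y) + (1 - exp (- rate x * h)) * step_prob x y"

text \<open>If at most one jump falls between \<open>s\<close> and \<open>s + h\<close>, the final
  position is \<open>Y n\<close> or \<open>Y (Suc n)\<close>, with probabilities known from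
  \<open>residual_law\<close>. Second jumps make the error, which is stated relative to the
  probability of the conditioning event so that it can be summed over \<open>n\<close>.\<close>

lemma local_estimate:
  assumes H: "H \<in> sets (hist n)" and s: "0 \<le> s" and h: "0 \<le> h" and x: "x \<in> V" and y: "y \<in> V"
  shows "\<bar>\<P>(\<omega> in M. \<omega> \<in> H \<and> \<omega> \<in> during s n \<and> Y n \<omega> = x \<and> X (s + h) \<omega> = y) -
      \<P>(\<omega> in M. \<omega> \<in> H \<and> \<omega> \<in> during s n \<and> Y n \<omega> = x) * one_jump h x y\<bar> \<le>
    (max_rate * h)\<^sup>2 * \<P>(\<omega> in M. \<omega> \<in> H \<and> \<omega> \<in> during s n \<and> Y n \<omega> = x)"
proof -
  define H' where "H' = H \<inter> before s n"
  have H': "H' \<in> sets (hist n)" "H' \<subseteq> before s n"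
    unfolding H'_def by (intro sets.Int H before_hist) blast
  define R where "R \<omega> = s - arrival W n \<omega>" for \<omega>
  define A\<^sub>0 where "A\<^sub>0 = {\<omega> \<in> space M. \<omega> \<in> H \<and> \<omega> \<in> during s n \<and> Y n \<omega> = x}"
  define Bev where "Bev = {\<omega> \<in> space M. \<omega> \<in> H \<and> \<omega> \<in> during s n \<and> Y n \<omega> = x \<and> X (s + h) \<omega> = y}"
  define a where "a = prob A\<^sub>0"
  have a0: "0 \<le> a" by (simp add: a_def)
  have A0_eq: "A\<^sub>0 = {\<omega> \<in> space M. \<omega> \<in> H' \<and> Y n \<omega> = x \<and> s - arrival W n \<omega> < W n \<omega>}"
    unfolding A\<^sub>0_def H'_def during_def before_def arrival_Suc[of n] by auto
  \<comment> \<open>On \<open>T c\<close> the wait at \<open>Y n\<close> is still going on at time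
    \<open>s + c\<close>; \<open>T 0\<close> is the conditioning event.\<close>
  define T where "T c = {\<omega> \<in> space M. \<omega> \<in> H' \<and> Y n \<omega> = x \<and> R \<omega> + c < W n \<omega>}" for c
  have T_hist: "T c \<in> sets (hist (Suc n))" for c
  proof -
    have "T c = H' \<inter> {\<omega> \<in> space M. Y n \<omega> = x} \<inter> {\<omega> \<in> space M. s + c < arrival W (Suc n) \<omega>}"
      unfolding T_def R_def arrival_Suc by auto
    then show ?thesis
      using hist_Suc[OF H'(1)] Y_eq_hist[of n "Suc n" x] arrival_gt_hist[of "Suc n" "Suc n" "s + c"]
      by (simp only: sets.Int le_Suc_eq order_refl simp_thms)
  qed
  have T_sets: "T c \<in> sets M" for c by (rule hist_events[OF T_hist])
  have Tu: "\<P>(\<omega> in M. \<omega> \<in> T c \<and> Y (Suc n) \<omega> = u) = step_prob x u * exp (- rate x * c) * a"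
    if "u \<in> V" "0 \<le> c" for u c
  proof -
    have "{\<omega> \<in> space M. \<omega> \<in> T c \<and> Y (Suc n) \<omega> = u} =
        {\<omega> \<in> space M. \<omega> \<in> H' \<and> Y n \<omega> = x \<and> s - arrival W n \<omega> + c < W n \<omega> \<and> Y (Suc n) \<omega> = u}"
      unfolding T_def R_def by blast
    then show ?thesis using residual_law[OF H' s x that] unfolding a_def A0_eq by (simp only:)
  qed
  have T_prob: "prob (T c) = exp (- rate x * c) * a" if "0 \<le> c" for c
  proof -
    have "prob (T c) = (\<Sum>u\<in>V. \<P>(\<omega> in M. \<omega> \<in> T c \<and> Y (Suc n) \<omega> = u))"
      by (rule prob_sum_values[OF pair_finite_verts Y_meas T_sets])
    also have "\<dots> = (\<Sum>u\<in>V. step_prob x u * (exp (- rate x * c) * a))"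
      by (intro sum.cong refl) (simp only: Tu that mult.assoc)
    also have "\<dots> = exp (- rate x * c) * a"
      by (simp only: sum_distrib_right[symmetric] sum_step_prob[OF x] mult_1)
    finally show ?thesis .
  qed
  have sub: "T h \<subseteq> T 0" using h unfolding T_def by auto
  \<comment> \<open>The wait at \<open>Y n\<close> ends after \<open>s\<close> and not after
    \<open>s + h\<close>. This belongs to the history at step \<open>Suc n\<close>, so it can be
    combined with a bound on the next wait.\<close>
  define E2 where "E2 = T 0 - T h"
  have E2_hist: "E2 \<in> sets (hist (Suc n))" unfolding E2_def by (intro sets.Diff T_hist)
  have E2_prob: "prob E2 = (1 - exp (- rate x * h)) * a"
    unfolding E2_def using finite_measure_Diff[OF T_sets T_sets sub] T_prob[OF h] T_prob[of 0]
    by (simp add: left_diff_distrib)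
  define E2y where "E2y = {\<omega> \<in> space M. \<omega> \<in> E2 \<and> Y (Suc n) \<omega> = y}"
  have TY_sets: "{\<omega> \<in> space M. \<omega> \<in> T c \<and> Y (Suc n) \<omega> = y} \<in> sets M" for c
  proof -
    have "{\<omega> \<in> space M. \<omega> \<in> T c \<and> Y (Suc n) \<omega> = y} = T c \<inter> {\<omega> \<in> space M. Y (Suc n) \<omega> = y}" by auto
    then show ?thesis using T_sets Y_eq_event by (simp only: sets.Int)
  qed
  have E2y_eq: "E2y = {\<omega> \<in> space M. \<omega> \<in> T 0 \<and> Y (Suc n) \<omega> = y} - {\<omega> \<in> space M. \<omega> \<in> T h \<and> Y (Suc n) \<omega> = y}"
    unfolding E2y_def E2_def by blast
  have E2y_sets: "E2y \<in> sets M" unfolding E2y_eq by (intro sets.Diff TY_sets)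
  have E2y_prob: "prob E2y = (1 - exp (- rate x * h)) * step_prob x y * a"
  proof -
    have "prob E2y = \<P>(\<omega> in M. \<omega> \<in> T 0 \<and> Y (Suc n) \<omega> = y) - \<P>(\<omega> in M. \<omega> \<in> T h \<and> Y (Suc n) \<omega> = y)"
      unfolding E2y_eq by (rule finite_measure_Diff[OF TY_sets TY_sets]) (use sub in blast)
    then show ?thesis by (simp add: Tu[OF y h] Tu[OF y order_refl] algebra_simps)
  qed
  \<comment> \<open>The outcome when second jumps are ignored: no jump and \<open>x = y\<close>, or
    a first jump to \<open>y\<close>. Its probability is exactly the one in
    \<open>one_jump\<close>.\<close>
  define C where "C = (if x = y then T h else {}) \<union> E2y"
  have C_sets: "C \<in> sets M" unfolding C_def by (intro sets.Un E2y_sets) (simp add: T_sets)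
  have C_prob: "prob C = a * one_jump h x y"
  proof -
    have "prob C = prob (if x = y then T h else {}) + prob E2y"
      unfolding C_def by (rule finite_measure_Union) (use T_sets E2y_sets in \<open>auto simp: E2y_def E2_def\<close>)
    then show ?thesis using T_prob[OF h] E2y_prob by (simp add: one_jump_def algebra_simps)
  qed
  \<comment> \<open>Contains every second jump by \<open>s + h\<close>: the wait at
    \<open>Y (Suc n)\<close> begins after \<open>s\<close>, so it must be at most \<open>h\<close>
    long to end in time.\<close>
  define E3 where "E3 = {\<omega> \<in> space M. \<omega> \<in> E2 \<and> W (Suc n) \<omega> \<le> h}"
  have E3_eq: "E3 = E2 \<inter> (W (Suc n) -` {..h} \<inter> space M)" unfolding E3_def by auto
  have E3_sets: "E3 \<in> sets M"
    unfolding E3_eq by (intro sets.Int hist_events[OF E2_hist] measurable_sets[OF W_meas]) simp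
  have "prob E3 \<le> (1 - exp (- max_rate * h)) * prob E2"
    unfolding E3_def by (rule waiting_le[OF E2_hist h])
  \<comment> \<open>One factor \<open>max_rate * h\<close> for each of the two jumps, from 1 -
    exp(-u) \<le> u.\<close>
  also have "\<dots> \<le> (max_rate * h) * (max_rate * h * a)"
  proof (intro mult_mono)
    show "1 - exp (- max_rate * h) \<le> max_rate * h" using exp_ge_add_one_self[of "- max_rate * h"] by linarith
    have "1 - exp (- rate x * h) \<le> rate x * h" using exp_ge_add_one_self[of "- rate x * h"] by linarith
    also have "\<dots> \<le> max_rate * h" using rate_le[OF x] h by (rule mult_right_mono)
    finally show "prob E2 \<le> max_rate * h * a" unfolding E2_prob using a0 by (rule mult_right_mono)
    show "0 \<le> max_rate * h" using h by (simp add: max_rate_def sum_nonneg)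
  qed (rule measure_nonneg)
  also have "\<dots> = (max_rate * h)\<^sup>2 * a" by (simp add: power2_eq_square)
  finally have E3_le: "prob E3 \<le> (max_rate * h)\<^sup>2 * a" .
  have pos1: "X (s + h) \<omega> = Y n \<omega>" if "\<omega> \<in> T h" for \<omega>
  proof (rule position_eq)
    show "s + h < arrival W (Suc n) \<omega>" using that unfolding T_def R_def arrival_Suc by auto
    fix k assume "k < n"
    then have "arrival W (Suc k) \<omega> \<le> s" using that by (auto simp: T_def H'_def before_def)
    then show "arrival W (Suc k) \<omega> \<le> s + h" using h by linarith
  qed
  have pos2: "X (s + h) \<omega> = Y (Suc n) \<omega>" if "\<omega> \<in> E2" "\<omega> \<notin> E3" for \<omega>
  proof (rule position_eq)
    have \<omega>: "\<omega> \<in> T 0" "\<omega> \<notin> T h" using that(1) by (auto simp: E2_def)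
    have "h < W (Suc n) \<omega>" using that \<omega>(1) by (auto simp: E3_def T_def)
    moreover have "s < arrival W (Suc n) \<omega>" using \<omega>(1) unfolding T_def R_def arrival_Suc by auto
    ultimately show "s + h < arrival W (Suc (Suc n)) \<omega>" unfolding arrival_Suc[of "Suc n"] by linarith
    fix k assume "k < Suc n"
    show "arrival W (Suc k) \<omega> \<le> s + h"
    proof (cases "k = n")
      case True
      then show ?thesis using \<omega> unfolding T_def R_def arrival_Suc by auto
    next
      case False
      then have "arrival W (Suc k) \<omega> \<le> s" using \<omega>(1) \<open>k < Suc n\<close> by (auto simp: T_def H'_def before_def)
      then show ?thesis using h by linarith
    qed
  qed
  have A0_T: "A\<^sub>0 = T 0" unfolding A0_eq T_def R_def by auto
  have X_sets: "{\<omega> \<in> space M. X (s + h) \<omega> = y} \<in> sets M"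
  proof -
    have "{\<omega> \<in> space M. X (s + h) \<omega> = y} = X (s + h) -` {y} \<inter> space M" by auto
    then show ?thesis using measurable_sets[OF measurable_position[where Y = Y, OF Y_meas W_meas], of "{y}"] y by simp
  qed
  have B_eq: "Bev = A\<^sub>0 \<inter> {\<omega> \<in> space M. X (s + h) \<omega> = y}" unfolding Bev_def A\<^sub>0_def by blast
  have B_sets: "Bev \<in> sets M" unfolding B_eq A0_T by (intro sets.Int T_sets X_sets)
  have Y_T: "Y n \<omega> = x" if "\<omega> \<in> T c" for \<omega> c using that by (simp add: T_def)
  \<comment> \<open>Outside \<open>E3\<close> the events \<open>Bev\<close> and \<open>C\<close>
    coincide, so their probabilities differ by at most that of \<open>E3\<close>.\<close>
  have "Bev \<subseteq> C \<union> E3"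
  proof
    fix \<omega> assume "\<omega> \<in> Bev"
    then have \<omega>: "\<omega> \<in> T 0" "\<omega> \<in> space M" "X (s + h) \<omega> = y" unfolding B_eq A0_T by auto
    show "\<omega> \<in> C \<union> E3"
    proof (cases "\<omega> \<in> T h")
      case True
      then have "x = y" using pos1 Y_T \<omega>(3) by fastforce
      with True show ?thesis by (simp add: C_def)
    next
      case False
      then have "\<omega> \<in> E2" using \<omega>(1) by (simp add: E2_def)
      then show ?thesis using pos2[of \<omega>] \<omega> by (auto simp: C_def E2y_def)
    qed
  qed
  then have "prob Bev \<le> prob C + prob E3"
    by (rule order_trans[OF finite_measure_mono[OF _ sets.Un[OF C_sets E3_sets]]
          measure_Un_le[OF C_sets E3_sets]])
  moreover have "C \<subseteq> Bev \<union> E3"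
  proof
    fix \<omega> assume \<omega>: "\<omega> \<in> C"
    show "\<omega> \<in> Bev \<union> E3"
    proof (cases "\<omega> \<in> E2y")
      case True
      then have "\<omega> \<in> E2" "Y (Suc n) \<omega> = y" "\<omega> \<in> space M" "\<omega> \<in> T 0" by (auto simp: E2y_def E2_def)
      then show ?thesis using pos2[of \<omega>] unfolding B_eq A0_T by blast
    next
      case False
      then have "x = y" "\<omega> \<in> T h" using \<omega> by (auto simp: C_def split: if_splits)
      moreover have "\<omega> \<in> space M" using \<open>\<omega> \<in> T h\<close> by (simp add: T_def)
      ultimately show ?thesis using pos1[of \<omega>] Y_T[of \<omega> h] sub unfolding B_eq A0_T by blast
    qed
  qed
  then have "prob C \<le> prob Bev + prob E3"
    by (rule order_trans[OF finite_measure_mono[OF _ sets.Un[OF B_sets E3_sets]]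
          measure_Un_le[OF B_sets E3_sets]])
  ultimately have "\<bar>prob Bev - prob C\<bar> \<le> (max_rate * h)\<^sup>2 * a" using E3_le by linarith
  then show ?thesis unfolding C_prob a_def A\<^sub>0_def Bev_def .
qed

section \<open>From the local estimate to the transition law\<close>

lemma X_meas: "X t \<in> M \<rightarrow>\<^sub>M count_space V"
  by (rule measurable_position[OF Y_meas W_meas])

lemma X_eq_event: "{\<omega> \<in> space M. X t \<omega> = y} \<in> sets M"
proof -
  have "{\<omega> \<in> space M. X t \<omega> = y} = X t -` ({y} \<inter> V) \<inter> space M"
    using measurable_space[OF X_meas[of t]] by auto
  then show ?thesis using measurable_sets[OF X_meas, of "{y} \<inter> V"] by simp
qed

lemma cylinder_event:
  fixes m :: nat
  shows "{\<omega> \<in> space M. \<forall>k\<le>m. X (t k) \<omega> = x k} \<in> sets M"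
proof -
  have "{\<omega> \<in> space M. \<forall>k\<in>{..m}. X (t k) \<omega> = x k} \<in> sets M"
    by (intro sets.sets_Collect_finite_All X_eq_event finite_atMost)
  then show ?thesis by (simp only: Ball_def atMost_iff)
qed

text \<open>Without explosion exactly one of the events \<open>during s n\<close> occurs, up to a
  null set.\<close>

lemma sums_during:
  assumes E: "E \<in> sets M"
  shows "(\<lambda>n. \<P>(\<omega> in M. \<omega> \<in> E \<and> \<omega> \<in> during s n)) sums prob E"
proof -
  have eq: "{\<omega> \<in> space M. \<omega> \<in> E \<and> \<omega> \<in> during s n} = E \<inter> during s n" for n
    using sets.sets_into_space[OF E] by blast
  have "n = n'" if "\<omega> \<in> during s n" "\<omega> \<in> during s n'" for \<omega> n n'
  proof (rule linorder_cases[of n n'])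
    assume "n < n'"
    then show ?thesis using that by (auto simp: during_def not_less[symmetric])
  next
    assume "n' < n"
    then show ?thesis using that by (auto simp: during_def not_less[symmetric])
  qed
  then have disj: "disjoint_family (\<lambda>n. E \<inter> during s n)"
    unfolding disjoint_family_on_def by blast
  have meas: "E \<inter> during s n \<in> sets M" for n by (intro sets.Int E during_event)
  have "prob (\<Union>n. E \<inter> during s n) = prob E"
  proof (rule finite_measure_eq_AE)
    show "AE \<omega> in M. \<omega> \<in> (\<Union>n. E \<inter> during s n) \<longleftrightarrow> \<omega> \<in> E"
      using AE_no_explosion
    proof (rule AE_mp, intro AE_I2 impI)
      fix \<omega> assume \<omega>: "\<omega> \<in> space M" and "\<forall>s. \<exists>n. s < arrival W (Suc n) \<omega>"
      then have ex: "\<exists>n. s < arrival W (Suc n) \<omega>" by blast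
      define n where "n = (LEAST n. s < arrival W (Suc n) \<omega>)"
      have "s < arrival W (Suc n) \<omega>" unfolding n_def using ex by (rule LeastI_ex)
      moreover have "arrival W (Suc k) \<omega> \<le> s" if "k < n" for k
        using not_less_Least[of k "\<lambda>n. s < arrival W (Suc n) \<omega>"] that by (simp add: n_def not_less)
      ultimately have "\<omega> \<in> during s n" using \<omega> by (simp add: during_def)
      then show "\<omega> \<in> (\<Union>n. E \<inter> during s n) \<longleftrightarrow> \<omega> \<in> E" by blast
    qed
    show "(\<Union>n. E \<inter> during s n) \<in> sets M" using meas by (intro sets.countable_UN) blast
  qed (rule E)
  moreover have "(\<lambda>n. prob (E \<inter> during s n)) sums prob (\<Union>n. E \<inter> during s n)"
    by (rule finite_measure_UNION[OF _ disj]) (use meas in blast)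
  ultimately show ?thesis by (simp only: eq)
qed

text \<open>Expresses an earlier position without \<open>W n\<close>: for \<open>i = n\<close> the
  condition \<open>t < arrival W (Suc n) \<omega>\<close> already follows from
  \<open>during s n\<close>, and for \<open>i < n\<close> the arrival at \<open>Suc i\<close> is
  known from the history at step \<open>n\<close>.\<close>

lemma position_past:
  assumes "\<omega> \<in> during s n" "t \<le> s"
  shows "X t \<omega> = x \<longleftrightarrow>
    (\<exists>i\<in>{..n}. Y i \<omega> = x \<and> (i = n \<or> t < arrival W (Suc i) \<omega>) \<and> (\<forall>k<i. arrival W (Suc k) \<omega> \<le> t))"
proof
  assume X: "X t \<omega> = x"
  have t: "t < arrival W (Suc n) \<omega>" using assms by (auto simp: during_def)
  define i where "i = (LEAST n. t < arrival W (Suc n) \<omega>)"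
  have i: "t < arrival W (Suc i) \<omega>" unfolding i_def by (rule LeastI[of _ n]) (rule t)
  have "i \<le> n" unfolding i_def using t by (rule Least_le)
  moreover have le: "arrival W (Suc k) \<omega> \<le> t" if "k < i" for k
    using not_less_Least[of k "\<lambda>n. t < arrival W (Suc n) \<omega>"] that by (simp add: i_def not_less)
  moreover have "Y i \<omega> = x" using position_eq[where Y = Y, OF i le] X by simp
  ultimately show "\<exists>i\<in>{..n}. Y i \<omega> = x \<and> (i = n \<or> t < arrival W (Suc i) \<omega>) \<and>
      (\<forall>k<i. arrival W (Suc k) \<omega> \<le> t)"
    using i by blast
next
  assume "\<exists>i\<in>{..n}. Y i \<omega> = x \<and> (i = n \<or> t < arrival W (Suc i) \<omega>) \<and>
      (\<forall>k<i. arrival W (Suc k) \<omega> \<le> t)"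
  then obtain i where i: "Y i \<omega> = x" "i = n \<or> t < arrival W (Suc i) \<omega>"
      "\<And>k. k < i \<Longrightarrow> arrival W (Suc k) \<omega> \<le> t" by blast
  have "t < arrival W (Suc n) \<omega>" using assms by (auto simp: during_def)
  then have "t < arrival W (Suc i) \<omega>" using i(2) by blast
  from position_eq[where Y = Y, OF this i(3)] i(1) show "X t \<omega> = x" by simp
qed

text \<open>Turns an observation of positions up to time \<open>s\<close> into an event of the
  history at step \<open>n\<close>. The two agree only within \<open>during s n\<close>, and
  \<open>H\<close> depends on \<open>n\<close>.\<close>

lemma cylinder_hist:
  fixes m :: nat
  assumes "\<And>k. k \<le> m \<Longrightarrow> t k \<le> s"
  shows "\<exists>H\<in>sets (hist n). \<forall>\<omega>\<in>during s n. (\<forall>k\<le>m. X (t k) \<omega> = x k) \<longleftrightarrow> \<omega> \<in> H"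
proof -
  define H where "H k = {\<omega> \<in> space (hist n). \<exists>i\<in>{..n}. Y i \<omega> = x k \<and>
    (i = n \<or> t k < arrival W (Suc i) \<omega>) \<and> (\<forall>l\<in>{..<i}. arrival W (Suc l) \<omega> \<le> t k)}" for k
  have "H k \<in> sets (hist n)" for k
    unfolding H_def
  proof (intro sets.sets_Collect_finite_Ex sets.sets_Collect_conj sets.sets_Collect_finite_All)
    fix i l assume i: "i \<in> {..n}"
    show "{\<omega> \<in> space (hist n). Y i \<omega> = x k} \<in> sets (hist n)"
      using Y_eq_hist[of i n "x k"] i by (simp only: space_hist atMost_iff)
    show "{\<omega> \<in> space (hist n). i = n \<or> t k < arrival W (Suc i) \<omega>} \<in> sets (hist n)"
    proof (cases "i = n")
      case True
      then show ?thesis by simp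
    next
      case False
      then have "Suc i \<le> n" using i by simp
      from arrival_gt_hist[OF this, of "t k"] False show ?thesis by (simp only: space_hist simp_thms)
    qed
    assume "l \<in> {..<i}"
    then have "Suc l \<le> n" using i by simp
    from arrival_le_hist[OF this, of "t k"]
    show "{\<omega> \<in> space (hist n). arrival W (Suc l) \<omega> \<le> t k} \<in> sets (hist n)" by (simp only: space_hist)
  qed simp_all
  then have "(\<Inter>k\<in>{..m}. H k) \<in> sets (hist n)" by (intro sets.finite_INT) auto
  moreover have "(\<forall>k\<le>m. X (t k) \<omega> = x k) \<longleftrightarrow> \<omega> \<in> (\<Inter>k\<in>{..m}. H k)" if "\<omega> \<in> during s n" for \<omega>
  proof -
    have "\<omega> \<in> space M" using that by (simp add: during_def)
    then have "X (t k) \<omega> = x k \<longleftrightarrow> \<omega> \<in> H k" if "k \<le> m" for k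
      unfolding position_past[OF \<open>\<omega> \<in> during s n\<close> assms[OF that]] H_def space_hist by blast
    then show ?thesis by blast
  qed
  ultimately show ?thesis by blast
qed

text \<open>Each local error is at most \<open>(max_rate * h)\<^sup>2\<close> times the probability
  of its piece, so the sum over the number of jumps and the current states is bounded by this
  constant, uniformly in the observed past.\<close>

lemma step_estimate:
  fixes m :: nat and z :: "nat \<Rightarrow> 'v"
  assumes t: "\<And>k. k \<le> m \<Longrightarrow> t k \<le> s" and s: "0 \<le> s" and h: "0 \<le> h" and y: "y \<in> V"
  defines "A \<equiv> {\<omega> \<in> space M. \<forall>k\<le>m. X (t k) \<omega> = z k}"
  shows "\<bar>\<P>(\<omega> in M. \<omega> \<in> A \<and> X (s + h) \<omega> = y) -
      (\<Sum>x\<in>V. \<P>(\<omega> in M. \<omega> \<in> A \<and> X s \<omega> = x) * one_jump h x y)\<bar> \<le> (max_rate * h)\<^sup>2"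
proof -
  have A: "A \<in> sets M" unfolding A_def by (rule cylinder_event)
  define \<alpha> where "\<alpha> x = \<P>(\<omega> in M. \<omega> \<in> A \<and> X s \<omega> = x)" for x
  define \<beta> where "\<beta> x = \<P>(\<omega> in M. \<omega> \<in> {\<omega> \<in> space M. \<omega> \<in> A \<and> X (s + h) \<omega> = y} \<and> X s \<omega> = x)" for x
  have int: "{\<omega> \<in> space M. \<omega> \<in> E \<and> X r \<omega> = x} \<in> sets M" if "E \<in> sets M" for E r x
  proof -
    have "{\<omega> \<in> space M. \<omega> \<in> E \<and> X r \<omega> = x} = E \<inter> {\<omega> \<in> space M. X r \<omega> = x}"
      using sets.sets_into_space[OF that] by blast
    then show ?thesis using that X_eq_event by (simp only: sets.Int)
  qed
  have est: "\<bar>\<beta> x - \<alpha> x * one_jump h x y\<bar> \<le> (max_rate * h)\<^sup>2 * \<alpha> x" if x: "x \<in> V" for x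
  proof -
    let ?a = "\<lambda>n. \<P>(\<omega> in M. \<omega> \<in> {\<omega> \<in> space M. \<omega> \<in> A \<and> X s \<omega> = x} \<and> \<omega> \<in> during s n)"
    let ?b = "\<lambda>n. \<P>(\<omega> in M. \<omega> \<in> {\<omega> \<in> space M. \<omega> \<in> {\<omega> \<in> space M. \<omega> \<in> A \<and> X (s + h) \<omega> = y} \<and> X s \<omega> = x}
      \<and> \<omega> \<in> during s n)"
    have a: "?a sums \<alpha> x" unfolding \<alpha>_def by (intro sums_during int A)
    have b: "?b sums \<beta> x" unfolding \<beta>_def by (intro sums_during int A)
    have ab: "\<bar>?b n - ?a n * one_jump h x y\<bar> \<le> (max_rate * h)\<^sup>2 * ?a n" for n
    proof -
      obtain H where H: "H \<in> sets (hist n)"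
          "\<And>\<omega>. \<omega> \<in> during s n \<Longrightarrow> (\<forall>k\<le>m. X (t k) \<omega> = z k) \<longleftrightarrow> \<omega> \<in> H"
        using cylinder_hist[where m = m and t = t and n = n and x = z, OF t] by blast
      have AH: "\<omega> \<in> A \<longleftrightarrow> \<omega> \<in> H" if "\<omega> \<in> during s n" for \<omega>
        using H(2)[OF that] that unfolding A_def during_def by blast
      have 1: "{\<omega> \<in> space M. \<omega> \<in> {\<omega> \<in> space M. \<omega> \<in> A \<and> X s \<omega> = x} \<and> \<omega> \<in> during s n} =
          {\<omega> \<in> space M. \<omega> \<in> H \<and> \<omega> \<in> during s n \<and> Y n \<omega> = x}"
      proof (intro Collect_cong)
        fix \<omega> show "\<omega> \<in> space M \<and> \<omega> \<in> {\<omega> \<in> space M. \<omega> \<in> A \<and> X s \<omega> = x} \<and> \<omega> \<in> during s n \<longleftrightarrow>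
            \<omega> \<in> space M \<and> \<omega> \<in> H \<and> \<omega> \<in> during s n \<and> Y n \<omega> = x"
          using AH[of \<omega>] position_during[of \<omega> s n] by (cases "\<omega> \<in> during s n") auto
      qed
      have 2: "{\<omega> \<in> space M. \<omega> \<in> {\<omega> \<in> space M. \<omega> \<in> {\<omega> \<in> space M. \<omega> \<in> A \<and> X (s + h) \<omega> = y} \<and> X s \<omega> = x} \<and>
          \<omega> \<in> during s n} = {\<omega> \<in> space M. \<omega> \<in> H \<and> \<omega> \<in> during s n \<and> Y n \<omega> = x \<and> X (s + h) \<omega> = y}"
      proof (intro Collect_cong)
        fix \<omega> show "\<omega> \<in> space M \<and> \<omega> \<in> {\<omega> \<in> space M. \<omega> \<in> {\<omega> \<in> space M. \<omega> \<in> A \<and> X (s + h) \<omega> = y} \<and> X s \<omega> = x} \<and>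
            \<omega> \<in> during s n \<longleftrightarrow> \<omega> \<in> space M \<and> \<omega> \<in> H \<and> \<omega> \<in> during s n \<and> Y n \<omega> = x \<and> X (s + h) \<omega> = y"
          using AH[of \<omega>] position_during[of \<omega> s n] by (cases "\<omega> \<in> during s n") auto
      qed
      show ?thesis unfolding 1 2 by (rule local_estimate[OF H(1) s h x y])
    qed
    have "\<beta> x \<le> (one_jump h x y + (max_rate * h)\<^sup>2) * \<alpha> x"
      by (rule sums_le[OF _ b sums_mult[OF a]]) (use ab in \<open>auto simp: algebra_simps abs_le_iff\<close>)
    moreover have "(one_jump h x y - (max_rate * h)\<^sup>2) * \<alpha> x \<le> \<beta> x"
      by (rule sums_le[OF _ sums_mult[OF a] b]) (use ab in \<open>auto simp: algebra_simps abs_le_iff\<close>)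
    ultimately show ?thesis by (auto simp: algebra_simps abs_le_iff)
  qed
  have "\<P>(\<omega> in M. \<omega> \<in> A \<and> X (s + h) \<omega> = y) = (\<Sum>x\<in>V. \<beta> x)"
    unfolding \<beta>_def by (rule prob_sum_values[OF pair_finite_verts X_meas int[OF A]])
  then have "\<bar>\<P>(\<omega> in M. \<omega> \<in> A \<and> X (s + h) \<omega> = y) - (\<Sum>x\<in>V. \<alpha> x * one_jump h x y)\<bar> =
      \<bar>\<Sum>x\<in>V. \<beta> x - \<alpha> x * one_jump h x y\<bar>" by (simp only: sum_subtractf)
  also have "\<dots> \<le> (\<Sum>x\<in>V. (max_rate * h)\<^sup>2 * \<alpha> x)"
    by (rule order_trans[OF sum_abs]) (intro sum_mono est)
  also have "\<dots> = (max_rate * h)\<^sup>2 * prob A"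
    unfolding \<alpha>_def by (simp only: sum_distrib_left prob_sum_values[OF pair_finite_verts X_meas A, of s])
  also have "\<dots> \<le> (max_rate * h)\<^sup>2" by (simp add: mult_left_le)
  finally show ?thesis by (simp only: \<alpha>_def)
qed

lemma one_jump_deriv:
  assumes x: "x \<in> V"
  shows "((\<lambda>h. one_jump h x y) has_real_derivative rate_matrix G x y) (at_right 0)"
proof -
  have "((\<lambda>h. one_jump h x y) has_real_derivative
      - rate x * of_bool (x = y) + rate x * step_prob x y) (at_right 0)"
    unfolding one_jump_def by (auto intro!: derivative_eq_intros)
  moreover have "- rate x * of_bool (x = y) + rate x * step_prob x y = rate_matrix G x y"
    using deg_pos[OF x]
    by (simp add: pmf_out_nbrs rate_matrix_def deg_matrix_def diag_def row_sum_eq_deg)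
  ultimately show ?thesis by (simp only:)
qed

text \<open>For a fixed past, the joint probability \<open>f r y\<close> with the position a time
  \<open>r\<close> later almost follows the flow of \<open>P\<close>: one step is governed by
  \<open>one_jump h\<close>, which differs from \<open>P h\<close> by o(h) since both equal the
  identity at 0 and have the same derivative there. Uniqueness of the flow makes this exact.\<close>

lemma markov_property:
  fixes m :: nat
  assumes P: "transition_function V P"
    and deriv: "\<And>x y. x \<in> V \<Longrightarrow> y \<in> V \<Longrightarrow>
      ((\<lambda>t. P t x y) has_real_derivative rate_matrix G x y) (at_right 0)"
    and t: "\<And>k. k \<le> m \<Longrightarrow> t k \<le> t m" "0 \<le> t m" and r: "0 \<le> r" and y: "y \<in> V" and z: "z m \<in> V"
  shows "\<P>(\<omega> in M. (\<forall>k\<le>m. X (t k) \<omega> = z k) \<and> X (t m + r) \<omega> = y) =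
    \<P>(\<omega> in M. \<forall>k\<le>m. X (t k) \<omega> = z k) * P r (z m) y"
proof -
  define A where "A = {\<omega> \<in> space M. \<forall>k\<le>m. X (t k) \<omega> = z k}"
  define f where "f r y = \<P>(\<omega> in M. \<omega> \<in> A \<and> X (t m + r) \<omega> = y)" for r y
  \<comment> \<open>The error from second jumps plus the distance of \<open>one_jump h\<close> from
    \<open>P h\<close>, summed over all entries so that it depends on neither the time nor the
    target state.\<close>
  define \<rho> where "\<rho> h = (max_rate * h)\<^sup>2 + (\<Sum>y\<in>V. \<Sum>x\<in>V. \<bar>one_jump h x y - P h x y\<bar>)" for h
  have P0: "P 0 x y = of_bool (x = y)" if "x \<in> V" "y \<in> V" for x y
    using P that by (simp add: transition_function_def)
  have "((\<lambda>h. max_rate\<^sup>2 * h + (\<Sum>y\<in>V. \<Sum>x\<in>V. \<bar>(one_jump h x y - P h x y) / h\<bar>)) \<longlongrightarrow>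
      max_rate\<^sup>2 * 0 + (\<Sum>y\<in>V. \<Sum>x\<in>V. \<bar>0\<bar>)) (at_right 0)"
  proof (intro tendsto_intros)
    fix x y assume xy: "x \<in> V" "y \<in> V"
    have "((\<lambda>h. one_jump h x y - P h x y) has_real_derivative 0) (at_right 0)"
      using DERIV_diff[OF one_jump_deriv[OF xy(1), of y] deriv[OF xy]] by simp
    then show "((\<lambda>h. (one_jump h x y - P h x y) / h) \<longlongrightarrow> 0) (at_right 0)"
      by (simp add: has_field_derivative_iff P0[OF xy] one_jump_def)
  qed
  then have "((\<lambda>h. max_rate\<^sup>2 * h + (\<Sum>y\<in>V. \<Sum>x\<in>V. \<bar>(one_jump h x y - P h x y) / h\<bar>)) \<longlongrightarrow> 0) (at_right 0)"
    by simp
  then have \<rho>: "((\<lambda>h. \<rho> h / h) \<longlongrightarrow> 0) (at_right 0)"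
  proof (rule Lim_transform_eventually)
    show "\<forall>\<^sub>F h in at_right 0. max_rate\<^sup>2 * h + (\<Sum>y\<in>V. \<Sum>x\<in>V. \<bar>(one_jump h x y - P h x y) / h\<bar>) = \<rho> h / h"
      using eventually_at_right_less[of "0 :: real"]
    proof eventually_elim
      case (elim h)
      then show ?case
        by (simp add: \<rho>_def add_divide_distrib sum_divide_distrib power2_eq_square)
    qed
  qed
  have f_le: "f s x \<le> 1" "0 \<le> f s x" for s x unfolding f_def by simp_all
  have step: "\<bar>f (s + h) y - (\<Sum>x\<in>V. f s x * P h x y)\<bar> \<le> \<rho> h"
    if "0 \<le> s" "0 < h" "y \<in> V" for s h y
  proof -
    have "t k \<le> t m + s" if "k \<le> m" for k using t(1)[OF that] \<open>0 \<le> s\<close> by linarith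
    then have 1: "\<bar>f (s + h) y - (\<Sum>x\<in>V. f s x * one_jump h x y)\<bar> \<le> (max_rate * h)\<^sup>2"
      using that t(2) unfolding f_def A_def add.assoc[symmetric] by (intro step_estimate) auto
    have "\<bar>(\<Sum>x\<in>V. f s x * one_jump h x y) - (\<Sum>x\<in>V. f s x * P h x y)\<bar> =
        \<bar>\<Sum>x\<in>V. f s x * (one_jump h x y - P h x y)\<bar>"
      by (simp only: sum_subtractf[symmetric] right_diff_distrib)
    also have "\<dots> \<le> (\<Sum>x\<in>V. \<bar>one_jump h x y - P h x y\<bar>)"
      by (rule order_trans[OF sum_abs])
         (intro sum_mono, simp add: abs_mult f_le mult_left_le_one_le)
    also have "\<dots> \<le> (\<Sum>y\<in>V. \<Sum>x\<in>V. \<bar>one_jump h x y - P h x y\<bar>)"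
      using that(3) pair_finite_verts
      by (intro member_le_sum[of y V "\<lambda>y. \<Sum>x\<in>V. \<bar>one_jump h x y - P h x y\<bar>"]) (auto intro: sum_nonneg)
    finally show ?thesis using 1 unfolding \<rho>_def by linarith
  qed
  have "f r y = (\<Sum>x\<in>V. f 0 x * P r x y)"
    by (rule transition_function_flow_unique[OF pair_finite_verts P \<rho> step r y])
  \<comment> \<open>At time lag 0 the position is the last one observed, so the whole mass of the
    past sits at \<open>z m\<close>.\<close>
  also have "\<dots> = (\<Sum>x\<in>V. if x = z m then prob A * P r (z m) y else 0)"
  proof (intro sum.cong refl)
    fix x
    have "{\<omega> \<in> space M. \<omega> \<in> A \<and> X (t m + 0) \<omega> = x} = (if x = z m then A else {})"
      unfolding A_def by auto
    then have "f 0 x = (if x = z m then prob A else 0)" unfolding f_def by (simp only:) simp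
    then show "f 0 x * P r x y = (if x = z m then prob A * P r (z m) y else 0)" by simp
  qed
  also have "\<dots> = prob A * P r (z m) y" using z pair_finite_verts by simp
  finally have "f r y = prob A * P r (z m) y" .
  moreover have "{\<omega> \<in> space M. \<omega> \<in> A \<and> X (t m + r) \<omega> = y} =
      {\<omega> \<in> space M. (\<forall>k\<le>m. X (t k) \<omega> = z k) \<and> X (t m + r) \<omega> = y}"
    unfolding A_def by blast
  ultimately show ?thesis unfolding f_def A_def by (simp only:)
qed

end

section \<open>The joint process\<close>

lemma joint_process_eq_iff:
  assumes "x \<in> extensional {..<m}"
  shows "joint_process m Y W t \<omega> = x \<longleftrightarrow> (\<forall>i<m. position (Y i) (W i) t \<omega> = x i)"
proof
  assume "\<forall>i<m. position (Y i) (W i) t \<omega> = x i"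
  then show "joint_process m Y W t \<omega> = x"
    using assms by (intro extensionalityI[of _ "{..<m}"]) (auto simp: joint_process_def)
qed (auto simp: joint_process_def)

lemma joint_process_right_cont:
  assumes "1 \<le> m"
  shows "\<exists>\<epsilon>>0. \<forall>s\<in>{t..<t + \<epsilon>}. joint_process m Y W s \<omega> = joint_process m Y W t \<omega>"
proof -
  have "\<forall>i\<in>{..<m}. \<exists>\<epsilon>>0. \<forall>s\<in>{t..<t + \<epsilon>}. position (Y i) (W i) s \<omega> = position (Y i) (W i) t \<omega>"
    by (intro ballI position_right_cont)
  from bchoice[OF this] obtain \<epsilon> where "\<forall>i\<in>{..<m}. \<epsilon> i > 0 \<and>
      (\<forall>s\<in>{t..<t + \<epsilon> i}. position (Y i) (W i) s \<omega> = position (Y i) (W i) t \<omega>)" ..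
  then have \<epsilon>: "\<And>i. i < m \<Longrightarrow> \<epsilon> i > 0"
      "\<And>i s. i < m \<Longrightarrow> s \<in> {t..<t + \<epsilon> i} \<Longrightarrow> position (Y i) (W i) s \<omega> = position (Y i) (W i) t \<omega>"
    by (meson lessThan_iff)+
  define \<delta> where "\<delta> = Min (\<epsilon> ` {..<m})"
  have ne: "{..<m} \<noteq> {}" using assms by (auto simp: lessThan_empty_iff)
  have "\<delta> > 0" unfolding \<delta>_def using \<epsilon>(1) ne by (subst Min_gr_iff) auto
  moreover have "joint_process m Y W s \<omega> = joint_process m Y W t \<omega>" if s: "s \<in> {t..<t + \<delta>}" for s
  proof -
    have "position (Y i) (W i) s \<omega> = position (Y i) (W i) t \<omega>" if "i < m" for i
    proof -
      have "\<delta> \<le> \<epsilon> i" unfolding \<delta>_def using that by (intro Min_le) auto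
      then have "s \<in> {t..<t + \<epsilon> i}" using s by simp
      then show ?thesis by (rule \<epsilon>(2)[OF that])
    qed
    then show ?thesis unfolding joint_process_def by (intro restrict_ext) (metis lessThan_iff)
  qed
  ultimately show ?thesis by blast
qed

lemma measurable_joint_process_pair:
  fixes Y :: "nat \<Rightarrow> nat \<Rightarrow> 'a \<Rightarrow> 'v"
  assumes V: "finite V" and Y: "\<And>i n. i < m \<Longrightarrow> Y i n \<in> M \<rightarrow>\<^sub>M count_space V"
    and W: "\<And>i n. i < m \<Longrightarrow> W i n \<in> borel_measurable M"
  shows "case_prod (joint_process m Y W) \<in> borel \<Otimes>\<^sub>M M \<rightarrow>\<^sub>M count_space ({..<m} \<rightarrow>\<^sub>E V)"
proof -
  let ?N = "borel \<Otimes>\<^sub>M M :: (real \<times> 'a) measure"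
  have pos: "(\<lambda>(t, \<omega>). position (Y i) (W i) t \<omega>) \<in> ?N \<rightarrow>\<^sub>M count_space V" if "i < m" for i
    using measurable_position_pair[OF Y[OF that] W[OF that]] .
  have finE: "finite ({..<m} \<rightarrow>\<^sub>E V)" using V by (intro finite_PiE) auto
  show ?thesis
  proof (rule measurable_count_space_eq2[OF finE, THEN iffD2], intro conjI ballI)
    show "case_prod (joint_process m Y W) \<in> space ?N \<rightarrow> {..<m} \<rightarrow>\<^sub>E V"
      using measurable_space[OF pos] by (auto simp: joint_process_def split: if_splits)
    fix x assume x: "x \<in> {..<m} \<rightarrow>\<^sub>E V"
    have "case_prod (joint_process m Y W) -` {x} \<inter> space ?N =
        {p \<in> space ?N. \<forall>i\<in>{..<m}. (\<lambda>(t, \<omega>). position (Y i) (W i) t \<omega>) p = x i}"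
      using joint_process_eq_iff[of x m Y W] x by (auto simp: PiE_def)
    moreover have "{p \<in> space ?N. \<forall>i\<in>{..<m}. (\<lambda>(t, \<omega>). position (Y i) (W i) t \<omega>) p = x i} \<in> sets ?N"
    proof (intro sets.sets_Collect_finite_All finite_lessThan)
      fix i assume i: "i \<in> {..<m}"
      then have "x i \<in> V" using x by auto
      then have "(\<lambda>(t, \<omega>). position (Y i) (W i) t \<omega>) -` {x i} \<inter> space ?N \<in> sets ?N"
        using i by (intro measurable_sets[OF pos]) auto
      also have "(\<lambda>(t, \<omega>). position (Y i) (W i) t \<omega>) -` {x i} \<inter> space ?N =
          {p \<in> space ?N. (\<lambda>(t, \<omega>). position (Y i) (W i) t \<omega>) p = x i}" by auto
      finally show "{p \<in> space ?N. (\<lambda>(t, \<omega>). position (Y i) (W i) t \<omega>) p = x i} \<in> sets ?N" .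
    qed
    ultimately show "case_prod (joint_process m Y W) -` {x} \<inter> space ?N \<in> sets ?N" by (simp only:)
  qed
qed

text \<open>The position is a fixed measurable functional \<open>pos\<close> of the sequence of
  vertices and waits. An observation of walker \<open>i\<close> is thus the preimage of a set in
  path space, and independence of the sequences applies.\<close>

lemma (in prob_space) joint_process_product:
  fixes n :: nat and Y :: "nat \<Rightarrow> nat \<Rightarrow> 'a \<Rightarrow> 'v"
  assumes m: "1 \<le> m"
    and indep: "indep_vars
      (\<lambda>i. \<Pi>\<^sub>M n\<in>(UNIV :: nat set). count_space V \<Otimes>\<^sub>M (borel :: real measure))
      (\<lambda>i \<omega> n. (Y i n \<omega>, W i n \<omega>)) {..<m}"
    and x: "\<And>k. k \<le> n \<Longrightarrow> x k \<in> {..<m} \<rightarrow>\<^sub>E V"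
  shows "\<P>(\<omega> in M. \<forall>k\<le>n. joint_process m Y W (t k) \<omega> = x k) =
    (\<Prod>i<m. \<P>(\<omega> in M. \<forall>k\<le>n. position (Y i) (W i) (t k) \<omega> = x k i))"
proof -
  define N where "N = (\<Pi>\<^sub>M n\<in>(UNIV :: nat set). count_space V \<Otimes>\<^sub>M (borel :: real measure))"
  define pos where "pos = position (\<lambda>n (p :: nat \<Rightarrow> 'v \<times> real). fst (p n)) (\<lambda>n p. snd (p n))"
  define A where "A i = {p \<in> space N. \<forall>k\<in>{..n}. pos (t k) p = x k i}" for i
  let ?Z = "\<lambda>i \<omega> n. (Y i n \<omega>, W i n \<omega>)"
  have comp: "(\<lambda>p. p n) \<in> N \<rightarrow>\<^sub>M count_space V \<Otimes>\<^sub>M borel" for n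
    unfolding N_def by (rule measurable_component_singleton) simp
  have pos_meas: "pos s \<in> N \<rightarrow>\<^sub>M count_space V" for s
    unfolding pos_def
    by (rule measurable_position) (rule measurable_compose[OF comp], rule measurable_fst measurable_snd)+
  have A: "A i \<in> sets N" if "i < m" for i
    unfolding A_def
  proof (intro sets.sets_Collect_finite_All finite_atMost)
    fix k assume "k \<in> {..n}"
    then have "x k i \<in> V" using x[of k] that by auto
    then have "pos (t k) -` {x k i} \<inter> space N \<in> sets N" by (intro measurable_sets[OF pos_meas]) auto
    also have "pos (t k) -` {x k i} \<inter> space N = {p \<in> space N. pos (t k) p = x k i}" by auto
    finally show "{p \<in> space N. pos (t k) p = x k i} \<in> sets N" .
  qed
  have ne: "{..<m} \<noteq> {}" using m by (auto simp: lessThan_empty_iff)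
  have Z: "?Z i \<in> M \<rightarrow>\<^sub>M N" if "i < m" for i
    using indep that unfolding indep_vars_def N_def by auto
  have vimage: "?Z i -` A i \<inter> space M = {\<omega> \<in> space M. \<forall>k\<le>n. position (Y i) (W i) (t k) \<omega> = x k i}"
    if "i < m" for i
    using measurable_space[OF Z[OF that]] by (auto simp: A_def pos_def position_def)
  have "prob (\<Inter>i\<in>{..<m}. ?Z i -` A i \<inter> space M) = (\<Prod>i\<in>{..<m}. prob (?Z i -` A i \<inter> space M))"
    using indep_varsD_finite[OF indep ne finite_lessThan, of A] A unfolding N_def by auto
  also have "\<dots> = (\<Prod>i<m. \<P>(\<omega> in M. \<forall>k\<le>n. position (Y i) (W i) (t k) \<omega> = x k i))"
    by (intro prod.cong refl) (simp only: vimage lessThan_iff)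
  also have "(\<Inter>i\<in>{..<m}. ?Z i -` A i \<inter> space M) =
      {\<omega> \<in> space M. \<forall>k\<le>n. joint_process m Y W (t k) \<omega> = x k}"
  proof -
    have "(\<Inter>i\<in>{..<m}. ?Z i -` A i \<inter> space M) =
        (\<Inter>i\<in>{..<m}. {\<omega> \<in> space M. \<forall>k\<le>n. position (Y i) (W i) (t k) \<omega> = x k i})"
      by (intro INF_cong refl) (simp only: vimage lessThan_iff)
    also have "\<dots> = {\<omega> \<in> space M. \<forall>k\<le>n. \<forall>i<m. position (Y i) (W i) (t k) \<omega> = x k i}"
      using ne by blast
    also have "\<dots> = {\<omega> \<in> space M. \<forall>k\<le>n. joint_process m Y W (t k) \<omega> = x k}"
    proof (intro Collect_cong conj_cong refl all_cong)
      fix \<omega> k assume "k \<le> n"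
      then have "x k \<in> extensional {..<m}" using x[of k] by (simp add: PiE_def)
      then show "(\<forall>i<m. position (Y i) (W i) (t k) \<omega> = x k i) \<longleftrightarrow> joint_process m Y W (t k) \<omega> = x k"
        by (rule joint_process_eq_iff[symmetric])
    qed
    finally show ?thesis .
  qed
  finally show ?thesis .
qed

text \<open>The shift \<open>l\<close> has to dominate every degree for the diagonal
  \<open>l - deg G x\<close> to be nonnegative, and the sum of all degrees does. The degree then
  cancels in each row sum.\<close>

lemma (in pair_graph) uniformized_graph:
  defines "l \<equiv> (\<Sum>v\<in>pverts G. real (deg G v))"
  shows "uniformized (pverts G) (\<lambda>x y. adj_matrix G x y + (l - deg G x) * of_bool (x = y)) l"
proof
  show "finite (pverts G)" by (rule pair_finite_verts)
  fix x y assume x: "x \<in> pverts G"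
  have "real (deg G x) \<le> l"
    unfolding l_def using x by (intro member_le_sum) (auto simp: pair_finite_verts)
  then show "0 \<le> adj_matrix G x y + (l - deg G x) * of_bool (x = y)"
    by (simp add: adj_matrix_def)
next
  fix x assume x: "x \<in> pverts G"
  have "(\<Sum>y\<in>pverts G. (l - deg G x) * of_bool (x = y)) =
      (\<Sum>y\<in>pverts G. if y = x then l - deg G x else 0)" by (intro sum.cong) auto
  then show "(\<Sum>y\<in>pverts G. adj_matrix G x y + (l - deg G x) * of_bool (x = y)) = l"
    using row_sum_eq_deg[of x] x pair_finite_verts by (simp add: sum.distrib row_sum_def)
qed

theorem theorem4:
  fixes G :: "'v pair_pre_digraph" and m :: nat and M :: "'a measure"
    and Y :: "nat \<Rightarrow> nat \<Rightarrow> 'a \<Rightarrow> 'v" and W :: "nat \<Rightarrow> nat \<Rightarrow> 'a \<Rightarrow> real"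
  assumes "pair_graph G"
    and "\<forall>v\<in>pverts G. 0 < deg G v"
    and "1 \<le> m"
    and "prob_space M"
    and "independent_walkers M G m Y W"
  shows "continuous_time_markov_chain M (pverts (cart_power G m))
           (rate_matrix (cart_power G m)) (joint_process m Y W) \<and>
         discrete_markov_chain M (pverts (cart_power G m))
           (jump_matrix (cart_power G m)) (jump_chain (joint_process m Y W)) \<and>
         (\<forall>v\<in>pverts (cart_power G m). \<forall>u\<in>pverts (cart_power G m).
           jump_matrix (cart_power G m) v u = frontier_matrix G m v u)"
proof -
  interpret pair_graph G by fact
  interpret prob_space M by fact
  note deg_pos = assms(2)
  have rw: "random_walker M G (Y i) (W i)" if "i < m" for i
    using assms(5) that by (simp add: independent_walkers_def)
  have indep: "indep_vars
      (\<lambda>i. \<Pi>\<^sub>M n\<in>(UNIV :: nat set). count_space (pverts G) \<Otimes>\<^sub>M (borel :: real measure))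
      (\<lambda>i \<omega> n. (Y i n \<omega>, W i n \<omega>)) {..<m}"
    using assms(5) by (simp add: independent_walkers_def)
  have walker: "walker M G (Y i) (W i)" if "i < m" for i
    using rw[OF that] deg_pos by unfold_locales auto
  define H where "H = cart_power G m"
  define S where "S = pverts H"
  define X where "X = joint_process m Y W"
  have S_PiE: "S = {..<m} \<rightarrow>\<^sub>E pverts G" by (simp add: S_def H_def pverts_cart_power)
  have fin: "finite S" by (simp add: S_def H_def finite_cart_power)
  define l where "l = (\<Sum>v\<in>pverts G. real (deg G v))"
  define P\<^sub>1 where
    "P\<^sub>1 = unif_semigroup (pverts G) (\<lambda>x y. adj_matrix G x y + (l - deg G x) * of_bool (x = y)) l"
  define P where "P t x y = (\<Prod>i<m. P\<^sub>1 t (x i) (y i))" for t x y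
  interpret U: uniformized "pverts G" "\<lambda>x y. adj_matrix G x y + (l - deg G x) * of_bool (x = y)" l
    unfolding l_def by (rule uniformized_graph)
  have tf1: "transition_function (pverts G) P\<^sub>1"
    unfolding P\<^sub>1_def by (rule U.transition_function_unif_semigroup)
  have deriv1: "((\<lambda>t. P\<^sub>1 t x y) has_real_derivative rate_matrix G x y) (at_right 0)"
    if "x \<in> pverts G" "y \<in> pverts G" for x y
  proof -
    have "adj_matrix G x y + (l - deg G x) * of_bool (x = y) - l * of_bool (x = y) = rate_matrix G x y"
      by (simp add: rate_matrix_def deg_matrix_def diag_def row_sum_eq_deg algebra_simps)
    then show ?thesis unfolding P\<^sub>1_def using U.unif_semigroup_deriv[OF that] by (simp only:)
  qed
  have tf: "transition_function S P"
    unfolding S_PiE P_def[abs_def] by (rule transition_function_power[OF pair_finite_verts tf1])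
  have deriv: "((\<lambda>t. P t x y) has_real_derivative rate_matrix H x y) (at_right 0)"
    if "x \<in> S" "y \<in> S" for x y
    unfolding P_def H_def
    by (rule cart_power_rate_matrix_deriv[OF tf1 deriv1]) (use that in \<open>simp_all add: S_def H_def\<close>)
  have X_pair: "case_prod X \<in> borel \<Otimes>\<^sub>M M \<rightarrow>\<^sub>M count_space S"
    unfolding X_def S_PiE
    by (rule measurable_joint_process_pair[OF pair_finite_verts])
       (use rw in \<open>auto simp: random_walker_def\<close>)
  have X_meas: "X t \<in> M \<rightarrow>\<^sub>M count_space S" for t
    using measurable_compose[OF measurable_Pair[OF measurable_const measurable_ident] X_pair, of t] by simp
  have X_rc: "\<exists>\<epsilon>>0. \<forall>s\<in>{t..<t + \<epsilon>}. X s \<omega> = X t \<omega>" for t \<omega>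
    unfolding X_def by (rule joint_process_right_cont[OF assms(3)])
  \<comment> \<open>Independence splits the probability into one factor per walker, each walker's
    Markov property extends its factor by one step, and independence reassembles the past.\<close>
  have markov: "\<P>(\<omega> in M. \<forall>k\<le>Suc n. X (t k) \<omega> = x k) =
      \<P>(\<omega> in M. \<forall>k\<le>n. X (t k) \<omega> = x k) * P (t (Suc n) - t n) (x n) (x (Suc n))"
    if t0: "0 \<le> t 0" and inc: "\<And>k. k \<le> n \<Longrightarrow> t k < t (Suc k)" and xS: "\<And>k. k \<le> Suc n \<Longrightarrow> x k \<in> S"
    for n t x
  proof -
    have mono: "t k \<le> t n'" if "k \<le> n'" "n' \<le> n" for k n'
      using that
    proof (induction n' rule: dec_induct)
      case (step n')
      then show ?case using inc[of n'] by simp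
    qed simp
    have tn: "0 \<le> t n" using mono[of 0 n] t0 by simp
    have xV: "x k i \<in> pverts G" if "k \<le> Suc n" "i < m" for k i
      using xS[OF that(1)] that(2) by (auto simp: S_PiE)
    have "\<P>(\<omega> in M. \<forall>k\<le>Suc n. X (t k) \<omega> = x k) =
        (\<Prod>i<m. \<P>(\<omega> in M. \<forall>k\<le>Suc n. position (Y i) (W i) (t k) \<omega> = x k i))"
      unfolding X_def by (rule joint_process_product[OF assms(3) indep]) (use xS in \<open>simp only: S_PiE\<close>)
    also have "\<dots> = (\<Prod>i<m. \<P>(\<omega> in M. \<forall>k\<le>n. position (Y i) (W i) (t k) \<omega> = x k i) *
        P\<^sub>1 (t (Suc n) - t n) (x n i) (x (Suc n) i))"
    proof (intro prod.cong refl)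
      fix i assume "i \<in> {..<m}"
      then have i: "i < m" by simp
      have "\<P>(\<omega> in M. (\<forall>k\<le>n. position (Y i) (W i) (t k) \<omega> = x k i) \<and>
          position (Y i) (W i) (t n + (t (Suc n) - t n)) \<omega> = x (Suc n) i) =
          \<P>(\<omega> in M. \<forall>k\<le>n. position (Y i) (W i) (t k) \<omega> = x k i) *
            P\<^sub>1 (t (Suc n) - t n) (x n i) (x (Suc n) i)"
        using mono[OF _ order_refl] tn inc[of n] xV[OF _ i]
        by (intro walker.markov_property[OF walker[OF i] tf1 deriv1, where z = "\<lambda>k. x k i"]) auto
      moreover have "t n + (t (Suc n) - t n) = t (Suc n)" by simp
      ultimately show "\<P>(\<omega> in M. \<forall>k\<le>Suc n. position (Y i) (W i) (t k) \<omega> = x k i) =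
          \<P>(\<omega> in M. \<forall>k\<le>n. position (Y i) (W i) (t k) \<omega> = x k i) *
            P\<^sub>1 (t (Suc n) - t n) (x n i) (x (Suc n) i)"
        by (simp only: all_le_Suc)
    qed
    also have "\<dots> = (\<Prod>i<m. \<P>(\<omega> in M. \<forall>k\<le>n. position (Y i) (W i) (t k) \<omega> = x k i)) *
        P (t (Suc n) - t n) (x n) (x (Suc n))"
      by (simp only: prod.distrib P_def)
    also have "(\<Prod>i<m. \<P>(\<omega> in M. \<forall>k\<le>n. position (Y i) (W i) (t k) \<omega> = x k i)) =
        \<P>(\<omega> in M. \<forall>k\<le>n. X (t k) \<omega> = x k)"
      unfolding X_def
      by (rule joint_process_product[OF assms(3) indep, symmetric]) (use xS in \<open>simp add: S_PiE\<close>)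
    finally show ?thesis .
  qed
  interpret R: right_cont_markov_process M S P X
    by unfold_locales (use fin tf X_meas X_rc markov in blast)+
  have deg_sum: "0 < (\<Sum>i<m. real (deg G (x i)))" if "x \<in> S" for x
    using deg_pos that assms(3) by (intro sum_pos) (auto simp: S_PiE lessThan_empty_iff)
  \<comment> \<open>Loops are absent from the power graph as well. So the diagonal of the rate
    matrix is minus the total degree, and the jump matrix vanishes on the diagonal, as the embedded
    chain requires.\<close>
  have loop: "adj_matrix H x x = 0" if "x \<in> S" for x
  proof -
    have "adj_matrix G v v = 0" for v using pair_no_loops[of "(v, v)"] by (auto simp: adj_matrix_def)
    then show ?thesis using adj_matrix_cart_power[of x m x] that by (simp add: H_def S_def)
  qed
  have rate_diag: "rate_matrix H x x = - (\<Sum>i<m. real (deg G (x i)))" if "x \<in> S" for x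
    using loop[OF that] row_sum_cart_power[of x m] that
    by (simp add: rate_matrix_def deg_matrix_def diag_def H_def S_def)
  have "continuous_time_markov_chain M S (rate_matrix H) X"
    unfolding continuous_time_markov_chain_def
  proof (intro conjI allI impI exI[of _ P])
    show "AE \<omega> in M. \<forall>t\<ge>0. \<exists>\<epsilon>>0. \<forall>s\<in>{t..<t + \<epsilon>}. X s \<omega> = X t \<omega>"
      using X_rc by (intro AE_I2) blast
    show "\<forall>x\<in>S. \<forall>y\<in>S. ((\<lambda>t. P t x y) has_real_derivative rate_matrix H x y) (at_right 0)"
      using deriv by blast
    fix n :: nat and t x
    assume "0 \<le> t 0" "\<forall>k\<le>n. t k < t (Suc k)" "\<forall>k\<le>Suc n. x k \<in> S"
      and nz: "\<P>(\<omega> in M. \<forall>k\<le>n. X (t k) \<omega> = x k) \<noteq> 0"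
    then have "\<P>(\<omega> in M. \<forall>k\<le>Suc n. X (t k) \<omega> = x k) =
        \<P>(\<omega> in M. \<forall>k\<le>n. X (t k) \<omega> = x k) * P (t (Suc n) - t n) (x n) (x (Suc n))"
      by (intro markov) blast+
    moreover have "{\<omega> \<in> space M. X (t (Suc n)) \<omega> = x (Suc n) \<and> (\<forall>k\<le>n. X (t k) \<omega> = x k)} =
        {\<omega> \<in> space M. \<forall>k\<le>Suc n. X (t k) \<omega> = x k}"
      unfolding all_le_Suc by blast
    ultimately show "\<P>(\<omega> in M. X (t (Suc n)) \<omega> = x (Suc n) \<bar> \<forall>k\<le>n. X (t k) \<omega> = x k) =
        P (t (Suc n) - t n) (x n) (x (Suc n))"
      using nz by (simp only: cond_prob_def) simp
  qed (use X_meas tf in blast)+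
  moreover have "discrete_markov_chain M S (jump_matrix H) (jump_chain X)"
  proof (rule R.discrete_markov_chain_jump_chain[where Q = "rate_matrix H"])
    show "rate_matrix H x x < 0" if "x \<in> S" for x
      using rate_diag[OF that] deg_sum[OF that] by simp
    show "jump_chain X n \<in> M \<rightarrow>\<^sub>M count_space S" for n
      by (rule measurable_jump_chain[OF fin X_pair X_rc])
    show "jump_matrix H x y = (if x = y then 0 else rate_matrix H x y / - rate_matrix H x x)"
      if "x \<in> S" "y \<in> S" for x y
      using jump_matrix_cart_power[of x m y] loop[OF that(1)] rate_diag[OF that(1)] that
      by (auto simp: H_def S_def rate_matrix_def[of _ x y] deg_matrix_def diag_def)
  qed (rule deriv)
  moreover have "\<forall>v\<in>S. \<forall>u\<in>S. jump_matrix H v u = frontier_matrix G m v u"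
    using jump_matrix_eq_frontier_matrix[OF assms(3) deg_pos] by (simp add: S_def H_def)
  ultimately show ?thesis unfolding X_def S_def H_def by blast
qed

end
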